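(* Let $\psi$ be an increasing slowly varying function with $\psi(x)\gg\log x$. Let $f$ be a positive, locally integrable real function on $[1,\infty)$ satisfying: (i) $(x\psi(x))^{1/h}\ll f(x)\ll\min\{(x\psi(x))^{1/(h-1)},\,x\}$; and (ii) $\int_1^x \frac{f(t)}{t}\,dt\asymp f(x)$. Then there exists $A\subseteq\mathbb{Z}_{\ge0}$ such that $|A\cap[1,x]|\asymp f(x)$ and $r_{A,h}(n)\asymp f(n)^h/n$.
   Context: Fix an integer $h\ge 2$ and positive integers $b_1,\dots,b_h$, not necessarily distinct, with $\gcd(b_1,\dots,b_h)=1$. For $A\subseteq\mathbb{Z}_{\ge 0}$, $1\le\ell\le h$ and an integer $n\ge 0$, let $r_{A,\ell}(n)$ be the number of $\ell$-tuples $(k_1,\dots,k_\ell)\in A^\ell$ with $b_1k_1+\cdots+b_\ell k_\ell=n$. A function $\psi$ is slowly varying if it is positive and measurable and $\psi(\lambda x)/\psi(x)\to1$ as $x\to\infty$ for every real $\lambda>0$. Asymptotic notation: $X\ll Y$ means $|X|\le CY$ for some constant $C>0$ and all sufficiently large values of the variable. $X\asymp Y$ means $X\ll Y$ and $Y\ll X$. *)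

theory Defs
  imports "HOL-Analysis.Analysis" "HOL-Library.Landau_Symbols"
begin

text \<open>r_{A,l}(n): number of l-tuples (k_1,...,k_l) in A^l with b_1 k_1 + ... + b_l k_l = n.
  Tuples are represented as functions on {1..l}, extended by 0 outside.\<close>
definition rep_count :: "(nat \<Rightarrow> nat) \<Rightarrow> nat set \<Rightarrow> nat \<Rightarrow> nat \<Rightarrow> nat" where
  "rep_count b A l n = card {k :: nat \<Rightarrow> nat.
      (\<forall>i. i \<notin> {1..l} \<longrightarrow> k i = 0) \<and> (\<forall>i\<in>{1..l}. k i \<in> A) \<and>
      (\<Sum>i=1..l. b i * k i) = n}"

definition slowly_varying :: "(real \<Rightarrow> real) \<Rightarrow> bool" where
  "slowly_varying \<psi> \<longleftrightarrow> (\<forall>x\<ge>1. \<psi> x > 0) \<and> set_borel_measurable lborel {1..} \<psi> \<and>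
     (\<forall>c>0. ((\<lambda>x. \<psi> (c * x) / \<psi> x) \<longlongrightarrow> 1) at_top)"

end

theory Submission
  imports Defs
begin

text \<open>
  Replace \<open>f\<close> by \<open>F x = integral {1..x} (f t / t)\<close>, which is increasing and doubling and grows at least
  like a power, and let every \<open>k\<close> belong to \<open>A\<close> with probability \<open>p k = G k / k\<close>, where
  \<open>G n = min n (K * F n)\<close> and \<open>K\<close> is a large constant.  A representation of \<open>n\<close> is sorted by its largest
  entry \<open>k\<close>: the number \<open>w k\<close> of representations with largest entry \<open>k\<close> depends only on the members of
  \<open>A\<close> below \<open>k\<close>, so the number of representations, \<open>\<Sum>k\<in>A. w k\<close>, satisfies a martingale Chernoff bound
  around \<open>\<Sum>k. p k * w k\<close>.  Since \<open>k\<close> has the order of magnitude of \<open>n\<close>, the latter sum is of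
  order \<open>p n\<close> times the number of choices of the remaining entries, which is controlled by the counting
  function of \<open>A\<close> alone.  The size of the individual \<open>w k\<close> is controlled by the same inequality for fewer
  summands: with at most \<open>h - 2\<close> summands (and with \<open>h - 1\<close> summands at integers where \<open>G\<close> is small) the
  number of representations is bounded, with \<open>h - 1\<close> summands it is \<open>O(\<psi>)\<close>.

  No probability space is needed: the exponential moments are supermartingales, so membership in \<open>A\<close> can
  be decided for one \<open>k\<close> after the other without increasing a weighted sum of all of them.
\<close>

subsection \<open>Derandomised exponential moment bounds\<close>

text \<open>If \<open>f\<close> is near its lower limit and \<open>\<psi>\<close> is of order log,
  the expected number of representations of n is itself only of order \<open>ln n\<close>, no larger
  than the error \<open>3 * ln (real n)\<close> that a union bound over all n costs. The lower bound
  survives only if the mean beats this error by a large factor \<open>L\<close>. The rescaling by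
  \<open>K\<close> supplies it, without circularity: at integers where \<open>G\<close> is small,
  the counts with h - 1 summands are bounded by \<open>Q ^ h\<close>, which does not depend on
  \<open>K\<close>. The upper bound has the opposite difficulty: at such n the weights
  \<open>w k\<close> can be as large as \<open>\<psi> n\<close>, so a multiplier of order
  \<open>ln n / \<mu> n\<close> can produce exponentials as large as a power of n. Oversized weights
  come only from remainders below n^(1-\<delta>), and the exponent \<open>\<sigma>\<close> is chosen
  so that the drop of \<open>G\<close> from n to n^(1-\<delta>) outweighs them. The function
  \<open>f\<close> is replaced because it need not be monotone, whereas comparing \<open>p k\<close>
  with \<open>p n\<close> for all k of the order of n uses monotonicity and doubling.\<close>

lemma derandomization:
  fixes p :: "nat \<Rightarrow> real" and u :: "'j \<Rightarrow> nat \<Rightarrow> nat set \<Rightarrow> real" and a :: "'j \<Rightarrow> real"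
  assumes p01: "\<And>k. 0 \<le> p k" "\<And>k. p k \<le> 1"
    and pred: "\<And>j k X. j \<in> J \<Longrightarrow> u j k X = u j k (X \<inter> {..<k})"
    and a: "\<And>j. j \<in> J \<Longrightarrow> 0 \<le> a j"
    and suma: "\<And>F. finite F \<Longrightarrow> F \<subseteq> J \<Longrightarrow> sum a F < 1"
  shows "\<exists>A. (\<forall>k\<in>A. p k > 0) \<and> (\<forall>j\<in>J. \<forall>n. a j *
    exp (\<Sum>k<n. (if k \<in> A then u j k A else 0) - p k * (exp (u j k A) - 1)) < 1)"
proof -
  \<comment> \<open>This is the exponential supermartingale: deciding on \<open>n\<close> with
    probability \<open>p n\<close> multiplies it on average by
    \<open>(1 + p n * g) * exp (- p n * g) \<le> 1\<close>, where
    \<open>g = exp (u j n X) - 1\<close>.\<close>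
  define M where "M j n X =
    exp (\<Sum>k<n. (if k \<in> X then u j k X else 0) - p k * (exp (u j k X) - 1))" for j n X
  \<comment> \<open>\<open>J\<close> may be infinite, so the invariant bounds every finite partial
    sum and no convergence question arises.\<close>
  define P where "P n X \<longleftrightarrow> X \<subseteq> {..<n} \<and> (\<forall>k\<in>X. p k > 0) \<and>
    (\<forall>F. finite F \<and> F \<subseteq> J \<longrightarrow> (\<Sum>j\<in>F. a j * M j n X) < 1)" for n X
  have Mcong: "M j n X = M j n Y" if "j \<in> J" "X \<inter> {..<n} = Y \<inter> {..<n}" for j n X Y
  proof -
    have "u j k X = u j k Y" if "k < n" for k
    proof -
      have "Z \<inter> {..<k} = (Z \<inter> {..<n}) \<inter> {..<k}" for Z :: "nat set" using \<open>k < n\<close> by auto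
      then have "X \<inter> {..<k} = Y \<inter> {..<k}" using \<open>X \<inter> {..<n} = Y \<inter> {..<n}\<close> by metis
      then show ?thesis using pred[OF \<open>j \<in> J\<close>] by metis
    qed
    moreover have "k \<in> X \<longleftrightarrow> k \<in> Y" if "k < n" for k
      using that \<open>X \<inter> {..<n} = Y \<inter> {..<n}\<close> by auto
    ultimately show ?thesis unfolding M_def by (intro arg_cong[where f=exp] sum.cong) auto
  qed
  have step: "\<exists>Y. P (Suc n) Y \<and> Y \<inter> {..<n} = X" if PX: "P n X" for n X
  proof (rule ccontr)
    assume neg: "\<not> ?thesis"
    have Xsub: "X \<subseteq> {..<n}" and Xp: "\<forall>k\<in>X. p k > 0"
      and Xs: "\<And>F. finite F \<Longrightarrow> F \<subseteq> J \<Longrightarrow> (\<Sum>j\<in>F. a j * M j n X) < 1"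
      using PX by (auto simp: P_def)
    have nX: "n \<notin> X" using Xsub by auto
    let ?g = "\<lambda>j. exp (u j n X) - 1"
    have Mout: "M j (Suc n) X = M j n X * exp (- p n * ?g j)" for j
      using nX by (simp add: M_def exp_add[symmetric])
    have Min: "M j (Suc n) (insert n X) = M j n X * (exp (u j n X) * exp (- p n * ?g j))"
      if "j \<in> J" for j
    proof -
      have "M j n (insert n X) = M j n X" using Xsub by (intro Mcong that) auto
      moreover have "u j n (insert n X) = u j n X"
        using pred[OF that, of n "insert n X"] pred[OF that, of n X] by simp
      ultimately show ?thesis by (simp add: M_def exp_add[symmetric])
    qed
    have avg: "p n * M j (Suc n) (insert n X) + (1 - p n) * M j (Suc n) X \<le> M j n X"
      if "j \<in> J" for j
    proof -
      have "1 + p n * ?g j \<le> exp (p n * ?g j)" by (rule exp_ge_add_one_self)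
      then have "(1 + p n * ?g j) * exp (- (p n * ?g j)) \<le> exp (p n * ?g j) * exp (- (p n * ?g j))"
        by (intro mult_right_mono) auto
      also have "\<dots> = 1" by (simp add: exp_add[symmetric])
      finally have le: "(1 + p n * ?g j) * exp (- (p n * ?g j)) \<le> 1" .
      have "p n * M j (Suc n) (insert n X) + (1 - p n) * M j (Suc n) X
          = M j n X * ((1 + p n * ?g j) * exp (- (p n * ?g j)))"
        unfolding Min[OF that] Mout by (simp add: algebra_simps)
      also have "\<dots> \<le> M j n X * 1" using le by (intro mult_left_mono) (auto simp: M_def)
      finally show ?thesis by simp
    qed
    have nonneg: "0 \<le> a j * M j k Y" if "j \<in> J" for j k Y using a[OF that] by (simp add: M_def)
    have "\<not> P (Suc n) X" using neg Xsub by blast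
    then obtain F1 where F1: "finite F1" "F1 \<subseteq> J" "(\<Sum>j\<in>F1. a j * M j (Suc n) X) \<ge> 1"
      using Xsub Xp by (auto simp: P_def not_less intro: less_SucI)
    have F2: "\<exists>F2. finite F2 \<and> F2 \<subseteq> J \<and> (p n > 0 \<longrightarrow> (\<Sum>j\<in>F2. a j * M j (Suc n) (insert n X)) \<ge> 1)"
    proof (cases "p n > 0")
      case True
      have "\<not> P (Suc n) (insert n X)" using neg Xsub by auto
      then show ?thesis using Xsub Xp True by (auto simp: P_def not_less intro: less_SucI)
    qed auto
    then obtain F2 where F2: "finite F2" "F2 \<subseteq> J"
      "p n > 0 \<Longrightarrow> (\<Sum>j\<in>F2. a j * M j (Suc n) (insert n X)) \<ge> 1" by blast
    \<comment> \<open>Each rejected choice comes with its own violating finite family. All terms are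
      nonnegative, so both choices violate the bound on the union, and averaging them contradicts
      the invariant at \<open>n\<close>. If \<open>p n = 0\<close>, only the choice of leaving out
      \<open>n\<close> is tested.\<close>
    let ?F = "F1 \<union> F2"
    have FJ: "finite ?F" "?F \<subseteq> J" using F1 F2 by auto
    have out: "(\<Sum>j\<in>?F. a j * M j (Suc n) X) \<ge> 1"
      using F1(3) by (rule order_trans) (intro sum_mono2 FJ nonneg, use FJ in auto)
    have inn: "p n * (\<Sum>j\<in>?F. a j * M j (Suc n) (insert n X)) \<ge> p n * 1"
    proof (cases "p n > 0")
      case True
      have "1 \<le> (\<Sum>j\<in>?F. a j * M j (Suc n) (insert n X))"
        using F2(3)[OF True] by (rule order_trans) (intro sum_mono2 FJ nonneg, use FJ in auto)
      then show ?thesis using True by (intro mult_left_mono) auto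
    next
      case False
      then have "p n = 0" using p01(1)[of n] by linarith
      then show ?thesis by simp
    qed
    have "1 \<le> p n * (\<Sum>j\<in>?F. a j * M j (Suc n) (insert n X)) + (1 - p n) * (\<Sum>j\<in>?F. a j * M j (Suc n) X)"
    proof -
      have "(1 - p n) * 1 \<le> (1 - p n) * (\<Sum>j\<in>?F. a j * M j (Suc n) X)"
        using out p01(2)[of n] by (intro mult_left_mono) auto
      from add_mono[OF inn this] show ?thesis by simp
    qed
    also have "\<dots> = (\<Sum>j\<in>?F. a j * (p n * M j (Suc n) (insert n X) + (1 - p n) * M j (Suc n) X))"
      by (simp add: sum_distrib_left sum.distrib[symmetric] distrib_left mult.left_commute)
    also have "\<dots> \<le> (\<Sum>j\<in>?F. a j * M j n X)"
      using avg a FJ by (intro sum_mono mult_left_mono) auto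
    also have "\<dots> < 1" using Xs[OF FJ] .
    finally show False by simp
  qed
  have P0: "P 0 {}"
    using suma by (auto simp: P_def M_def)
  have "\<exists>X. \<forall>n. P n (X n) \<and> X (Suc n) \<inter> {..<n} = X n"
    using dependent_nat_choice[of P "\<lambda>n X Y. Y \<inter> {..<n} = X"] P0 step by blast
  then obtain X where X: "\<And>n. P n (X n)" "\<And>n. X (Suc n) \<inter> {..<n} = X n" by blast
  have Xsub: "X n \<subseteq> {..<n}" for n using X(1)[of n] by (simp add: P_def)
  have coh: "X (m + d) \<inter> {..<m} = X m" for m d
  proof (induction d)
    case 0
    then show ?case using Xsub[of m] by auto
  next
    case (Suc d)
    have "X (Suc (m + d)) \<inter> {..<m} = (X (Suc (m + d)) \<inter> {..<m+d}) \<inter> {..<m}" by auto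
    then show ?case using X(2)[of "m+d"] Suc by simp
  qed
  define A where "A = (\<Union>n. X n)"
  have AX: "A \<inter> {..<n} = X n \<inter> {..<n}" for n
  proof -
    have "k \<in> X n" if "k \<in> X m" "k < n" for k m
    proof (cases "m \<le> n")
      case True
      then show ?thesis using coh[of m "n - m"] that by auto
    next
      case False
      then show ?thesis using coh[of n "m - n"] that by auto
    qed
    then show ?thesis by (auto simp: A_def)
  qed
  show ?thesis
  proof (intro exI[of _ A] conjI ballI allI)
    fix k assume "k \<in> A"
    then show "p k > 0" using X(1) by (auto simp: A_def P_def)
  next
    fix j n assume j: "j \<in> J"
    have "a j * M j n (X n) < 1"
      using X(1)[of n] j unfolding P_def by (auto dest!: spec[of _ "{j}"])
    moreover have "M j n A = M j n (X n)" by (rule Mcong[OF j AX])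
    ultimately show "a j * exp (\<Sum>k<n. (if k \<in> A then u j k A else 0) - p k * (exp (u j k A) - 1)) < 1"
      by (simp add: M_def)
  qed
qed

lemma sum_inverse_cube_tail:
  fixes k0 N :: nat
  assumes "k0 \<ge> 2"
  shows "(\<Sum>n\<in>{k0..<N}. 1 / real n ^ 3) \<le> 1 / (real k0 - 1) "
proof -
  \<comment> \<open>The subtracted term makes the induction telescope, by way of
    \<open>1 / N ^ 3 \<le> 1 / (N - 1) - 1 / N\<close>.\<close>
  have "(\<Sum>n\<in>{k0..<N}. 1 / real n ^ 3) \<le> 1 / (real k0 - 1) - (if N \<ge> k0 then 1 / (real N - 1) else 0)"
  proof (induction N)
    case 0
    then show ?case using assms by simp
  next
    case (Suc N)
    show ?case
    proof (cases "Suc N \<le> k0")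
      case True
      then show ?thesis using assms by (cases "Suc N = k0") auto
    next
      case False
      then have N: "k0 \<le> N" "real N \<ge> 2" using assms by auto
      have "1 / real N ^ 3 \<le> 1 / (real N * (real N - 1))"
      proof (intro divide_left_mono)
        have "real N * (real N - 1) \<le> real N * real N * 1" using N by (auto intro!: mult_left_mono)
        also have "\<dots> \<le> real N * real N * real N" using N by (intro mult_left_mono) auto
        finally show "real N * (real N - 1) \<le> real N ^ 3" by (simp add: power3_eq_cube)
      qed (use N in auto)
      also have "\<dots> = 1 / (real N - 1) - 1 / real N" using N by (simp add: field_simps)
      finally have "1 / real N ^ 3 \<le> 1 / (real N - 1) - 1 / real N" .
      then show ?thesis using Suc N by (simp add: sum.atLeastLessThan_Suc)
    qed
  qed
  also have "\<dots> \<le> 1 / (real k0 - 1)" using assms by auto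
  finally show ?thesis .
qed

text \<open>Weighting each pair of a family and a target n by \<open>1 / n ^ 3\<close> gives total
  weight at most \<open>card T / (k0 - 1) < 1\<close>. Taking logarithms turns the weight into the
  error \<open>3 * ln (real n)\<close>.\<close>

lemma simultaneous_exponential_bounds:
  fixes p :: "nat \<Rightarrow> real" and T :: "(nat \<Rightarrow> nat \<Rightarrow> nat set \<Rightarrow> real) set"
  assumes p01: "\<And>k. 0 \<le> p k" "\<And>k. p k \<le> 1"
    and fin: "finite T" and k0: "k0 \<ge> card T + 3"
    and pred: "\<And>U n k X. U \<in> T \<Longrightarrow> U n k X = U n k (X \<inter> {..<k})"
  shows "\<exists>A. (\<forall>k\<in>A. p k > 0) \<and> (\<forall>U\<in>T. \<forall>n\<ge>k0. \<forall>N.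
    (\<Sum>k<N. (if k \<in> A then U n k A else 0) - p k * (exp (U n k A) - 1)) \<le> 3 * ln (real n))"
proof -
  let ?J = "T \<times> {k0..}"
  let ?a = "\<lambda>j :: (nat \<Rightarrow> nat \<Rightarrow> nat set \<Rightarrow> real) \<times> nat. 1 / real (snd j) ^ 3"
  have "\<exists>A. (\<forall>k\<in>A. p k > 0) \<and> (\<forall>j\<in>?J. \<forall>N. ?a j *
    exp (\<Sum>k<N. (if k \<in> A then (fst j) (snd j) k A else 0) - p k * (exp ((fst j) (snd j) k A) - 1)) < 1)"
  proof (rule derandomization[where J="?J"])
    show "fst j (snd j) k X = fst j (snd j) k (X \<inter> {..<k})" if "j \<in> ?J" for j k X
      using pred[of "fst j"] that by (cases j) auto
    fix F assume F: "finite F" "F \<subseteq> ?J"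
    define N where "N = Suc (Max (insert 0 (snd ` F)))"
    have "F \<subseteq> T \<times> {k0..<N}"
    proof
      fix j assume j: "j \<in> F"
      then have "snd j \<le> Max (insert 0 (snd ` F))" using F by (intro Max_ge) auto
      then show "j \<in> T \<times> {k0..<N}" using j F by (cases j) (auto simp: N_def)
    qed
    then have "sum ?a F \<le> sum ?a (T \<times> {k0..<N})"
      using fin by (intro sum_mono2) auto
    also have "\<dots> = (\<Sum>U\<in>T. \<Sum>n\<in>{k0..<N}. 1 / real n ^ 3)"
      by (simp only: sum.cartesian_product case_prod_unfold)
    also have "\<dots> \<le> real (card T) * (1 / (real k0 - 1))"
      using sum_inverse_cube_tail[of k0 N] k0 by (simp only: sum_constant) (intro mult_left_mono, auto)
    also have "\<dots> < 1" using k0 by (simp add: field_simps)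
    finally show "sum ?a F < 1" .
  qed (use p01 in auto)
  then obtain A where A: "\<forall>k\<in>A. p k > 0" and
    AJ: "\<forall>j\<in>?J. \<forall>N. ?a j *
    exp (\<Sum>k<N. (if k \<in> A then (fst j) (snd j) k A else 0) - p k * (exp ((fst j) (snd j) k A) - 1)) < 1"
    by blast
  have *: "1 / real n ^ 3 *
    exp (\<Sum>k<N. (if k \<in> A then U n k A else 0) - p k * (exp (U n k A) - 1)) < 1"
    if "U \<in> T" "n \<ge> k0" for U n N
    using spec[OF bspec[OF AJ, of "(U, n)"], of N] that by (auto cong: if_cong)
  have "(\<Sum>k<N. (if k \<in> A then U n k A else 0) - p k * (exp (U n k A) - 1)) \<le> 3 * ln (real n)" (is "?s \<le> _")
    if "U \<in> T" "n \<ge> k0" for U n N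
  proof -
    have n: "real n > 0" using that k0 by auto
    have "exp ?s < real n ^ 3" using *[OF that, of N] n
      by (simp only: times_divide_eq_left mult_1 divide_less_eq zero_less_power if_True)
    also have "\<dots> = exp (3 * ln (real n))" using n by (simp add: exp_of_nat_mult[of 3, simplified])
    finally show ?thesis by simp
  qed
  then show ?thesis using A by blast
qed

subsection \<open>Counting representations by their largest entry\<close>

text \<open>Arbitrary index sets are needed because deleting the positions of the largest entry
  leaves a set that is not an initial segment. The value 0 outside \<open>J\<close> makes a tuple
  determined by its entries on \<open>J\<close>.\<close>

definition tuples :: "(nat \<Rightarrow> nat) \<Rightarrow> nat set \<Rightarrow> nat set \<Rightarrow> nat \<Rightarrow> (nat \<Rightarrow> nat) set" where
  "tuples b J A n = {k. (\<forall>i. i \<notin> J \<longrightarrow> k i = 0) \<and> (\<forall>i\<in>J. k i \<in> A) \<and> (\<Sum>i\<in>J. b i * k i) = n}"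

definition reps :: "(nat \<Rightarrow> nat) \<Rightarrow> nat set \<Rightarrow> nat set \<Rightarrow> nat \<Rightarrow> nat" where
  "reps b J A n = card (tuples b J A n)"

lemma rep_count_eq_reps: "rep_count b A h n = reps b {1..h} A n"
  by (simp add: rep_count_def reps_def tuples_def)

lemma card_zero_extended_PiE:
  fixes B :: "'i \<Rightarrow> nat set"
  assumes "finite I"
  shows "card {k :: 'i \<Rightarrow> nat. (\<forall>i. i \<notin> I \<longrightarrow> k i = 0) \<and> (\<forall>i\<in>I. k i \<in> B i)} = (\<Prod>i\<in>I. card (B i))"
proof -
  have "bij_betw (\<lambda>k. restrict k I) {k :: 'i \<Rightarrow> nat. (\<forall>i. i \<notin> I \<longrightarrow> k i = 0) \<and> (\<forall>i\<in>I. k i \<in> B i)} (PiE I B)"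
    by (rule bij_betwI[where g="\<lambda>k i. if i \<in> I then k i else 0"]) (auto simp: fun_eq_iff PiE_def extensional_def)
  then show ?thesis using card_PiE[OF assms, of B] by (simp add: bij_betw_same_card)
qed

lemma finite_zero_extended_PiE:
  fixes B :: "'i \<Rightarrow> nat set"
  assumes "finite I" "\<And>i. i \<in> I \<Longrightarrow> finite (B i)"
  shows "finite {k :: 'i \<Rightarrow> nat. (\<forall>i. i \<notin> I \<longrightarrow> k i = 0) \<and> (\<forall>i\<in>I. k i \<in> B i)}"
proof -
  have "{k :: 'i \<Rightarrow> nat. (\<forall>i. i \<notin> I \<longrightarrow> k i = 0) \<and> (\<forall>i\<in>I. k i \<in> B i)}
      \<subseteq> (\<lambda>k i. if i \<in> I then k i else 0) ` PiE I B"
  proof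
    fix k :: "'i \<Rightarrow> nat" assume k: "k \<in> {k. (\<forall>i. i \<notin> I \<longrightarrow> k i = 0) \<and> (\<forall>i\<in>I. k i \<in> B i)}"
    then have "k = (\<lambda>i. if i \<in> I then restrict k I i else 0)" by (auto simp: fun_eq_iff)
    moreover have "restrict k I \<in> PiE I B" using k by auto
    ultimately show "k \<in> (\<lambda>k i. if i \<in> I then k i else 0) ` PiE I B" by blast
  qed
  then show ?thesis using finite_PiE[OF assms] by (meson finite_imageI finite_subset)
qed

lemma tuple_entry_le:
  assumes "finite J" "k \<in> tuples b J A n" "i \<in> J" "b i > 0"
  shows "k i \<le> n"
proof -
  have "k i \<le> b i * k i" using assms by simp
  also have "\<dots> \<le> (\<Sum>i\<in>J. b i * k i)" using assms by (intro member_le_sum) auto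
  finally show ?thesis using assms by (simp add: tuples_def)
qed

lemma finite_tuples:
  assumes "finite J" "\<forall>i\<in>J. b i > 0"
  shows "finite (tuples b J A n)"
proof (rule finite_subset)
  show "tuples b J A n \<subseteq> {k. (\<forall>i. i \<notin> J \<longrightarrow> k i = 0) \<and> (\<forall>i\<in>J. k i \<in> {..n})}"
    using tuple_entry_le[OF assms(1)] assms(2) by (auto simp: tuples_def)
qed (rule finite_zero_extended_PiE, use assms in auto)

lemma reps_mono:
  assumes "finite J" "\<forall>i\<in>J. b i > 0" "A \<subseteq> A'"
  shows "reps b J A n \<le> reps b J A' n"
  unfolding reps_def by (intro card_mono finite_tuples assms) (use assms in \<open>auto simp: tuples_def\<close>)

lemma reps_pos_lower:
  assumes "reps b J A n > 0" "J \<noteq> {}" "finite J" "\<forall>i\<in>J. b i > 0" "\<forall>k\<in>A. k \<ge> m"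
  shows "n \<ge> m"
proof -
  obtain k where k: "k \<in> tuples b J A n" using assms(1) by (auto simp: reps_def card_gt_0_iff)
  obtain i where i: "i \<in> J" using assms by auto
  have "m \<le> k i" using k i assms by (auto simp: tuples_def)
  also have "\<dots> \<le> n" using tuple_entry_le[OF assms(3) k i] assms i by auto
  finally show ?thesis .
qed

lemma reps_empty_index: "reps b {} A n \<le> 1"
proof -
  have "tuples b {} A n \<subseteq> {\<lambda>_. 0}" by (auto simp: tuples_def)
  then have "card (tuples b {} A n) \<le> card {(\<lambda>_. 0) :: nat \<Rightarrow> nat}" by (intro card_mono) auto
  then show ?thesis by (simp add: reps_def)
qed

text \<open>Tuples with different sums are different, and every entry of a tuple with sum at most
  \<open>M\<close> is itself at most \<open>M\<close>, since all coefficients are at least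
  1.\<close>

lemma sum_reps_le:
  assumes "finite J" "\<forall>i\<in>J. b i > 0"
  shows "(\<Sum>m\<le>M. reps b J A m) \<le> card (A \<inter> {..M}) ^ card J"
proof -
  have "(\<Sum>m\<le>M. reps b J A m) = card (\<Union>m\<le>M. tuples b J A m)"
    unfolding reps_def
    by (subst card_UN_disjoint) (auto simp: finite_tuples assms, auto simp: tuples_def)
  also have "\<dots> \<le> card {k. (\<forall>i. i \<notin> J \<longrightarrow> k i = 0) \<and> (\<forall>i\<in>J. k i \<in> A \<inter> {..M})}"
  proof (intro card_mono finite_zero_extended_PiE)
    show "(\<Union>m\<le>M. tuples b J A m) \<subseteq> {k. (\<forall>i. i \<notin> J \<longrightarrow> k i = 0) \<and> (\<forall>i\<in>J. k i \<in> A \<inter> {..M})}"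
    proof
      fix k assume "k \<in> (\<Union>m\<le>M. tuples b J A m)"
      then obtain m where m: "m \<le> M" "k \<in> tuples b J A m" by auto
      then have "k i \<le> M" if "i \<in> J" for i
        using tuple_entry_le[OF assms(1) m(2) that] assms that by fastforce
      then show "k \<in> {k. (\<forall>i. i \<notin> J \<longrightarrow> k i = 0) \<and> (\<forall>i\<in>J. k i \<in> A \<inter> {..M})}"
        using m by (auto simp: tuples_def)
    qed
  qed (use assms in auto)
  also have "\<dots> = card (A \<inter> {..M}) ^ card J"
    using card_zero_extended_PiE[OF assms(1), of "\<lambda>_. A \<inter> {..M}"] by simp
  finally show ?thesis .
qed

text \<open>The number of representations of \<open>n\<close> whose largest entry is \<open>k\<close>, attained exactly on the
  index set \<open>S\<close>, while the entries on \<open>J\<close> are smaller members of \<open>X\<close>.\<close>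

definition top_reps :: "(nat \<Rightarrow> nat) \<Rightarrow> nat set \<Rightarrow> nat set \<Rightarrow> nat \<Rightarrow> nat \<Rightarrow> nat set \<Rightarrow> nat" where
  "top_reps b J S n k X = (if sum b S * k \<le> n then reps b J (X \<inter> {..<k}) (n - sum b S * k) else 0)"

lemma top_reps_predictable: "top_reps b J S n k (X \<inter> {..<k}) = top_reps b J S n k X"
  by (simp add: top_reps_def Int_assoc)

text \<open>A tuple is recovered from its maximum \<open>k\<close>, the nonempty set
  \<open>S\<close> of positions attaining it, and its restriction to \<open>I - S\<close>. Recording
  the whole set \<open>S\<close> accounts for ties and makes the remaining entries strictly smaller
  than \<open>k\<close>.\<close>

lemma reps_le_sum_top_reps:
  assumes I: "finite I" "I \<noteq> {}" "\<forall>i\<in>I. b i > 0"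
  shows "reps b I A n \<le> (\<Sum>S\<in>Pow I - {{}}. \<Sum>k\<in>A \<inter> {..n}. top_reps b (I - S) S n k A)"
proof -
  define P where "P S k = (if sum b S * k \<le> n then
     (\<lambda>\<kappa> i. if i \<in> S then k else \<kappa> i) ` tuples b (I - S) (A \<inter> {..<k}) (n - sum b S * k) else {})" for S k
  have fin: "finite (P S k)" for S k
    unfolding P_def using I by (auto intro!: finite_imageI finite_tuples)
  have cardP: "card (P S k) \<le> top_reps b (I - S) S n k A" for S k
    unfolding P_def top_reps_def reps_def using I by (auto intro!: card_image_le finite_tuples)
  have "tuples b I A n \<subseteq> (\<Union>S\<in>Pow I - {{}}. \<Union>k\<in>A \<inter> {..n}. P S k)"
  proof
    fix \<kappa> assume \<kappa>: "\<kappa> \<in> tuples b I A n"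
    define k where "k = Max (\<kappa> ` I)"
    define S where "S = {i\<in>I. \<kappa> i = k}"
    have "k \<in> \<kappa> ` I" unfolding k_def using I by (intro Max_in) auto
    then obtain i where i: "i \<in> I" "\<kappa> i = k" by auto
    have le: "\<kappa> j \<le> k" if "j \<in> I" for j unfolding k_def using I that by (intro Max_ge) auto
    have S: "S \<subseteq> I" "S \<noteq> {}" using i by (auto simp: S_def)
    have kA: "k \<in> A" using \<kappa> i by (auto simp: tuples_def)
    have kn: "k \<le> n" using tuple_entry_le[OF I(1) \<kappa> i(1)] I(3) i by auto
    have "n = (\<Sum>i\<in>I. b i * \<kappa> i)" using \<kappa> by (simp add: tuples_def)
    also have "\<dots> = (\<Sum>i\<in>I - S. b i * \<kappa> i) + (\<Sum>i\<in>S. b i * \<kappa> i)"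
      using I S by (intro sum.subset_diff) auto
    also have "(\<Sum>i\<in>S. b i * \<kappa> i) = sum b S * k"
      by (simp add: sum_distrib_right S_def)
    finally have n: "n = (\<Sum>i\<in>I - S. b i * \<kappa> i) + sum b S * k" .
    let ?\<kappa> = "\<lambda>i. if i \<in> S then 0 else \<kappa> i"
    have "?\<kappa> \<in> tuples b (I - S) (A \<inter> {..<k}) (n - sum b S * k)"
    proof -
      have "?\<kappa> j \<in> A \<inter> {..<k}" if "j \<in> I - S" for j
        using that le[of j] \<kappa> by (auto simp: S_def tuples_def)
      moreover have "(\<Sum>i\<in>I - S. b i * ?\<kappa> i) = (\<Sum>i\<in>I - S. b i * \<kappa> i)"
        by (intro sum.cong) auto
      then have "(\<Sum>i\<in>I - S. b i * ?\<kappa> i) = n - sum b S * k" using n by simp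
      ultimately show ?thesis using \<kappa> by (auto simp: tuples_def)
    qed
    moreover have "\<kappa> = (\<lambda>i. if i \<in> S then k else ?\<kappa> i)" by (auto simp: fun_eq_iff S_def)
    ultimately have "\<kappa> \<in> P S k" using n unfolding P_def by auto
    then show "\<kappa> \<in> (\<Union>S\<in>Pow I - {{}}. \<Union>k\<in>A \<inter> {..n}. P S k)" using S kA kn by auto
  qed
  then have "reps b I A n \<le> card (\<Union>S\<in>Pow I - {{}}. \<Union>k\<in>A \<inter> {..n}. P S k)"
    unfolding reps_def using I fin by (intro card_mono) auto
  also have "\<dots> \<le> (\<Sum>S\<in>Pow I - {{}}. card (\<Union>k\<in>A \<inter> {..n}. P S k))"
    using I by (intro card_UN_le) auto
  also have "\<dots> \<le> (\<Sum>S\<in>Pow I - {{}}. \<Sum>k\<in>A \<inter> {..n}. card (P S k))"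
    by (intro sum_mono card_UN_le) auto
  also have "\<dots> \<le> (\<Sum>S\<in>Pow I - {{}}. \<Sum>k\<in>A \<inter> {..n}. top_reps b (I - S) S n k A)"
    using cardP by (intro sum_mono)
  finally show ?thesis .
qed

text \<open>No entry exceeds \<open>k\<close>, so the largest entry is at least a fixed fraction of
  \<open>n\<close>; this is what makes \<open>p k\<close> comparable with
  \<open>p n\<close>.\<close>

lemma top_reps_support:
  assumes "finite J" "finite S" "J \<inter> S = {}" "S \<noteq> {}" "\<forall>i\<in>S. b i > 0" "top_reps b J S n k X > 0"
  shows "k \<le> n" "n \<le> sum b (J \<union> S) * k"
proof -
  from assms(6) have le: "sum b S * k \<le> n" and "reps b J (X \<inter> {..<k}) (n - sum b S * k) > 0"
    by (auto simp: top_reps_def split: if_splits)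
  then obtain \<kappa> where \<kappa>: "\<kappa> \<in> tuples b J (X \<inter> {..<k}) (n - sum b S * k)"
    by (auto simp: reps_def card_gt_0_iff)
  have "sum b S > 0" using assms by (intro sum_pos) auto
  then have "1 * k \<le> sum b S * k" by (intro mult_le_mono1) simp
  then show "k \<le> n" using le by linarith
  have "n - sum b S * k = (\<Sum>i\<in>J. b i * \<kappa> i)" using \<kappa> by (simp add: tuples_def)
  also have "\<dots> \<le> (\<Sum>i\<in>J. b i * k)" using \<kappa> by (intro sum_mono mult_le_mono2) (fastforce simp: tuples_def)
  also have "\<dots> = sum b J * k" by (simp add: sum_distrib_right)
  finally have "n \<le> sum b J * k + sum b S * k" by simp
  then show "n \<le> sum b (J \<union> S) * k" using assms by (simp add: sum.union_disjoint algebra_simps)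
qed

text \<open>Different \<open>k\<close> leave different remainders \<open>n - sum b S * k\<close>, so
  the sum over \<open>k\<close> is a partial sum of representation counts over distinct
  \<open>m \<le> M\<close>. The bound \<open>M\<close> is required only where there is a
  contribution.\<close>

lemma sum_top_reps_le:
  assumes "finite J" "\<forall>i\<in>J. b i > 0" "finite S" "S \<noteq> {}" "\<forall>i\<in>S. b i > 0"
    and K: "finite K" "\<And>k. k \<in> K \<Longrightarrow> top_reps b J S n k A > 0 \<Longrightarrow> n - sum b S * k \<le> M"
  shows "(\<Sum>k\<in>K. top_reps b J S n k A) \<le> card (A \<inter> {..M}) ^ card J"
proof -
  have pos: "sum b S > 0" using assms by (intro sum_pos) auto
  let ?K = "{k\<in>K. top_reps b J S n k A > 0}"
  have le: "sum b S * k \<le> n" if "k \<in> ?K" for k using that by (auto simp: top_reps_def split: if_splits)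
  have inj: "inj_on (\<lambda>k. n - sum b S * k) ?K"
  proof (rule inj_onI)
    fix k k' assume "k \<in> ?K" "k' \<in> ?K" "n - sum b S * k = n - sum b S * k'"
    then have "sum b S * k = sum b S * k'" using le[of k] le[of k'] by linarith
    then show "k = k'" using pos by simp
  qed
  have "(\<Sum>k\<in>K. top_reps b J S n k A) = (\<Sum>k\<in>?K. top_reps b J S n k A)"
    using K by (intro sum.mono_neutral_right) auto
  also have "\<dots> \<le> (\<Sum>k\<in>?K. reps b J A (n - sum b S * k))"
    by (intro sum_mono) (auto simp: top_reps_def intro!: reps_mono assms)
  also have "\<dots> = (\<Sum>m\<in>(\<lambda>k. n - sum b S * k) ` ?K. reps b J A m)"
    using inj by (simp add: sum.reindex)
  also have "\<dots> \<le> (\<Sum>m\<le>M. reps b J A m)"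
    using K by (intro sum_mono2) auto
  also have "\<dots> \<le> card (A \<inter> {..M}) ^ card J" by (intro sum_reps_le assms)
  finally show ?thesis .
qed

text \<open>Writing \<open>k\<close> into position \<open>h\<close>, where the shorter tuples are 0,
  is injective, and different \<open>k\<close> give disjoint families of full tuples.\<close>

lemma sum_reps_prefix_le:
  assumes h: "h \<ge> (1::nat)" and bpos: "\<forall>i\<in>{1..h}. b i > 0"
    and K: "finite K" "K \<subseteq> A" "\<And>k. k \<in> K \<Longrightarrow> b h * k \<le> n"
    and B: "B \<subseteq> A"
  shows "(\<Sum>k\<in>K. reps b {1..<h} B (n - b h * k)) \<le> reps b {1..h} A n"
proof -
  define P where "P k = (\<lambda>\<kappa>. \<kappa>(h := k)) ` tuples b {1..<h} B (n - b h * k)" for k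
  have fin: "finite (tuples b {1..<h} B m)" for m using bpos by (intro finite_tuples) auto
  have inj: "inj_on (\<lambda>\<kappa>. \<kappa>(h := k)) (tuples b {1..<h} B m)" for k m
  proof (rule inj_onI)
    fix x y assume xy: "x \<in> tuples b {1..<h} B m" "y \<in> tuples b {1..<h} B m" "x(h := k) = y(h := k)"
    have "x h = 0" "y h = 0" using xy by (auto simp: tuples_def)
    then show "x = y" using xy(3) by (metis fun_upd_idem_iff fun_upd_upd)
  qed
  have "(\<Sum>k\<in>K. reps b {1..<h} B (n - b h * k)) = (\<Sum>k\<in>K. card (P k))"
    unfolding P_def reps_def using inj by (simp add: card_image)
  also have "\<dots> = card (\<Union>k\<in>K. P k)"
  proof (rule card_UN_disjoint[symmetric])
    show "\<forall>i\<in>K. \<forall>j\<in>K. i \<noteq> j \<longrightarrow> P i \<inter> P j = {}"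
      by (auto simp: P_def) (metis fun_upd_same)
  qed (use K fin in \<open>auto simp: P_def\<close>)
  also have "\<dots> \<le> reps b {1..h} A n"
    unfolding reps_def
  proof (intro card_mono finite_tuples)
    have split: "{1..h} = insert h {1..<h}" using h by auto
    show "(\<Union>k\<in>K. P k) \<subseteq> tuples b {1..h} A n"
    proof
      fix x assume "x \<in> (\<Union>k\<in>K. P k)"
      then obtain k \<kappa> where k: "k \<in> K" and \<kappa>: "\<kappa> \<in> tuples b {1..<h} B (n - b h * k)" and x: "x = \<kappa>(h := k)"
        by (auto simp: P_def)
      have "(\<Sum>i\<in>{1..<h}. b i * x i) = (\<Sum>i\<in>{1..<h}. b i * \<kappa> i)" by (intro sum.cong) (auto simp: x)
      then have "(\<Sum>i\<in>{1..h}. b i * x i) = n"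
        using \<kappa> K(3)[OF k] unfolding split by (simp add: x tuples_def)
      moreover have "x i \<in> A" if "i \<in> {1..h}" for i
        using that \<kappa> K k B by (cases "i = h") (auto simp: x tuples_def)
      moreover have "x i = 0" if "i \<notin> {1..h}" for i
        using that \<kappa> h by (auto simp: x tuples_def)
      ultimately show "x \<in> tuples b {1..h} A n" by (auto simp: tuples_def)
    qed
  qed (use bpos in auto)
  finally show ?thesis .
qed

section \<open>Solving the linear congruence modulo the last coefficient\<close>

lemma bezout_finite_family:
  fixes b :: "'i \<Rightarrow> nat"
  assumes "finite I"
  shows "\<exists>z :: 'i \<Rightarrow> int. (\<Sum>i\<in>I. int (b i) * z i) = int (Gcd (b ` I))"
  using assms
proof (induction I)
  case empty
  then show ?case by simp
next
  case (insert i I)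
  then obtain z where z: "(\<Sum>i\<in>I. int (b i) * z i) = int (Gcd (b ` I))" by blast
  obtain x y where xy: "x * int (b i) + y * int (Gcd (b ` I)) = gcd (int (b i)) (int (Gcd (b ` I)))"
    using bezout_int by blast
  have "(\<Sum>j\<in>insert i I. int (b j) * (if j = i then x else y * z j))
      = int (b i) * x + (\<Sum>j\<in>I. int (b j) * (if j = i then x else y * z j))"
    using insert by simp
  also have "(\<Sum>j\<in>I. int (b j) * (if j = i then x else y * z j)) = (\<Sum>j\<in>I. y * (int (b j) * z j))"
    using insert by (intro sum.cong) auto
  also have "\<dots> = y * int (Gcd (b ` I))" using z by (simp add: sum_distrib_left[symmetric])
  also have "int (b i) * x + \<dots> = int (Gcd (b ` insert i I))" using xy by (simp add: mult.commute)
  finally show ?case by (rule exI[where x="\<lambda>j. if j = i then x else y * z j"])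
qed

text \<open>With integers \<open>z i\<close> such that the combination of the \<open>b i\<close>
  equals 1, take \<open>\<rho> i\<close> to be the residue of \<open>n * z i\<close>. Then n minus
  the sum of the first h - 1 terms is congruent to \<open>n * b h * z h\<close>, hence to 0, modulo
  \<open>b h\<close>.\<close>

lemma residues_solving_congruence:
  assumes h: "h \<ge> (1::nat)" and pos: "b h > 0" and g: "Gcd (b ` {1..h}) = (1::nat)"
  shows "\<exists>\<rho>. \<forall>i. \<rho> i < b h \<and> (\<forall>k. (\<forall>i\<in>{1..<h}. k i mod b h = \<rho> i) \<longrightarrow>
    int (b h) dvd int n - (\<Sum>i\<in>{1..<h}. int (b i) * int (k i)))"
proof -
  obtain z where z: "(\<Sum>i\<in>{1..h}. int (b i) * z i) = 1"
    using bezout_finite_family[of "{1..h}" b] g by auto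
  define \<rho> where "\<rho> i = nat ((int n * z i) mod int (b h))" for i
  have \<rho>: "\<rho> i < b h" "int (\<rho> i) = (int n * z i) mod int (b h)" for i
    using pos by (auto simp: \<rho>_def nat_less_iff)
  have split: "{1..h} = insert h {1..<h}" using h by auto
  have "int (b h) dvd int n - (\<Sum>i\<in>{1..<h}. int (b i) * int (k i))"
    if k: "\<forall>i\<in>{1..<h}. k i mod b h = \<rho> i" for k
  proof -
    have d: "int (b h) dvd int n * z i - int (k i)" if "i \<in> {1..<h}" for i
    proof -
      have "int (k i) mod int (b h) = (int n * z i) mod int (b h)"
        using k that \<rho>(2)[of i] by (metis zmod_int)
      then show ?thesis by (metis mod_eq_dvd_iff)
    qed
    have "int n = int n * (\<Sum>i\<in>{1..h}. int (b i) * z i)" using z by simp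
    also have "\<dots> = int (b h) * (int n * z h) + (\<Sum>i\<in>{1..<h}. int (b i) * (int n * z i))"
      unfolding split by (simp add: algebra_simps sum_distrib_left)
    finally have "int n - (\<Sum>i\<in>{1..<h}. int (b i) * int (k i)) = int (b h) * (int n * z h)
        + (\<Sum>i\<in>{1..<h}. int (b i) * (int n * z i - int (k i)))"
      by (simp add: right_diff_distrib sum_subtractf)
    moreover have "int (b h) dvd (\<Sum>i\<in>{1..<h}. int (b i) * (int n * z i - int (k i)))"
      using d by (intro dvd_sum dvd_mult) auto
    ultimately show ?thesis by simp
  qed
  then show ?thesis using \<rho>(1) by blast
qed

section \<open>Elementary exponential inequalities and residue classes in intervals\<close>

lemma exp_minus_one_le: "exp x - 1 \<le> x * exp x" for x :: real
  using exp_ge_add_one_self[of "-x"] by (simp add: exp_minus field_simps)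

lemma exp_minus_one_le_double: "exp x - 1 \<le> 2 * x" if "0 \<le> x" "x \<le> 1" for x :: real
proof -
  have "exp x \<le> 1 + x + x\<^sup>2" using that by (rule exp_bound)
  also have "x\<^sup>2 \<le> x * 1" unfolding power2_eq_square using that by (intro mult_left_mono) auto
  finally show ?thesis by simp
qed

lemma exp_neg_minus_one_le: "exp (- x) - 1 \<le> - (x / 2)" if "0 \<le> x" "x \<le> 1" for x :: real
proof -
  have "exp (- x) \<le> 1 / (1 + x)"
    using exp_ge_add_one_self[of x] that by (simp add: exp_minus field_simps)
  also have "\<dots> \<le> 1 - x / 2"
  proof -
    have "x * x \<le> x * 1" using that by (intro mult_left_mono) auto
    then have "1 \<le> (1 - x / 2) * (1 + x)" by (simp add: algebra_simps)
    then show ?thesis using that by (simp add: divide_le_eq)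
  qed
  finally show ?thesis by simp
qed

lemma card_residue_class_interval:
  fixes q s \<rho> :: nat
  assumes "\<rho> < q"
  shows "s div q \<le> card {k. s < k \<and> k \<le> 2 * s \<and> k mod q = \<rho>}"
proof -
  \<comment> \<open>The shift from \<open>s + 1\<close> to the first member of the class. As
    \<open>t < q\<close>, the progression with step \<open>q\<close> from there has
    \<open>s div q\<close> members up to \<open>2 * s\<close>.\<close>
  define t where "t = (\<rho> + (q - (s + 1) mod q)) mod q"
  have q: "q > 0" using assms by simp
  have t: "t < q" unfolding t_def using q by simp
  have "(s + 1 + t) mod q = ((s + 1) mod q + (\<rho> + (q - (s + 1) mod q))) mod q"
    unfolding t_def by (simp only: mod_add_right_eq mod_add_left_eq)
  also have "(s + 1) mod q + (\<rho> + (q - (s + 1) mod q)) = \<rho> + q"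
    using mod_less_divisor[OF q, of "s + 1"] by linarith
  also have "(\<rho> + q) mod q = \<rho>" using assms by simp
  finally have r: "(s + 1 + t) mod q = \<rho>" .
  have "(\<lambda>j. s + 1 + t + j * q) ` {..<s div q} \<subseteq> {k. s < k \<and> k \<le> 2 * s \<and> k mod q = \<rho>}"
  proof (rule image_subsetI)
    fix j assume "j \<in> {..<s div q}"
    then have "(j + 1) * q \<le> (s div q) * q" by (intro mult_le_mono1) simp
    also have "\<dots> \<le> s" by simp
    finally have "j * q + q \<le> s" by simp
    then have "s + 1 + t + j * q \<le> 2 * s" using t by linarith
    moreover have "(s + 1 + t + j * q) mod q = \<rho>" using r by simp
    ultimately show "s + 1 + t + j * q \<in> {k. s < k \<and> k \<le> 2 * s \<and> k mod q = \<rho>}" by simp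
  qed
  then have "card ((\<lambda>j. s + 1 + t + j * q) ` {..<s div q}) \<le> card {k. s < k \<and> k \<le> 2 * s \<and> k mod q = \<rho>}"
    by (intro card_mono) auto
  moreover have "card ((\<lambda>j. s + 1 + t + j * q) ` {..<s div q}) = s div q"
    using q by (subst card_image) (auto simp: inj_on_def)
  ultimately show ?thesis by simp
qed

subsection \<open>The conditions on the growth function\<close>

text \<open>
  \<open>Q\<close>, \<open>c2\<close>, \<open>c7\<close> and hence the requirement on \<open>L\<close> depend only on \<open>h\<close>, \<open>b\<close>, \<open>E\<close> and \<open>D\<close>, so that \<open>L\<close> can
  be reached by rescaling \<open>G\<close>.  From \<open>G_root\<close> on, the assumptions hold automatically once \<open>k0\<close> is large.
\<close>

locale growth_data =
  fixes h :: nat and b :: "nat \<Rightarrow> nat" and E :: nat and D Cu Cl c0 L :: real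
    and G \<psi> :: "nat \<Rightarrow> real" and k0 :: nat
    and \<delta> \<sigma> Q C1 C4 c2 c7 T :: real
  defines "\<delta> \<equiv> 1 / (4 * real h)"
    and "\<sigma> \<equiv> ln 2 / (8 * real h * ln (real E))"
    and "Q \<equiv> 32 * real h * 2 ^ h"
    and "C1 \<equiv> 4 * D + 2"
    and "C4 \<equiv> 2 ^ h * (2 * D * C1 ^ h * Cu + 3 * Q ^ h * Cl)"
    and "c2 \<equiv> 1 / (8 * real E * real (b h) * D)"
    and "c7 \<equiv> c2 ^ (h - 1) / D"
    and "T \<equiv> 3 * Q ^ h + 3 * C4 / (c0 * \<sigma>)"
  assumes h2: "h \<ge> 2"
    and bpos: "\<forall>i\<in>{1..h}. b i > 0"
    and bgcd: "Gcd (b ` {1..h}) = 1"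
    and E8: "8 * sum b {1..h} \<le> E"
    and DE: "real E \<le> D"
    and const_pos: "Cu > 0" "Cl > 0" "c0 > 0" "L \<ge> 1"
    and L: "12 * Q ^ h \<le> L * c7"
    and k0: "k0 \<ge> 4 * E * b h"
    and G_le: "\<And>n. n \<ge> k0 \<Longrightarrow> G n \<le> real n"
    and G_mono: "\<And>m n. k0 \<le> m \<Longrightarrow> m \<le> n \<Longrightarrow> G m \<le> G n"
    and G_doubling: "\<And>k n. k0 \<le> k \<Longrightarrow> k \<le> n \<Longrightarrow> n \<le> k * E \<Longrightarrow> G n \<le> D * G k"
    and G_growth: "\<And>m n. k0 \<le> m \<Longrightarrow> m * E \<le> n \<Longrightarrow> 2 * G m \<le> G n"
    and G_lower: "\<And>n. n \<ge> k0 \<Longrightarrow> c0 * (real n * \<psi> n) \<le> G n ^ h"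
    and G_upper: "\<And>n. n \<ge> k0 \<Longrightarrow> G n ^ (h - 1) \<le> Cu * (real n * \<psi> n)"
    and \<psi>_mono: "\<And>m n. k0 \<le> m \<Longrightarrow> m \<le> n \<Longrightarrow> \<psi> m \<le> \<psi> n"
    and \<psi>_ln: "\<And>n. n \<ge> k0 \<Longrightarrow> ln (real n) \<le> Cl * \<psi> n"
    and G_ln: "\<And>n. n \<ge> k0 \<Longrightarrow> L * (real n * ln (real n)) \<le> G n ^ h"
    and G_root: "\<And>n. n \<ge> k0 \<Longrightarrow> real n powr (1 / real h) \<le> G n"
    and G_log: "\<And>n. n \<ge> k0 \<Longrightarrow> 24 * real E * real (b h) * D * ln (real n) \<le> G n"
    and C1_le_powr: "\<And>n. n \<ge> k0 \<Longrightarrow> D * C1 ^ h \<le> real n powr (\<delta> / 2)"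
    and G_power_le: "\<And>n. n \<ge> k0 \<Longrightarrow> G n ^ (h - 2) \<le> real n powr (1 - \<delta>)"
    and \<psi>_ln_le_root: "\<And>n. n \<ge> k0 \<Longrightarrow> 12 * C4 * \<psi> n * ln (real n) \<le> c7 * real n powr (1 / (2 * real h))"
    and E_le_powr: "\<And>n. n \<ge> k0 \<Longrightarrow> real E \<le> real n powr \<delta>"
    and \<psi>_ln_le_powr: "\<And>n. n \<ge> k0 \<Longrightarrow> 3 * C4 * \<psi> n * ln (real n) \<le> real n powr \<delta>"
    and C1_le_powr_\<sigma>: "\<And>n. n \<ge> k0 \<Longrightarrow> 6 * D * C1 ^ (h - 1) \<le> real n powr \<sigma>"
begin

text \<open>Probability 0 below \<open>k0\<close> forces all members of \<open>A\<close> into the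
  range where the growth conditions hold.\<close>

definition p :: "nat \<Rightarrow> real" where "p k = (if k0 \<le> k then G k / real k else 0)"

text \<open>The order of the expected number of representations: about \<open>G n ^ h\<close> tuples
  whose sums are spread over about \<open>n\<close> values.\<close>

definition \<mu> :: "nat \<Rightarrow> real" where "\<mu> n = G n ^ h / real n"

text \<open>
  For the lower bound only those representations are counted whose last entry \<open>k\<close> is the largest one
  and whose other entries lie in \<open>{n div E<..2 * (n div E)}\<close>.
\<close>

definition low :: "nat \<Rightarrow> nat \<Rightarrow> nat set \<Rightarrow> nat" where
  "low n k X = (if 2 * (n div E) < k \<and> b h * k \<le> n
     then reps b {1..<h} (X \<inter> {n div E<..2 * (n div E)}) (n - b h * k) else 0)"

text \<open>An upper bound for \<open>low\<close> that is bounded where the expected number of representations with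
  \<open>h - 1\<close> summands is small.\<close>

definition W :: "nat \<Rightarrow> real" where
  "W n = (if G n ^ (h - 1) \<le> real n powr (1 - 2 * \<delta>) then Q ^ h else C4 * \<psi> n)"

text \<open>The conclusion of \<open>simultaneous_exponential_bounds\<close> for one target
  \<open>n\<close>, with \<open>u\<close> already evaluated at \<open>A\<close>.\<close>

definition dominated :: "nat set \<Rightarrow> nat \<Rightarrow> (nat \<Rightarrow> real) \<Rightarrow> bool" where
  "dominated A n u \<longleftrightarrow>
     (\<forall>N. (\<Sum>k<N. (if k \<in> A then u k else 0) - p k * (exp (u k) - 1)) \<le> 3 * ln (real n))"

lemma bh: "b h \<ge> 1" "b h \<le> sum b {1..h}" "E \<ge> 8"
proof -
  show "b h \<ge> 1" using bpos h2 by (simp add: Suc_le_eq)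
  show "b h \<le> sum b {1..h}" using h2 by (intro member_le_sum) auto
  then show "E \<ge> 8" using E8 \<open>b h \<ge> 1\<close> by linarith
qed

lemma D8: "D \<ge> 8" using bh DE by linarith

lemma k0_ge: "k0 \<ge> 32" "k0 \<ge> E"
proof -
  have "8 * 1 \<le> E * b h" using bh by (intro mult_le_mono) auto
  then show "k0 \<ge> 32" using k0 by linarith
  have "E * 1 \<le> E * b h" using bh by (intro mult_le_mono) auto
  then show "k0 \<ge> E" using k0 by linarith
qed

lemma k0_le_if: "n \<ge> E * k0 \<Longrightarrow> n \<ge> k0"
  using bh(3) mult_le_mono1[of 1 E k0] by linarith

lemma ln_ge_1: "n \<ge> k0 \<Longrightarrow> ln (real n) \<ge> 1"
proof -
  assume "n \<ge> k0"
  then have "real n \<ge> 3" using k0_ge by linarith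
  then have "exp 1 \<le> real n" using exp_le by linarith
  then show ?thesis using k0_ge \<open>n \<ge> k0\<close> by (subst ln_ge_iff) auto
qed

lemma G_ge_1: "n \<ge> k0 \<Longrightarrow> G n \<ge> 1"
proof -
  assume n: "n \<ge> k0"
  then have "1 \<le> real n powr (1 / real h)" using k0_ge by (intro ge_one_powr_ge_zero) auto
  then show ?thesis using G_root[OF n] by linarith
qed

lemma \<delta>: "0 < \<delta>" "\<delta> \<le> 1 / 8" "\<delta> * real h = 1 / 4"
  using h2 by (auto simp: \<delta>_def field_simps)

lemma Q: "Q \<ge> 1"
proof -
  have "1 * 1 \<le> 32 * real h * 2 ^ h" using h2 by (intro mult_mono) auto
  then show ?thesis by (simp add: Q_def)
qed

lemma C1: "C1 \<ge> 1" using D8 by (simp add: C1_def)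

lemma C4: "C4 > 0"
  unfolding C4_def using const_pos D8 C1 Q by (intro mult_pos_pos add_pos_pos) auto

lemma \<sigma>: "\<sigma> > 0"
  unfolding \<sigma>_def using h2 bh by (intro divide_pos_pos mult_pos_pos) auto

lemma T: "T \<ge> 3 * Q ^ h" "3 * C4 \<le> T * (c0 * \<sigma>)" "T \<ge> 1"
proof -
  have pos: "3 * C4 / (c0 * \<sigma>) > 0" using C4 const_pos \<sigma> by auto
  then show "T \<ge> 3 * Q ^ h" by (simp add: T_def)
  have "T * (c0 * \<sigma>) = 3 * Q ^ h * (c0 * \<sigma>) + 3 * C4"
    unfolding T_def using const_pos \<sigma> by (simp add: field_simps)
  then show "3 * C4 \<le> T * (c0 * \<sigma>)" using Q const_pos \<sigma> by (smt (verit) mult_nonneg_nonneg zero_le_power)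
  show "T \<ge> 1" using \<open>T \<ge> 3 * Q ^ h\<close> one_le_power[OF Q, of h] by linarith
qed

lemma \<psi>_pos: "n \<ge> k0 \<Longrightarrow> \<psi> n > 0"
  using \<psi>_ln[of n] ln_ge_1[of n] const_pos by (smt (verit) mult_nonneg_nonpos)

lemma \<mu>: assumes "n \<ge> k0" shows "\<mu> n \<ge> L * ln (real n)" "\<mu> n \<ge> c0 * \<psi> n" "\<mu> n \<ge> 1"
proof -
  have n: "real n > 0" using assms k0_ge by auto
  show 1: "\<mu> n \<ge> L * ln (real n)" "\<mu> n \<ge> c0 * \<psi> n"
    using G_ln[OF assms] G_lower[OF assms] n by (simp_all add: \<mu>_def field_simps)
  have "1 * 1 \<le> L * ln (real n)" using ln_ge_1[OF assms] const_pos by (intro mult_mono) auto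
  then show "\<mu> n \<ge> 1" using 1 by linarith
qed

lemma p_le:
  assumes "n \<ge> k0" "k \<le> n" "n \<le> k * E"
  shows "p k \<le> D * (G n / real n)"
proof (cases "k0 \<le> k")
  case True
  then have pos: "real k > 0" "real n > 0" using assms k0_ge by auto
  have "G k / real k \<le> G n / real k"
    using G_mono[OF True assms(2)] pos by (intro divide_right_mono) auto
  also have "\<dots> \<le> G n * (real E / real n)"
  proof -
    have "real n \<le> real k * real E" using assms(3) by (metis of_nat_le_iff of_nat_mult)
    then have "1 / real k \<le> real E / real n" using pos by (simp add: field_simps)
    then have "G n * (1 / real k) \<le> G n * (real E / real n)"
      using G_ge_1[OF assms(1)] by (intro mult_left_mono) auto
    then show ?thesis by simp
  qed
  also have "\<dots> = real E * (G n / real n)" by simp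
  also have "\<dots> \<le> D * (G n / real n)" using DE G_ge_1[OF assms(1)] by (intro mult_right_mono) auto
  finally show ?thesis using True by (simp add: p_def)
next
  case False
  then show ?thesis using G_ge_1[OF assms(1)] D8 by (simp add: p_def)
qed

lemma p_ge:
  assumes "k0 \<le> k" "k \<le> n" "n \<le> k * E"
  shows "G n / (real n * D) \<le> p k"
proof -
  have pos: "real k > 0" "real n > 0" "D > 0" using assms k0_ge D8 by auto
  have "G n / (real n * D) \<le> (D * G k) / (real n * D)"
    using G_doubling[OF assms] pos by (intro divide_right_mono) auto
  also have "\<dots> = G k / real n" using pos by simp
  also have "\<dots> \<le> G k / real k" using G_ge_1[OF assms(1)] pos assms by (intro divide_left_mono) auto
  finally show ?thesis using assms by (simp add: p_def)
qed

lemma p01: "0 \<le> p k" "p k \<le> 1"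
  using G_ge_1[of k] G_le[of k] k0_ge by (auto simp: p_def divide_le_eq_1)

text \<open>This is the case of \<open>Suc n\<close> steps, which decide all
  \<open>k \<le> n\<close>. The multiplier \<open>l\<close> may be negative, and the inequality is
  then a lower bound for the sum over \<open>A\<close>.\<close>

lemma dominatedD:
  assumes "dominated A n (\<lambda>k. l * w k)"
  shows "l * (\<Sum>k\<in>A \<inter> {..n}. w k) \<le> (\<Sum>k\<le>n. p k * (exp (l * w k) - 1)) + 3 * ln (real n)"
proof -
  have "(\<Sum>k<Suc n. (if k \<in> A then l * w k else 0) - p k * (exp (l * w k) - 1)) \<le> 3 * ln (real n)"
    using assms unfolding dominated_def by blast
  moreover have "(\<Sum>k\<le>n. if k \<in> A then l * w k else 0) = l * (\<Sum>k\<in>A \<inter> {..n}. w k)"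
    by (simp add: sum.inter_restrict[of "{..n}", symmetric] Int_commute sum_distrib_left)
  ultimately show ?thesis by (simp add: sum_subtractf lessThan_Suc_atMost)
qed

lemma G_growth_iterate:
  assumes "k0 \<le> m" "m * E ^ j \<le> n"
  shows "2 ^ j * G m \<le> G n"
  using assms(2)
proof (induction j arbitrary: n)
  case 0
  then show ?case using G_mono assms by simp
next
  case (Suc j)
  have "m * 1 \<le> m * E ^ j" using bh by (intro mult_le_mono2) simp
  then have "k0 \<le> m * E ^ j" using assms by linarith
  then have "2 * G (m * E ^ j) \<le> G n" using Suc by (intro G_growth) (auto simp: algebra_simps)
  moreover have "2 ^ j * G m \<le> G (m * E ^ j)" using Suc by simp
  ultimately show ?case by simp
qed

text \<open>About \<open>\<delta> * ln n / ln E\<close> factors \<open>E\<close> fit between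
  \<open>m\<close> and \<open>n\<close>, and each of them doubles \<open>G\<close>. By the choice of
  \<open>\<sigma>\<close>, the unrounded number of doublings amounts to a factor
  \<open>n powr (2 * \<sigma>)\<close>; rounding it down costs the factor 2.\<close>

lemma G_power_growth:
  assumes "k0 \<le> m" "real m \<le> real n powr (1 - \<delta>)" "k0 \<le> n"
  shows "G m \<le> 2 * real n powr (- 2 * \<sigma>) * G n"
proof -
  have n: "real n > 1" using assms k0_ge by auto
  have lE: "ln (real E) > 0" using bh by auto
  define x where "x = \<delta> * ln (real n) / ln (real E)"
  have x0: "x \<ge> 0" unfolding x_def using \<delta> n lE by auto
  define j where "j = nat \<lfloor>x\<rfloor>"
  have j: "real j \<le> x" "x - 1 \<le> real j" using x0 unfolding j_def by linarith+
  have "real (E ^ j) = exp (real j * ln (real E))" using bh by (simp add: exp_of_nat_mult)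
  also have "\<dots> \<le> exp (x * ln (real E))" using j lE by simp
  also have "\<dots> = real n powr \<delta>" using lE n by (simp add: x_def powr_def)
  finally have "real m * real (E ^ j) \<le> real n powr (1 - \<delta>) * real n powr \<delta>"
    using assms by (intro mult_mono) auto
  also have "\<dots> = real n" using n by (simp add: powr_add[symmetric])
  finally have "m * E ^ j \<le> n" by (metis of_nat_le_iff of_nat_mult)
  then have *: "2 ^ j * G m \<le> G n" using G_growth_iterate assms by blast
  have "real n powr (2 * \<sigma>) = exp (x * ln 2)"
    unfolding powr_def x_def \<sigma>_def \<delta>_def using n by (simp add: field_simps)
  also have "\<dots> \<le> exp ((1 + real j) * ln 2)" using j by simp
  also have "\<dots> = 2 * 2 ^ j" by (simp add: distrib_right exp_add exp_of_nat_mult)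
  finally have "real n powr (2 * \<sigma>) * G m \<le> 2 * 2 ^ j * G m"
    using G_ge_1[OF assms(1)] by (intro mult_right_mono) auto
  then have "real n powr (2 * \<sigma>) * G m \<le> 2 * G n" using * by linarith
  then show ?thesis using n by (simp add: powr_minus field_simps)
qed

end

subsection \<open>Sets satisfying the exponential moment bounds\<close>

text \<open>The multiplier is adapted to the known size of the weights: of order \<open>ln n\<close>
  for weights bounded by \<open>Q ^ card J\<close>, so that exponentials stay below a small power of
  n; \<open>1 / Q ^ h\<close> and \<open>- 1 / W n\<close> to keep exponents in absolute value at
  most 1; and \<open>3 * ln n / (T * \<mu> n)\<close> so that the error \<open>3 * ln n\<close>,
  divided by it, becomes \<open>T * \<mu> n\<close>.\<close>

locale good_set = growth_data +
  fixes A :: "nat set"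
  assumes A_ge: "\<And>k. k \<in> A \<Longrightarrow> k \<ge> k0"
    and ev_count: "\<And>n. n \<ge> k0 \<Longrightarrow> dominated A n (\<lambda>k. 1 * (if k \<le> n \<and> n < k * E then 1 else 0))"
    and ev_residue: "\<And>n \<rho>. n \<ge> k0 \<Longrightarrow> \<rho> < b h \<Longrightarrow>
      dominated A n (\<lambda>k. - 1 * (if n div E < k \<and> k \<le> 2 * (n div E) \<and> k mod b h = \<rho> then 1 else 0))"
    and ev_bounded: "\<And>n J S. n \<ge> k0 \<Longrightarrow> J \<subseteq> {1..h} \<Longrightarrow> S \<subseteq> {1..h} \<Longrightarrow>
      dominated A n (\<lambda>k. \<delta> / 2 * ln (real n) / Q ^ card J * real (top_reps b J S n k A))"
    and ev_medium: "\<And>n J S. n \<ge> k0 \<Longrightarrow> J \<subseteq> {1..h} \<Longrightarrow> S \<subseteq> {1..h} \<Longrightarrow>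
      dominated A n (\<lambda>k. 1 / Q ^ h * real (top_reps b J S n k A))"
    and ev_full: "\<And>n J S. n \<ge> k0 \<Longrightarrow> J \<subseteq> {1..h} \<Longrightarrow> S \<subseteq> {1..h} \<Longrightarrow>
      dominated A n (\<lambda>k. 3 * ln (real n) / (T * \<mu> n) * real (top_reps b J S n k A))"
    and ev_low: "\<And>n. n \<ge> k0 \<Longrightarrow> dominated A n (\<lambda>k. - (1 / W n) * real (low n k A))"
begin

section \<open>Upper bound for the counting function of \<open>A\<close>\<close>

lemma card_nonzero_atMost: "card ({..n} \<inter> - {0 :: nat}) = n"
proof -
  have "{..n} \<inter> - {0} = {1..n}" by auto
  then show ?thesis by simp
qed

text \<open>The members in \<open>{n div E<..n}\<close> have probability at most
  \<open>D * G n / n\<close>, so there are at most \<open>(2 * D + 1) * G n\<close> of them. Passing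
  to \<open>n div E\<close> halves \<open>G\<close>, so \<open>C1 = 2 * (2 * D + 1)\<close> is
  reproduced by the induction.\<close>

lemma count_le:
  assumes "n \<ge> k0"
  shows "real (card (A \<inter> {..n})) \<le> C1 * G n"
  using assms
proof (induction n rule: less_induct)
  case (less n)
  have n: "real n > 0" using less k0_ge by auto
  have E0: "E > 0" using bh by simp
  have div: "n < k * E \<longleftrightarrow> n div E < k" for k using E0 by (simp add: div_less_iff_less_mult)
  let ?w = "\<lambda>k. (if k \<le> n \<and> n < k * E then 1 else 0) :: real"
  have "1 * (\<Sum>k\<in>A \<inter> {..n}. ?w k) \<le> (\<Sum>k\<le>n. p k * (exp (1 * ?w k) - 1)) + 3 * ln (real n)"
    by (rule dominatedD[OF ev_count[OF less.prems]])
  also have "(\<Sum>k\<le>n. p k * (exp (1 * ?w k) - 1)) \<le> (\<Sum>k\<le>n. if k = 0 then 0 else 2 * D * (G n / real n))"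
  proof (rule sum_mono)
    fix k assume "k \<in> {..n}"
    show "p k * (exp (1 * ?w k) - 1) \<le> (if k = 0 then 0 else 2 * D * (G n / real n))"
    proof (cases "n < k * E")
      case True
      have "p k * (exp 1 - 1) \<le> D * (G n / real n) * 2"
        using p_le[OF less.prems, of k] True \<open>k \<in> _\<close> exp_le p01(1)[of k] D8 G_ge_1[OF less.prems]
        by (intro mult_mono) auto
      then show ?thesis using True \<open>k \<in> _\<close> by (auto simp: algebra_simps)
    next
      case False
      then show ?thesis using D8 G_ge_1[OF less.prems] by auto
    qed
  qed
  also have "\<dots> = 2 * D * G n" using n by (simp add: sum.If_cases card_nonzero_atMost)
  also have "3 * ln (real n) \<le> G n"
  proof -
    have "1 * 3 \<le> real E * real (b h) * D * 24"
    proof (intro mult_mono)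
      have "1 * 1 * 1 \<le> real E * real (b h) * D" using bh D8 by (intro mult_mono) auto
      then show "1 \<le> real E * real (b h) * D" by simp
    qed (use D8 in auto)
    then have "3 * ln (real n) \<le> 24 * real E * real (b h) * D * ln (real n)"
      using ln_ge_1[OF less.prems] by (intro mult_right_mono) auto
    then show ?thesis using G_log[OF less.prems] by linarith
  qed
  also have "(\<Sum>k\<in>A \<inter> {..n}. ?w k) = real (card (A \<inter> {n div E<..n}))"
  proof -
    have "(\<Sum>k\<in>A \<inter> {..n}. ?w k) = (\<Sum>k\<in>A \<inter> {n div E<..n}. 1)"
      by (rule sum.mono_neutral_cong_right) (auto simp: div)
    then show ?thesis by simp
  qed
  finally have 1: "real (card (A \<inter> {n div E<..n})) \<le> (2 * D + 1) * G n" by (simp add: algebra_simps)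
  have 2: "real (card (A \<inter> {..n div E})) \<le> (2 * D + 1) * G n"
  proof (cases "n div E < k0")
    case True
    then have "A \<inter> {..n div E} = {}" using A_ge by force
    then show ?thesis using D8 G_ge_1[OF less.prems] by simp
  next
    case False
    have "n div E < n" using n bh by (intro div_less_dividend) auto
    then have "real (card (A \<inter> {..n div E})) \<le> C1 * G (n div E)" using less.IH False by simp
    also have "2 * G (n div E) \<le> G n" using False by (intro G_growth) auto
    then have "C1 * G (n div E) \<le> C1 * (G n / 2)" using C1 by (intro mult_left_mono) auto
    finally show ?thesis by (simp add: C1_def algebra_simps)
  qed
  have "A \<inter> {..n} = (A \<inter> {..n div E}) \<union> (A \<inter> {n div E<..n})" by (auto intro: order_trans[OF _ div_le_dividend])
  then have "card (A \<inter> {..n}) \<le> card (A \<inter> {..n div E}) + card (A \<inter> {n div E<..n})"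
    using card_Un_le by metis
  then show ?case using 1 2 by (simp add: C1_def algebra_simps)
qed

section \<open>Weighted sums of the numbers of representations with given largest entry\<close>

lemma finite_index: "J \<subseteq> {1..h} \<Longrightarrow> finite J"
  by (rule finite_subset) auto

lemma index_pos: "J \<subseteq> {1..h} \<Longrightarrow> \<forall>i\<in>J. b i > 0"
  using bpos by blast

text \<open>Where the weight is nonzero, \<open>k\<close> lies between \<open>n / E\<close> and
  \<open>n\<close>, because \<open>E\<close> exceeds the sum of all coefficients; there
  \<open>p_le\<close> applies.\<close>

lemma p_top_reps_le:
  assumes n: "n \<ge> k0" and J: "J \<subseteq> {1..h}" and S: "S \<subseteq> {1..h}" "S \<noteq> {}" "J \<inter> S = {}"
  shows "p k * real (top_reps b J S n k A) \<le> D * (G n / real n) * real (top_reps b J S n k A)"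
proof (cases "top_reps b J S n k A = 0")
  case False
  have fin: "finite J" "finite S" using J S finite_index by blast+
  have bp: "\<forall>i\<in>S. b i > 0" using S(1) by (rule index_pos)
  have s: "k \<le> n" "n \<le> sum b (J \<union> S) * k"
    using top_reps_support[OF fin S(3) S(2) bp] False by auto
  have "sum b (J \<union> S) \<le> sum b {1..h}" using J S by (intro sum_mono2) auto
  also have "\<dots> \<le> E" using E8 by simp
  finally have "sum b (J \<union> S) * k \<le> E * k" by simp
  then have "n \<le> k * E" using s by (metis le_trans mult.commute)
  then show ?thesis using p_le[OF n s(1)] by (intro mult_right_mono) auto
qed simp

lemma sum_p_top_reps_le:
  assumes n: "n \<ge> k0" and J: "J \<subseteq> {1..h}" and S: "S \<subseteq> {1..h}" "S \<noteq> {}" "J \<inter> S = {}"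
    and K: "finite K" "\<And>k. k \<in> K \<Longrightarrow> top_reps b J S n k A > 0 \<Longrightarrow> n - sum b S * k \<le> M"
  shows "(\<Sum>k\<in>K. p k * real (top_reps b J S n k A)) \<le> D * (G n / real n) * real (card (A \<inter> {..M})) ^ card J"
proof -
  have fin: "finite J" "finite S" using J S finite_index by blast+
  have bp: "\<forall>i\<in>S. b i > 0" "\<forall>i\<in>J. b i > 0" using index_pos J S(1) by blast+
  have "(\<Sum>k\<in>K. p k * real (top_reps b J S n k A)) \<le> (\<Sum>k\<in>K. D * (G n / real n) * real (top_reps b J S n k A))"
    by (intro sum_mono p_top_reps_le assms)
  also have "\<dots> = D * (G n / real n) * real (\<Sum>k\<in>K. top_reps b J S n k A)"
    by (simp add: sum_distrib_left)
  also have "\<dots> \<le> D * (G n / real n) * real (card (A \<inter> {..M}) ^ card J)"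
    using sum_top_reps_le[OF fin(1) bp(2) fin(2) S(2) bp(1) K] D8 G_ge_1[OF n]
    by (intro mult_left_mono) (simp_all add: of_nat_le_iff del: of_nat_sum of_nat_power)
  finally show ?thesis by simp
qed

text \<open>Since \<open>C1 * G n \<ge> 1\<close>, the exponent may be raised from
  \<open>card J + 1\<close> to \<open>l\<close>, which gives one bound for all choices of the
  maximal positions.\<close>

lemma sum_p_top_reps_le':
  assumes n: "n \<ge> k0" and J: "J \<subseteq> {1..h}" and S: "S \<subseteq> {1..h}" "S \<noteq> {}" "J \<inter> S = {}"
    and l: "card J + 1 \<le> l" "l \<le> h"
  shows "(\<Sum>k\<le>n. p k * real (top_reps b J S n k A)) \<le> D * C1 ^ h * (G n ^ l / real n)"
proof -
  have C1G: "1 \<le> C1 * G n" using mult_mono[OF C1 G_ge_1[OF n]] C1 by auto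
  have "(\<Sum>k\<le>n. p k * real (top_reps b J S n k A)) \<le> D * (G n / real n) * real (card (A \<inter> {..n})) ^ card J"
    by (intro sum_p_top_reps_le assms) auto
  also have "D * (G n / real n) * real (card (A \<inter> {..n})) ^ card J \<le> D * (G n / real n) * (C1 ^ h * G n ^ (l - 1))"
  proof (rule mult_left_mono)
    have "real (card (A \<inter> {..n})) ^ card J \<le> (C1 * G n) ^ card J"
      using count_le[OF n] by (intro power_mono) auto
    also have "\<dots> \<le> (C1 * G n) ^ (l - 1)" using l C1G by (intro power_increasing) auto
    also have "\<dots> = C1 ^ (l - 1) * G n ^ (l - 1)" by (simp add: power_mult_distrib)
    also have "\<dots> \<le> C1 ^ h * G n ^ (l - 1)"
      using C1 G_ge_1[OF n] l by (intro mult_right_mono power_increasing) auto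
    finally show "real (card (A \<inter> {..n})) ^ card J \<le> C1 ^ h * G n ^ (l - 1)" .
  qed (use D8 G_ge_1[OF n] in auto)
  also have "\<dots> = D * C1 ^ h * (G n * G n ^ (l - 1) / real n)" by simp
  also have "G n * G n ^ (l - 1) = G n ^ l" using l by (simp add: power_Suc[symmetric])
  finally show ?thesis .
qed

lemma top_reps_le_if_reps_le:
  assumes "J \<subseteq> {1..h}" "\<And>m. m \<le> n \<Longrightarrow> real (reps b J A m) \<le> c" "c \<ge> 0"
  shows "real (top_reps b J S n k A) \<le> c"
proof -
  have "reps b J (A \<inter> {..<k}) m \<le> reps b J A m" for m
    using assms by (intro reps_mono finite_index index_pos) auto
  then have "real (reps b J (A \<inter> {..<k}) (n - sum b S * k)) \<le> real (reps b J A (n - sum b S * k))"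
    by simp
  also have "\<dots> \<le> c" by (rule assms) simp
  finally show ?thesis using assms by (simp add: top_reps_def)
qed

lemma reps_eq_0: "J \<subseteq> {1..h} \<Longrightarrow> J \<noteq> {} \<Longrightarrow> m < k0 \<Longrightarrow> reps b J A m = 0"
proof (rule ccontr)
  assume J: "J \<subseteq> {1..h}" "J \<noteq> {}" "m < k0" "reps b J A m \<noteq> 0"
  then have "k0 \<le> m" using A_ge by (intro reps_pos_lower[of b J A m k0] finite_index index_pos) auto
  then show False using J by simp
qed

lemma sum_over_top_index_sets_le:
  fixes Y :: "nat set \<Rightarrow> real"
  assumes "I \<subseteq> {1..h}" "\<And>S. S \<subseteq> I \<Longrightarrow> S \<noteq> {} \<Longrightarrow> Y S \<le> c" "c \<ge> 0"
  shows "(\<Sum>S\<in>Pow I - {{}}. Y S) \<le> 2 ^ h * c"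
proof -
  have fin: "finite I" using assms(1) finite_index by blast
  have "(\<Sum>S\<in>Pow I - {{}}. Y S) \<le> (\<Sum>S\<in>Pow I - {{}}. c)" using assms by (intro sum_mono) auto
  also have "\<dots> = real (card (Pow I - {{}})) * c" by simp
  also have "\<dots> \<le> real (2 ^ h) * c"
  proof (intro mult_right_mono assms)
    have "card (Pow I - {{}}) \<le> card (Pow {1..h})" using assms by (intro card_mono) auto
    then show "real (card (Pow I - {{}})) \<le> real (2 ^ h)" by (simp add: card_Pow del: of_nat_power)
  qed
  finally show ?thesis by simp
qed

lemma reps_le_top:
  assumes "I \<subseteq> {1..h}" "I \<noteq> {}" "c \<ge> 0"
    and "\<And>S. S \<subseteq> I \<Longrightarrow> S \<noteq> {} \<Longrightarrow> (\<Sum>k\<in>A \<inter> {..n}. real (top_reps b (I - S) S n k A)) \<le> c"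
  shows "real (reps b I A n) \<le> 2 ^ h * c"
proof -
  have fin: "finite I" using assms(1) finite_index by blast
  have "real (reps b I A n) \<le> real (\<Sum>S\<in>Pow I - {{}}. \<Sum>k\<in>A \<inter> {..n}. top_reps b (I - S) S n k A)"
    using assms(1,2) by (intro of_nat_mono reps_le_sum_top_reps fin index_pos)
  also have "\<dots> = (\<Sum>S\<in>Pow I - {{}}. \<Sum>k\<in>A \<inter> {..n}. real (top_reps b (I - S) S n k A))" by simp
  also have "\<dots> \<le> 2 ^ h * c" using assms by (intro sum_over_top_index_sets_le) auto
  finally show ?thesis .
qed

section \<open>Upper bounds with fewer than \<open>h\<close> summands\<close>

lemma card_diff_nonempty:
  assumes "I \<subseteq> {1..h}" "S \<subseteq> I" "S \<noteq> {}"
  shows "card (I - S) + 1 \<le> card I"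
proof -
  have "I - S \<subset> I" "finite I" using assms finite_index by blast+
  then have "card (I - S) < card I" by (intro psubset_card_mono)
  then show ?thesis by simp
qed

text \<open>With at most \<open>h - 2\<close> summands every integer is sparse. Hence in
  \<open>reps_bounded\<close>, after removal of at least one of at most h - 1 positions, the
  induction hypothesis applies to all remainders.\<close>

lemma sparse_small: "card I \<le> h - 2 \<Longrightarrow> n \<ge> k0 \<Longrightarrow> G n ^ card I \<le> real n powr (1 - \<delta>)"
  by (rule order_trans[OF power_increasing G_power_le]) (auto intro: G_ge_1)

text \<open>Sparsity makes the mean a negative power of n, which pays for a multiplier of order
  \<open>ln n\<close>; the error \<open>3 * ln n\<close> then becomes a constant. Each set
  \<open>S\<close> contributes at most \<open>32 * h * Q ^ (card I - 1)\<close>, and the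
  \<open>2 ^ h\<close> possible sets complete the factor \<open>Q\<close>.\<close>

lemma reps_bounded:
  assumes "I \<subseteq> {1..h}" "card I \<le> h - 1" "n < k0 \<or> G n ^ card I \<le> real n powr (1 - \<delta>)"
  shows "real (reps b I A n) \<le> Q ^ card I"
  using assms
proof (induction "card I" arbitrary: I n rule: less_induct)
  case less
  show ?case
  proof (cases "I = {}")
    case True
    then show ?thesis using reps_empty_index[of b A n] by simp
  next
    case ne: False
    show ?thesis
    proof (cases "n < k0")
      case True
      then show ?thesis using reps_eq_0 ne less Q by simp
    next
      case False
      then have n: "n \<ge> k0" by simp
      then have n1: "real n > 1" using k0_ge by auto
      have sp: "G n ^ card I \<le> real n powr (1 - \<delta>)" using less.prems False by auto
      have main: "(\<Sum>k\<in>A \<inter> {..n}. real (top_reps b (I - S) S n k A)) \<le> 32 * real h * Q ^ (card I - 1)"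
        if S: "S \<subseteq> I" "S \<noteq> {}" for S
      proof -
        let ?J = "I - S"
        let ?w = "\<lambda>k. real (top_reps b ?J S n k A)"
        have J: "?J \<subseteq> {1..h}" "S \<subseteq> {1..h}" using less.prems S by auto
        have cJ: "card ?J + 1 \<le> card I" using card_diff_nonempty less.prems S by blast
        have cJ2: "card ?J \<le> h - 2" using cJ less.prems by linarith
        have "real (reps b ?J A m) \<le> Q ^ card ?J" for m
          using cJ cJ2 J sparse_small[OF cJ2, of m] by (intro less.hyps) (auto simp: not_less[symmetric])
        then have w: "?w k \<le> Q ^ card ?J" for k
          using Q J by (intro top_reps_le_if_reps_le) auto
        \<comment> \<open>With this multiplier the exponentials are at most
          \<open>n powr (\<delta> / 2)\<close>, while the mean is at most
          \<open>n powr (- \<delta> / 2)\<close> once the constants are absorbed. Their product is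
          at most 1, and \<open>4 * ln n / l\<close> is \<open>32 * h * Q ^ card J\<close>.\<close>
        define l where "l = \<delta> / 2 * ln (real n) / Q ^ card ?J"
        have l: "l > 0" unfolding l_def using \<delta> ln_ge_1[OF n] Q by auto
        have e: "exp (l * ?w k) - 1 \<le> real n powr (\<delta> / 2) * ?w k" for k
        proof (cases "top_reps b ?J S n k A = 0")
          case False
          have "l * ?w k \<le> l * Q ^ card ?J" using w l by (intro mult_left_mono) auto
          also have "\<dots> = \<delta> / 2 * ln (real n)" using Q by (simp add: l_def)
          finally have "exp (l * ?w k) \<le> real n powr (\<delta> / 2)" using n1 by (simp add: powr_def)
          also have "\<dots> * 1 \<le> real n powr (\<delta> / 2) * ?w k" using False by (intro mult_left_mono) auto
          finally show ?thesis by simp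
        qed simp
        have "l * (\<Sum>k\<in>A \<inter> {..n}. ?w k) \<le> (\<Sum>k\<le>n. p k * (exp (l * ?w k) - 1)) + 3 * ln (real n)"
          unfolding l_def by (rule dominatedD[OF ev_bounded[OF n J]])
        also have "(\<Sum>k\<le>n. p k * (exp (l * ?w k) - 1)) \<le> (\<Sum>k\<le>n. p k * (real n powr (\<delta> / 2) * ?w k))"
          using e p01 by (intro sum_mono mult_left_mono) auto
        also have "\<dots> = real n powr (\<delta> / 2) * (\<Sum>k\<le>n. p k * ?w k)"
          by (simp add: sum_distrib_left algebra_simps)
        also have "\<dots> \<le> real n powr (\<delta> / 2) * (D * C1 ^ h * (G n ^ card I / real n))"
          using J S cJ less.prems by (intro mult_left_mono sum_p_top_reps_le' n) auto
        also have "\<dots> \<le> real n powr (\<delta> / 2) * (real n powr (\<delta> / 2) * (real n powr (1 - \<delta>) / real n))"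
          using C1_le_powr[OF n] sp G_ge_1[OF n] by (intro mult_left_mono mult_mono divide_right_mono) auto
        also have "\<dots> = 1" using n1 by (simp add: powr_add[symmetric])
        also have "1 \<le> ln (real n)" by (rule ln_ge_1[OF n])
        finally have "l * (\<Sum>k\<in>A \<inter> {..n}. ?w k) \<le> 4 * ln (real n)" by simp
        then have "(\<Sum>k\<in>A \<inter> {..n}. ?w k) \<le> 4 * ln (real n) / l" using l by (simp add: field_simps)
        also have "\<dots> = 32 * real h * Q ^ card ?J"
          using ln_ge_1[OF n] Q h2 by (simp add: l_def \<delta>_def field_simps)
        also have "\<dots> \<le> 32 * real h * Q ^ (card I - 1)"
          using cJ Q by (intro mult_left_mono power_increasing) auto
        finally show ?thesis .
      qed
      have "real (reps b I A n) \<le> 2 ^ h * (32 * real h * Q ^ (card I - 1))"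
        using main less.prems ne Q by (intro reps_le_top) auto
      also have "\<dots> = Q * Q ^ (card I - 1)" by (simp add: Q_def)
      also have "\<dots> = Q ^ card I"
        using ne less.prems finite_subset[of I "{1..h}"] card_gt_0_iff[of I] by (simp add: power_Suc[symmetric])
      finally show ?thesis .
    qed
  qed
qed

lemma reps_bounded_small:
  assumes "I \<subseteq> {1..h}" "card I \<le> h - 2"
  shows "real (reps b I A n) \<le> Q ^ h"
proof -
  have "real (reps b I A n) \<le> Q ^ card I"
    using assms sparse_small[OF assms(2), of n] by (intro reps_bounded) (auto simp: not_less[symmetric])
  also have "\<dots> \<le> Q ^ h" using assms Q by (intro power_increasing) auto
  finally show ?thesis .
qed

text \<open>After removal of the maximal positions at most h - 2 summands remain, so the weights are
  bounded by \<open>Q ^ h\<close> and the exponential is linearised. Both the mean, of order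
  \<open>G n ^ (h - 1) / n\<close>, and the error \<open>3 * ln n\<close> are
  \<open>O(\<psi>)\<close>.\<close>

lemma reps_le_\<psi>:
  assumes I: "I \<subseteq> {1..h}" "I \<noteq> {}" "card I \<le> h - 1" and n: "n \<ge> k0"
  shows "real (reps b I A n) \<le> C4 * \<psi> n"
proof -
  have n1: "real n > 1" using n k0_ge by auto
  have \<psi>: "\<psi> n > 0" by (rule \<psi>_pos[OF n])
  have QB: "Q ^ h > 0" using Q by simp
  have "(\<Sum>k\<in>A \<inter> {..n}. real (top_reps b (I - S) S n k A)) \<le> (2 * D * C1 ^ h * Cu + 3 * Q ^ h * Cl) * \<psi> n"
    if S: "S \<subseteq> I" "S \<noteq> {}" for S
  proof -
    let ?J = "I - S"
    let ?w = "\<lambda>k. real (top_reps b ?J S n k A)"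
    have J: "?J \<subseteq> {1..h}" "S \<subseteq> {1..h}" using I S by auto
    have cJ: "card ?J + 1 \<le> card I" using card_diff_nonempty I S by blast
    have w: "?w k \<le> Q ^ h" for k
      using cJ I J QB by (intro top_reps_le_if_reps_le reps_bounded_small) auto
    have "1 / Q ^ h * (\<Sum>k\<in>A \<inter> {..n}. ?w k) \<le> (\<Sum>k\<le>n. p k * (exp (1 / Q ^ h * ?w k) - 1)) + 3 * ln (real n)"
      by (rule dominatedD[OF ev_medium[OF n J]])
    also have "(\<Sum>k\<le>n. p k * (exp (1 / Q ^ h * ?w k) - 1)) \<le> (\<Sum>k\<le>n. p k * (2 * (1 / Q ^ h * ?w k)))"
      using w QB p01 by (intro sum_mono mult_left_mono exp_minus_one_le_double) (auto simp: field_simps)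
    also have "\<dots> = 2 / Q ^ h * (\<Sum>k\<le>n. p k * ?w k)"
      by (simp add: sum_distrib_left algebra_simps)
    also have "\<dots> \<le> 2 / Q ^ h * (D * C1 ^ h * (G n ^ (h - 1) / real n))"
      using J S cJ I QB by (intro mult_left_mono sum_p_top_reps_le' n) auto
    also have "\<dots> \<le> 2 / Q ^ h * (D * C1 ^ h * (Cu * \<psi> n))"
      using G_upper[OF n] n1 QB D8 C1 by (intro mult_left_mono) (auto simp: field_simps)
    also have "3 * ln (real n) \<le> 3 * (Cl * \<psi> n)" using \<psi>_ln[OF n] by simp
    finally have "(\<Sum>k\<in>A \<inter> {..n}. ?w k) / Q ^ h \<le> 2 / Q ^ h * (D * C1 ^ h * (Cu * \<psi> n)) + 3 * (Cl * \<psi> n)"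
      by simp
    then have "(\<Sum>k\<in>A \<inter> {..n}. ?w k) \<le> (2 / Q ^ h * (D * C1 ^ h * (Cu * \<psi> n)) + 3 * (Cl * \<psi> n)) * Q ^ h"
      using QB by (simp only: divide_le_eq if_True)
    also have "\<dots> = (2 * D * C1 ^ h * Cu + 3 * Q ^ h * Cl) * \<psi> n"
    proof -
      have "2 / x * y * x = 2 * y" if "x > 0" for x y :: real using that by simp
      from this[OF QB] show ?thesis by (simp only: distrib_right) (simp add: mult_ac)
    qed
    finally show ?thesis .
  qed
  then have "real (reps b I A n) \<le> 2 ^ h * ((2 * D * C1 ^ h * Cu + 3 * Q ^ h * Cl) * \<psi> n)"
    using I \<psi> const_pos D8 C1 QB by (intro reps_le_top) auto
  then show ?thesis by (simp add: C4_def)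
qed

text \<open>A bound uniform in the remainder \<open>m \<le> n\<close>, from monotonicity of
  \<open>\<psi>\<close>. Below \<open>k0\<close> nothing is represented by a nonempty index set, and
  for the empty one \<open>1 \<le> C4 * \<psi> n\<close> suffices.\<close>

lemma reps_le_\<psi>':
  assumes I: "I \<subseteq> {1..h}" "card I \<le> h - 1" and n: "n \<ge> k0" "m \<le> n"
  shows "real (reps b I A m) \<le> C4 * \<psi> n"
proof (cases "I = {}")
  case True
  have "1 \<le> ln (real n)" by (rule ln_ge_1[OF n(1)])
  also have "\<dots> \<le> Cl * \<psi> n" by (rule \<psi>_ln[OF n(1)])
  also have "\<dots> \<le> C4 * \<psi> n"
  proof (intro mult_right_mono)
    have "1 * (1 * Cl) \<le> 2 ^ h * (2 * D * C1 ^ h * Cu + 3 * Q ^ h * Cl)"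
    proof (intro mult_mono)
      have "1 * Cl \<le> 3 * Q ^ h * Cl" using one_le_power[OF Q, of h] const_pos by (intro mult_right_mono) linarith+
      moreover have "0 \<le> 2 * D * C1 ^ h * Cu" using D8 C1 const_pos by auto
      ultimately show "1 * Cl \<le> 2 * D * C1 ^ h * Cu + 3 * Q ^ h * Cl" by linarith
    qed (use const_pos in auto)
    then show "Cl \<le> C4" by (simp add: C4_def)
  qed (use \<psi>_pos[OF n(1)] in auto)
  finally show ?thesis using True reps_empty_index[of b A m] by simp
next
  case False
  show ?thesis
  proof (cases "m < k0")
    case True
    then show ?thesis using reps_eq_0 I False C4 \<psi>_pos[OF n(1)] by simp
  next
    case m: False
    then have "real (reps b I A m) \<le> C4 * \<psi> m" using I False by (intro reps_le_\<psi>) auto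
    also have "\<dots> \<le> C4 * \<psi> n" using C4 \<psi>_mono[of m n] m n by (intro mult_left_mono) auto
    finally show ?thesis .
  qed
qed

end

subsection \<open>Bounds for the number of representations\<close>

lemma real_less_div_plus_one: "real n / real m < real (n div m) + 1"
  by (metis floor_divide_of_nat_eq of_int_of_nat_eq real_of_int_floor_add_one_gt)

lemma power_minus_one_expand: "h \<ge> 2 \<Longrightarrow> x ^ (h - 1) = x ^ (h - 2) * x" for x :: real
  by (metis Suc_1 Suc_diff_Suc Suc_le_lessD mult.commute power_Suc)

context good_set
begin

text \<open>The weights are only known to be \<open>O(\<psi>)\<close>, possibly as large as the mean
  itself, so the exponents need not be bounded. Small exponents are linearised; large ones are
  controlled separately through the size of the remainder.\<close>

lemma top_sum_le_\<mu>:
  assumes n: "n \<ge> k0" and S: "S \<subseteq> {1..h}" "S \<noteq> {}"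
  shows "(\<Sum>k\<in>A \<inter> {..n}. real (top_reps b ({1..h} - S) S n k A)) \<le> (2 * D * C1 ^ h + 4 / 3 * T) * \<mu> n"
proof -
  let ?J = "{1..h} - S"
  let ?w = "\<lambda>k. real (top_reps b ?J S n k A)"
  have J: "?J \<subseteq> {1..h}" by auto
  have cJ: "card ?J + 1 \<le> h" using card_diff_nonempty[of "{1..h}" S] S by auto
  have n1: "real n > 1" using n k0_ge by auto
  have mu: "\<mu> n > 0" using \<mu>[OF n] by linarith
  have ln1: "ln (real n) \<ge> 1" by (rule ln_ge_1[OF n])
  have \<psi>: "\<psi> n > 0" by (rule \<psi>_pos[OF n])
  have w: "?w k \<le> C4 * \<psi> n" for k
    using cJ C4 \<psi> n by (intro top_reps_le_if_reps_le reps_le_\<psi>') auto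
  define l where "l = 3 * ln (real n) / (T * \<mu> n)"
  have l: "l > 0" unfolding l_def using T ln1 mu by auto
  \<comment> \<open>Terms with \<open>l * w k > 1\<close> only occur if \<open>n\<close> is thin while the remaining sum \<open>m\<close> is not; this forces
    \<open>m \<le> n powr (1 - \<delta>)\<close>, and the power growth of \<open>G\<close> makes their total contribution negligible.\<close>
  define K1 where "K1 = {k\<in>{..n}. l * ?w k \<le> 1}"
  define K2 where "K2 = {k\<in>{..n}. l * ?w k > 1}"
  have V: "(\<Sum>k\<le>n. p k * ?w k) \<le> D * C1 ^ h * \<mu> n"
    using sum_p_top_reps_le'[OF n J S _ cJ] by (auto simp: \<mu>_def)
  have "(\<Sum>k\<in>K1. p k * (exp (l * ?w k) - 1)) \<le> (\<Sum>k\<in>K1. p k * (2 * (l * ?w k)))"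
    using l p01 by (intro sum_mono mult_left_mono exp_minus_one_le_double) (auto simp: K1_def)
  also have "\<dots> = 2 * l * (\<Sum>k\<in>K1. p k * ?w k)" by (simp add: sum_distrib_left algebra_simps)
  also have "\<dots> \<le> 2 * l * (\<Sum>k\<le>n. p k * ?w k)"
    using l p01 by (intro mult_left_mono sum_mono2) (auto simp: K1_def)
  also have "\<dots> \<le> 2 * l * (D * C1 ^ h * \<mu> n)" using V l by (intro mult_left_mono) auto
  finally have S1: "(\<Sum>k\<in>K1. p k * (exp (l * ?w k) - 1)) \<le> 2 * l * (D * C1 ^ h * \<mu> n)" .

  \<comment> \<open>Since \<open>\<mu> n \<ge> c0 * \<psi> n\<close>, the term
    \<open>3 * C4 / (c0 * \<sigma>)\<close> of \<open>T\<close> keeps even the largest exponent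
    below \<open>\<sigma> * ln n\<close>.\<close>
  have exp_le: "exp (l * ?w k) \<le> real n powr \<sigma>" for k
  proof -
    have "l * ?w k \<le> l * (C4 * \<psi> n)" using w l by (intro mult_left_mono) auto
    also have "\<dots> = ln (real n) * (3 * C4 * \<psi> n / (T * \<mu> n))" by (simp add: l_def)
    also have "\<dots> \<le> ln (real n) * \<sigma>"
    proof (intro mult_left_mono)
      have "3 * C4 * \<psi> n \<le> T * (c0 * \<sigma>) * \<psi> n" using T \<psi> by (intro mult_right_mono) auto
      also have "\<dots> = T * \<sigma> * (c0 * \<psi> n)" by simp
      also have "\<dots> \<le> T * \<sigma> * \<mu> n" using \<mu>[OF n] T \<sigma> by (intro mult_left_mono) auto
      finally show "3 * C4 * \<psi> n / (T * \<mu> n) \<le> \<sigma>" using T mu by (simp add: divide_le_eq mult_ac)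
    qed (use ln1 in auto)
    finally show ?thesis using n1 by (simp add: powr_def mult.commute)
  qed
  define M where "M = nat \<lfloor>real n powr (1 - \<delta>)\<rfloor>"
  have K2: "card ?J = h - 1 \<and> n - sum b S * k \<le> M" if "k \<in> K2" for k
  proof -
    define m where "m = n - sum b S * k"
    have mn: "m \<le> n" by (simp add: m_def)
    have lw: "l * ?w k > 1" using that by (simp add: K2_def)
    have big: "T * \<mu> n < 3 * ln (real n) * ?w k"
      using lw T mu by (simp add: l_def field_simps)
    \<comment> \<open>The term \<open>3 * Q ^ h\<close> of \<open>T\<close> serves here: an exponent
      above 1 forces a weight above \<open>Q ^ h\<close>. The bounds for sparse remainders then
      leave only h - 1 summands and a remainder \<open>m\<close> that is not sparse.\<close>
    have "3 * ln (real n) * Q ^ h \<le> T * \<mu> n"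
    proof -
      have "ln (real n) \<le> \<mu> n"
        using \<mu>(1)[OF n] mult_right_mono[OF const_pos(4), of "ln (real n)"] ln1 by linarith
      then have "(3 * Q ^ h) * ln (real n) \<le> T * \<mu> n"
        using T Q ln1 by (intro mult_mono) auto
      then show ?thesis by (simp add: mult_ac)
    qed
    then have "3 * ln (real n) * Q ^ h < 3 * ln (real n) * ?w k" using big by linarith
    then have wB: "?w k > Q ^ h" using ln1 by simp
    have wpos: "top_reps b ?J S n k A > 0" using wB Q by (cases "top_reps b ?J S n k A = 0") auto
    have "top_reps b ?J S n k A \<le> reps b ?J A m"
      unfolding top_reps_def m_def using J by (auto intro!: reps_mono finite_index index_pos)
    then have RB: "real (reps b ?J A m) > Q ^ h" using wB by linarith
    have card: "card ?J = h - 1"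
    proof (rule ccontr)
      assume "card ?J \<noteq> h - 1"
      then have "card ?J \<le> h - 2" using cJ by linarith
      then show False using reps_bounded_small[OF J, of m] RB by linarith
    qed
    have fat: "\<not> (m < k0 \<or> G m ^ card ?J \<le> real m powr (1 - \<delta>))"
    proof
      assume "m < k0 \<or> G m ^ card ?J \<le> real m powr (1 - \<delta>)"
      then have "real (reps b ?J A m) \<le> Q ^ card ?J" using card by (intro reps_bounded J) auto
      also have "\<dots> \<le> Q ^ h" using card Q by (intro power_increasing) auto
      finally show False using RB by linarith
    qed
    then have m: "k0 \<le> m" "G m ^ (h - 1) > real m powr (1 - \<delta>)" using card by auto
    have m1: "real m > 1" using m k0_ge by linarith
    have "1 * \<mu> n \<le> T * \<mu> n" using T mu by (intro mult_right_mono) auto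
    also have "\<dots> \<le> 3 * ln (real n) * (C4 * \<psi> n)"
      using big mult_left_mono[OF w[of k], of "3 * ln (real n)"] ln1 by linarith
    also have "\<dots> \<le> real n powr \<delta>" using \<psi>_ln_le_powr[OF n] by (simp add: mult_ac)
    finally have "\<mu> n \<le> real n powr \<delta>" by simp
    then have "G n ^ h \<le> real n powr \<delta> * real n" using n1 by (simp add: \<mu>_def divide_le_eq)
    also have "\<dots> = real n powr (1 + \<delta>)" using n1 by (simp add: powr_add mult.commute)
    finally have Gn: "G n ^ h \<le> real n powr (1 + \<delta>)" .
    \<comment> \<open>The power \<open>h\<close> of
      \<open>m powr (1 - \<delta>) < G m ^ (h - 1)\<close> meets the power \<open>h - 1\<close> of
      \<open>G n ^ h \<le> n powr (1 + \<delta>)\<close> by monotonicity of \<open>G\<close>. As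
      \<open>\<delta> * h = 1 / 4\<close>, the exponent \<open>(1 + \<delta>) * (h - 1)\<close> is
      at most \<open>(1 - \<delta>) * (1 - \<delta>) * h\<close>.\<close>
    have "(real m powr (1 - \<delta>)) powr real h = (real m powr (1 - \<delta>)) ^ h"
      using m1 by (intro powr_realpow) auto
    also have "\<dots> \<le> (G m ^ (h - 1)) ^ h" using m by (intro power_mono) auto
    also have "\<dots> \<le> (G n ^ (h - 1)) ^ h"
      using G_mono[OF m(1), of n] mn G_ge_1[OF m(1)] by (intro power_mono) auto
    also have "\<dots> = (G n ^ h) ^ (h - 1)" by (simp add: power_mult[symmetric] mult.commute)
    also have "\<dots> \<le> (real n powr (1 + \<delta>)) ^ (h - 1)" using Gn G_ge_1[OF n] by (intro power_mono) auto
    also have "\<dots> = (real n powr (1 + \<delta>)) powr real (h - 1)"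
      using n1 by (intro powr_realpow[symmetric]) auto
    also have "\<dots> = real n powr ((1 + \<delta>) * (real h - 1))" using h2 by (simp add: powr_powr of_nat_diff)
    also have "\<dots> \<le> real n powr ((1 - \<delta>) * (1 - \<delta>) * real h)"
    proof (intro powr_mono)
      have "(1 - \<delta>) * (1 - \<delta>) * real h = real h - 2 * (\<delta> * real h) + \<delta> * (\<delta> * real h)" by (simp add: algebra_simps)
      moreover have "(1 + \<delta>) * (real h - 1) = real h + \<delta> * real h - 1 - \<delta>" by (simp add: algebra_simps)
      ultimately show "(1 + \<delta>) * (real h - 1) \<le> (1 - \<delta>) * (1 - \<delta>) * real h" using \<delta> by simp
    qed (use n1 in auto)
    also have "\<dots> = (real n powr (1 - \<delta>)) powr ((1 - \<delta>) * real h)" by (simp add: powr_powr mult_ac)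
    finally have "real m powr ((1 - \<delta>) * real h) \<le> (real n powr (1 - \<delta>)) powr ((1 - \<delta>) * real h)"
      by (simp add: powr_powr)
    moreover have "(1 - \<delta>) * real h > 0" using \<delta> h2 by auto
    ultimately have "real m \<le> real n powr (1 - \<delta>)"
      using powr_less_mono2[of "(1 - \<delta>) * real h" "real n powr (1 - \<delta>)" "real m"] by fastforce
    then have "m \<le> M" unfolding M_def by (simp add: le_nat_floor)
    then show ?thesis using card by (simp add: m_def)
  qed
  have S2: "(\<Sum>k\<in>K2. p k * (exp (l * ?w k) - 1)) \<le> ln (real n)"
  proof (cases "K2 = {}")
    case True
    then show ?thesis using ln1 by simp
  next
    case False
    then have card: "card ?J = h - 1" using K2 by blast
    \<comment> \<open>The power saving is used for only one of the h - 1 factors \<open>G M\<close>;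
      the others are bounded by \<open>G n\<close>. The resulting
      \<open>n powr (- 2 * \<sigma>)\<close> beats the \<open>n powr \<sigma>\<close> of
      \<open>exp_le\<close>.\<close>
    have NM: "real (card (A \<inter> {..M})) ^ (h - 1) \<le> C1 ^ (h - 1) * G n ^ (h - 1) * (2 * real n powr (- 2 * \<sigma>))"
    proof (cases "M < k0")
      case True
      then have "A \<inter> {..M} = {}" using A_ge by force
      then show ?thesis using h2 C1 G_ge_1[OF n] by (simp add: power_0_left)
    next
      case False
      then have M: "k0 \<le> M" by simp
      have Mn: "real M \<le> real n powr (1 - \<delta>)" unfolding M_def by simp
      also have "\<dots> \<le> real n powr 1" using n1 \<delta> by (intro powr_mono) auto
      finally have "M \<le> n" using n1 by simp
      then have GM: "1 \<le> G M" "G M \<le> G n" "G M \<le> 2 * real n powr (- 2 * \<sigma>) * G n"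
        using G_ge_1[OF M] G_mono[OF M] G_power_growth[OF M Mn n] by auto
      have "real (card (A \<inter> {..M})) ^ (h - 1) \<le> (C1 * G M) ^ (h - 1)"
        using count_le[OF M] by (intro power_mono) auto
      also have "\<dots> = C1 ^ (h - 1) * (G M ^ (h - 2) * G M)"
        by (simp only: power_mult_distrib power_minus_one_expand[OF h2] mult_ac)
      also have "\<dots> \<le> C1 ^ (h - 1) * (G n ^ (h - 2) * (2 * real n powr (- 2 * \<sigma>) * G n))"
        using GM C1 by (intro mult_left_mono mult_mono power_mono) auto
      also have "\<dots> = C1 ^ (h - 1) * (G n ^ (h - 2) * G n) * (2 * real n powr (- 2 * \<sigma>))" by simp
      also have "G n ^ (h - 2) * G n = G n ^ (h - 1)"
        by (simp only: power_minus_one_expand[OF h2])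
      finally show ?thesis .
    qed
    have Ghn: "G n * G n ^ (h - 1) = G n ^ h" using h2 by (simp add: power_Suc[symmetric])
    have "(\<Sum>k\<in>K2. p k * (exp (l * ?w k) - 1)) \<le> (\<Sum>k\<in>K2. p k * (l * real n powr \<sigma> * ?w k))"
    proof (intro sum_mono mult_left_mono p01)
      fix k
      have "exp (l * ?w k) - 1 \<le> l * ?w k * exp (l * ?w k)" by (rule exp_minus_one_le)
      also have "\<dots> \<le> l * ?w k * real n powr \<sigma>" using exp_le l by (intro mult_left_mono) auto
      finally show "exp (l * ?w k) - 1 \<le> l * real n powr \<sigma> * ?w k" by (simp add: mult_ac)
    qed
    also have "\<dots> = l * real n powr \<sigma> * (\<Sum>k\<in>K2. p k * ?w k)" by (simp add: sum_distrib_left algebra_simps)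
    also have "\<dots> \<le> l * real n powr \<sigma> * (D * (G n / real n) * real (card (A \<inter> {..M})) ^ card ?J)"
      using l K2 S by (intro mult_left_mono sum_p_top_reps_le n) (auto simp: K2_def)
    also have "\<dots> \<le> l * real n powr \<sigma> * (D * (G n / real n) * (C1 ^ (h - 1) * G n ^ (h - 1) * (2 * real n powr (- 2 * \<sigma>))))"
      unfolding card using NM l D8 G_ge_1[OF n] by (intro mult_left_mono) auto
    also have "\<dots> = l * (2 * D * C1 ^ (h - 1)) * (G n * G n ^ (h - 1) / real n) * (real n powr \<sigma> * real n powr (- 2 * \<sigma>))"
      by (simp add: mult_ac)
    also have "real n powr \<sigma> * real n powr (- 2 * \<sigma>) = 1 / real n powr \<sigma>"
      using n1 by (simp only: powr_add[symmetric] powr_minus_divide[symmetric]) simp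
    also have "l * (2 * D * C1 ^ (h - 1)) * (G n * G n ^ (h - 1) / real n) * (1 / real n powr \<sigma>)
        = (l * \<mu> n) * (2 * D * C1 ^ (h - 1) / real n powr \<sigma>)" unfolding Ghn \<mu>_def by simp
    also have "l * \<mu> n = 3 * ln (real n) / T" using mu T by (simp add: l_def)
    also have "3 * ln (real n) / T * (2 * D * C1 ^ (h - 1) / real n powr \<sigma>)
        = (ln (real n) / T) * (6 * D * C1 ^ (h - 1) / real n powr \<sigma>)" by simp
    also have "\<dots> \<le> ln (real n) * 1"
    proof (intro mult_mono)
      have "ln (real n) * 1 \<le> ln (real n) * T" using T ln1 by (intro mult_left_mono) auto
      then show "ln (real n) / T \<le> ln (real n)" using T by (simp add: divide_le_eq)
      show "6 * D * C1 ^ (h - 1) / real n powr \<sigma> \<le> 1" using C1_le_powr_\<sigma>[OF n] n1 by (simp add: divide_le_eq)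
    qed (use ln1 D8 C1 in auto)
    finally show ?thesis by simp
  qed
  have "l * (\<Sum>k\<in>A \<inter> {..n}. ?w k) \<le> (\<Sum>k\<le>n. p k * (exp (l * ?w k) - 1)) + 3 * ln (real n)"
    unfolding l_def by (rule dominatedD[OF ev_full[OF n J S(1)]])
  also have "(\<Sum>k\<le>n. p k * (exp (l * ?w k) - 1))
      = (\<Sum>k\<in>K1. p k * (exp (l * ?w k) - 1)) + (\<Sum>k\<in>K2. p k * (exp (l * ?w k) - 1))"
  proof -
    have "{..n} = K1 \<union> K2" "K1 \<inter> K2 = {}" "finite K1" "finite K2" by (auto simp: K1_def K2_def)
    then show ?thesis by (simp only: sum.union_disjoint)
  qed
  finally have "l * (\<Sum>k\<in>A \<inter> {..n}. ?w k) \<le> 2 * l * (D * C1 ^ h * \<mu> n) + 4 * ln (real n)"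
    using S1 S2 by linarith
  also have "4 * ln (real n) = l * (4 / 3 * T * \<mu> n)" using mu T by (simp add: l_def)
  finally have "l * (\<Sum>k\<in>A \<inter> {..n}. ?w k) \<le> l * ((2 * D * C1 ^ h + 4 / 3 * T) * \<mu> n)"
    by (simp add: algebra_simps)
  then show ?thesis using l by simp
qed

lemma reps_le_\<mu>:
  assumes n: "n \<ge> k0"
  shows "real (reps b {1..h} A n) \<le> 2 ^ h * ((2 * D * C1 ^ h + 4 / 3 * T) * \<mu> n)"
  using top_sum_le_\<mu>[OF n] h2 D8 C1 T \<mu>(3)[OF n] by (intro reps_le_top) auto

section \<open>Lower bounds: members in residue classes and representations built from them\<close>

lemma count_residue_ge:
  assumes n: "n \<ge> E * k0" and \<rho>: "\<rho> < b h"
  shows "real (card (A \<inter> {k. n div E < k \<and> k \<le> 2 * (n div E) \<and> k mod b h = \<rho>})) \<ge> c2 * G n"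
proof -
  define s where "s = n div E"
  define R where "R = {k. s < k \<and> k \<le> 2 * s \<and> k mod b h = \<rho>}"
  have nk: "n \<ge> k0" using n by (rule k0_le_if)
  have E0: "E > 0" using bh by simp
  have sk: "s \<ge> k0" unfolding s_def using n E0 by (simp add: less_eq_div_iff_mult_less_eq mult.commute)
  have n1: "real n > 1" using nk k0_ge by auto
  have "2 * s \<le> E * s" using bh by (intro mult_le_mono1) simp
  also have "E * s \<le> n" unfolding s_def by simp
  finally have s2: "2 * s \<le> n" .
  have finR: "finite R" "R \<subseteq> {..n}" unfolding R_def using s2 by auto
  let ?w = "\<lambda>k. (if s < k \<and> k \<le> 2 * s \<and> k mod b h = \<rho> then 1 else 0) :: real"
  have "- 1 * (\<Sum>k\<in>A \<inter> {..n}. ?w k) \<le> (\<Sum>k\<le>n. p k * (exp (- 1 * ?w k) - 1)) + 3 * ln (real n)"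
    unfolding s_def by (rule dominatedD[OF ev_residue[OF nk \<rho>]])
  also have "(\<Sum>k\<in>A \<inter> {..n}. ?w k) = real (card (A \<inter> R))"
  proof -
    have "(\<Sum>k\<in>A \<inter> {..n}. ?w k) = (\<Sum>k\<in>A \<inter> R. 1)"
      by (rule sum.mono_neutral_cong_right) (use finR in \<open>auto simp: R_def\<close>)
    then show ?thesis by simp
  qed
  also have "(\<Sum>k\<le>n. p k * (exp (- 1 * ?w k) - 1)) = (\<Sum>k\<in>R. p k * (exp (- 1) - 1))"
    by (rule sum.mono_neutral_cong_right) (use finR in \<open>auto simp: R_def\<close>)
  also have "\<dots> \<le> (\<Sum>k\<in>R. - (G n / (2 * real n * D)))"
  proof (rule sum_mono)
    fix k assume k: "k \<in> R"
    then have "n \<le> k * E" unfolding R_def s_def using E0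
      by (metis (mono_tags, lifting) div_less_iff_less_mult less_imp_le mem_Collect_eq)
    then have "G n / (real n * D) \<le> p k" using k sk s2 by (intro p_ge) (auto simp: R_def)
    moreover have "p k * (exp (- 1) - 1) \<le> p k * (- (1 / 2))"
      using exp_neg_minus_one_le[of 1] p01 by (intro mult_left_mono) auto
    ultimately show "p k * (exp (- 1) - 1) \<le> - (G n / (2 * real n * D))" by (simp add: field_simps)
  qed
  also have "\<dots> = - (real (card R) * (G n / (2 * real n * D)))" by simp
  also have "\<dots> \<le> - (real n / (2 * real E * real (b h)) * (G n / (2 * real n * D)))"
  proof -
    have "real n / (2 * real E * real (b h)) \<le> real (card R)"
    proof -
      have "s div b h \<le> card R" unfolding R_def by (rule card_residue_class_interval[OF \<rho>])
      then have 1: "real (s div b h) \<le> real (card R)" by simp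
      have q: "real (b h) \<ge> 1" "real E \<ge> 1" using bh by auto
      have "real n / real E < real s + 1" unfolding s_def by (rule real_less_div_plus_one)
      moreover have "real s / real (b h) < real (s div b h) + 1" by (rule real_less_div_plus_one)
      ultimately have "real n / real E / real (b h) \<le> (real s + 1) / real (b h)" "(real s + 1) / real (b h) \<le> real (s div b h) + 2"
      proof -
        assume a: "real n / real E < real s + 1" "real s / real (b h) < real (s div b h) + 1"
        show "real n / real E / real (b h) \<le> (real s + 1) / real (b h)"
          using a q by (intro divide_right_mono) auto
        have "1 / real (b h) \<le> 1" using q by simp
        then show "(real s + 1) / real (b h) \<le> real (s div b h) + 2" using a by (simp add: add_divide_distrib)
      qed
      then have 2: "real n / (real E * real (b h)) \<le> real (s div b h) + 2" by simp
      \<comment> \<open>Two roundings down, by \<open>E\<close> and by \<open>b h\<close>, lose at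
        most 2; the requirement \<open>k0 \<ge> 4 * E * b h\<close> makes this at most half of the
        main term.\<close>
      have "real n \<ge> 4 * real E * real (b h)" using nk k0 by (metis (mono_tags) le_trans of_nat_le_iff of_nat_mult of_nat_numeral)
      then have "4 \<le> real n / (real E * real (b h))" using q by (simp add: le_divide_eq mult_ac)
      then have "real n / (2 * real E * real (b h)) \<le> real n / (real E * real (b h)) - 2"
        by (simp add: field_simps)
      then show ?thesis using 1 2 by linarith
    qed
    then show ?thesis using G_ge_1[OF nk] D8 n1 by (simp only: neg_le_iff_le) (intro mult_right_mono, auto)
  qed
  also have "real n / (2 * real E * real (b h)) * (G n / (2 * real n * D)) = 2 * c2 * G n"
    using n1 by (simp add: c2_def)
  \<comment> \<open>\<open>c2\<close> is half of the constant in the mean, so that the other half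
    absorbs the error.\<close>
  also have "3 * ln (real n) \<le> c2 * G n"
  proof -
    have "8 * real E * real (b h) * D > 0" using bh D8 by auto
    then show ?thesis using G_log[OF nk] by (simp add: c2_def le_divide_eq mult_ac)
  qed
  finally have "c2 * G n \<le> real (card (A \<inter> R))" by simp
  then show ?thesis unfolding R_def s_def .
qed

end

context good_set
begin

text \<open>If \<open>G n\<close> is small, so is \<open>G m\<close> for the remainder
  \<open>m\<close>, because \<open>m\<close> is of the order of \<open>n\<close>, and
  \<open>reps_bounded\<close> applies; otherwise the general \<open>O(\<psi>)\<close> bound is
  used.\<close>

lemma low_le_W:
  assumes n: "n \<ge> E * k0"
  shows "real (low n k A) \<le> W n"
proof -
  have nk: "n \<ge> k0" using n by (rule k0_le_if)
  have E0: "E > 0" using bh by simp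
  have J: "{1..<h} \<subseteq> {1..h}" by auto
  have ne: "{1..<h} \<noteq> {}" using h2 by auto
  have W0: "W n \<ge> 0" using Q C4 \<psi>_pos[OF nk] by (simp add: W_def)
  define m where "m = n - b h * k"
  show ?thesis
  proof (cases "low n k A = 0")
    case True
    then show ?thesis using W0 by simp
  next
    case False
    then have l: "low n k A = reps b {1..<h} (A \<inter> {n div E<..2 * (n div E)}) m"
      by (auto simp: low_def m_def split: if_splits)
    then have "low n k A \<le> reps b {1..<h} A m"
      using J by (auto intro!: reps_mono finite_index index_pos)
    moreover have "real (reps b {1..<h} A m) \<le> W n"
    proof (cases "G n ^ (h - 1) \<le> real n powr (1 - 2 * \<delta>)")
      case True
      \<comment> \<open>There is at least one remaining entry since \<open>h \<ge> 2\<close>, and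
        all of them exceed \<open>n div E\<close>.\<close>
      have "m \<ge> n div E + 1"
        using False l J ne by (intro reps_pos_lower[of b "{1..<h}" "A \<inter> {n div E<..2 * (n div E)}" m] finite_index index_pos) auto
      then have "n div E < m" by simp
      then have nm: "n \<le> m * E" using E0 by (simp add: div_less_iff_less_mult less_imp_le)
      have "n div E \<ge> k0" using n E0 by (simp add: less_eq_div_iff_mult_less_eq mult.commute)
      then have mk: "m \<ge> k0" using \<open>n div E < m\<close> by simp
      then have m1: "real m > 1" using k0_ge by auto
      have "G m ^ (h - 1) \<le> G n ^ (h - 1)"
        using G_mono[OF mk, of n] G_ge_1[OF mk] by (intro power_mono) (auto simp: m_def)
      also have "\<dots> \<le> real n powr (1 - 2 * \<delta>)" by (rule True)
      also have "\<dots> \<le> (real m * real E) powr (1 - 2 * \<delta>)"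
        using nm \<delta> by (intro powr_mono2) (auto simp: of_nat_mult[symmetric] simp del: of_nat_mult)
      also have "\<dots> = real m powr (1 - 2 * \<delta>) * real E powr (1 - 2 * \<delta>)" by (simp add: powr_mult)
      \<comment> \<open>The gap between the threshold exponent \<open>1 - 2 * \<delta>\<close> in
        \<open>W\<close> and \<open>1 - \<delta>\<close> in \<open>reps_bounded\<close> absorbs the
        factor \<open>E\<close> between \<open>n\<close> and \<open>m\<close>.\<close>
      also have "\<dots> \<le> real m powr (1 - 2 * \<delta>) * real m powr \<delta>"
      proof (intro mult_left_mono)
        have "real E powr (1 - 2 * \<delta>) \<le> real E powr 1" using bh \<delta> by (intro powr_mono) auto
        then show "real E powr (1 - 2 * \<delta>) \<le> real m powr \<delta>" using E_le_powr[OF mk] E0 by simp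
      qed auto
      also have "\<dots> = real m powr (1 - \<delta>)" using m1 by (simp add: powr_add[symmetric])
      finally have "G m ^ card {1..<h} \<le> real m powr (1 - \<delta>)" by simp
      then have "real (reps b {1..<h} A m) \<le> Q ^ card {1..<h}" using J by (intro reps_bounded) auto
      also have "\<dots> \<le> Q ^ h" using Q by (intro power_increasing) auto
      finally show ?thesis using True by (simp add: W_def)
    next
      case False
      have "real (reps b {1..<h} A m) \<le> C4 * \<psi> n"
        using J nk by (intro reps_le_\<psi>') (auto simp: m_def)
      then show ?thesis using False by (simp add: W_def)
    qed
    ultimately show ?thesis by linarith
  qed
qed

lemma sum_low_ge:
  assumes n: "n \<ge> E * k0"
  shows "(c2 * G n) ^ (h - 1) \<le> real (\<Sum>k\<le>n. low n k A)"
proof -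
  define s where "s = n div E"
  have nk: "n \<ge> k0" using n by (rule k0_le_if)
  have n0: "n > 0" using nk k0_ge by simp
  obtain \<rho> where \<rho>: "\<And>i. \<rho> i < b h"
    and \<rho>d: "\<And>k. (\<forall>i\<in>{1..<h}. k i mod b h = \<rho> i) \<Longrightarrow>
      int (b h) dvd int n - (\<Sum>i\<in>{1..<h}. int (b i) * int (k i))"
    using residues_solving_congruence[of h b n] bgcd bh h2 by (metis One_nat_def Suc_le_lessD Suc_leD numeral_2_eq_2)
  define R where "R i = A \<inter> {k. s < k \<and> k \<le> 2 * s \<and> k mod b h = \<rho> i}" for i
  define P where "P = {k :: nat \<Rightarrow> nat. (\<forall>i. i \<notin> {1..<h} \<longrightarrow> k i = 0) \<and> (\<forall>i\<in>{1..<h}. k i \<in> R i)}"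
  define K where "K = {k. k \<le> n \<and> 2 * s < k \<and> b h * k \<le> n}"
  have finK: "finite K" unfolding K_def by (rule finite_subset[of _ "{..n}"]) auto
  have c2: "c2 > 0" unfolding c2_def using bh D8 by auto
  have "(c2 * G n) ^ (h - 1) = (\<Prod>i\<in>{1..<h}. c2 * G n)" by simp
  also have "\<dots> \<le> (\<Prod>i\<in>{1..<h}. real (card (R i)))"
    using count_residue_ge[OF n \<rho>] c2 G_ge_1[OF nk] unfolding R_def s_def by (intro prod_mono) auto
  also have "\<dots> = real (card P)" unfolding P_def by (subst card_zero_extended_PiE) auto
  also have "card P \<le> card (\<Union>k\<in>K. tuples b {1..<h} (A \<inter> {s<..2 * s}) (n - b h * k))"
  proof (intro card_mono)
    show "finite (\<Union>k\<in>K. tuples b {1..<h} (A \<inter> {s<..2 * s}) (n - b h * k))"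
      using finK bpos by (auto intro!: finite_tuples)
    show "P \<subseteq> (\<Union>k\<in>K. tuples b {1..<h} (A \<inter> {s<..2 * s}) (n - b h * k))"
    proof
      fix \<kappa> assume \<kappa>: "\<kappa> \<in> P"
      define t where "t = (\<Sum>i\<in>{1..<h}. b i * \<kappa> i)"
      define x where "x = b h * (2 * s)"
      define y where "y = sum b {1..<h} * (2 * s)"
      have "t \<le> (\<Sum>i\<in>{1..<h}. b i * (2 * s))"
        unfolding t_def using \<kappa> by (intro sum_mono mult_le_mono2) (auto simp: P_def R_def)
      also have "\<dots> = sum b {1..<h} * (2 * s)" by (simp add: sum_distrib_right)
      finally have ty: "t \<le> y" by (simp only: y_def)
      have H: "sum b {1..h} = b h + sum b {1..<h}"
      proof -
        have "{1..h} = insert h {1..<h}" using h2 by auto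
        then show ?thesis by simp
      qed
      have "8 * sum b {1..h} * s \<le> E * s" using E8 by (intro mult_le_mono1)
      also have "\<dots> \<le> n" by (simp add: s_def)
      finally have Es: "4 * (x + y) \<le> n"
        unfolding H x_def y_def by (simp add: algebra_simps)
      then have tn: "t \<le> n" using ty by simp
      have "\<forall>i\<in>{1..<h}. \<kappa> i mod b h = \<rho> i" using \<kappa> by (auto simp: P_def R_def)
      from \<rho>d[OF this] have "int (b h) dvd int (n - t)" using tn by (simp add: of_nat_diff t_def)
      then obtain k where k: "n - t = b h * k" unfolding int_dvd_int_iff by (auto simp: dvd_def)
      \<comment> \<open>The first entries use at most a quarter of \<open>n\<close> because
        \<open>E\<close> is at least 8 times the sum of the coefficients, so the last entry must be
        the largest.\<close>
      have "2 * s < k"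
      proof (rule ccontr)
        assume "\<not> 2 * s < k"
        then have "b h * k \<le> x" unfolding x_def by (intro mult_le_mono2) simp
        then have "n \<le> x + y" using k ty tn by simp
        then show False using Es n0 by simp
      qed
      moreover have "b h * k \<le> n" using k by simp
      moreover have "1 * k \<le> b h * k" using bh by (intro mult_le_mono1) simp
      then have "k \<le> n" using \<open>b h * k \<le> n\<close> by linarith
      ultimately have "k \<in> K" by (simp add: K_def)
      moreover have "\<kappa> \<in> tuples b {1..<h} (A \<inter> {s<..2 * s}) (n - b h * k)"
        using \<kappa> k tn by (auto simp: P_def R_def tuples_def t_def)
      ultimately show "\<kappa> \<in> (\<Union>k\<in>K. tuples b {1..<h} (A \<inter> {s<..2 * s}) (n - b h * k))" by blast
    qed
  qed
  also have "\<dots> \<le> (\<Sum>k\<in>K. reps b {1..<h} (A \<inter> {s<..2 * s}) (n - b h * k))"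
    unfolding reps_def by (intro card_UN_le finK)
  also have "\<dots> = (\<Sum>k\<in>K. low n k A)" by (intro sum.cong) (auto simp: K_def low_def s_def)
  also have "\<dots> \<le> (\<Sum>k\<le>n. low n k A)" by (intro sum_mono2) (auto simp: K_def)
  finally show ?thesis by simp
qed

text \<open>Linearising the negative exponentials costs half of the mean
  \<open>c7 * \<mu> n\<close>, and the error \<open>3 * W n * ln n\<close> at most another quarter
  of it. If \<open>G n\<close> is small, the error is controlled by the factor \<open>L\<close> in
  \<open>\<mu> n \<ge> L * ln n\<close>; otherwise \<open>\<mu> n\<close> is at least a power of
  n.\<close>

lemma reps_ge_\<mu>:
  assumes n: "n \<ge> E * k0"
  shows "real (reps b {1..h} A n) \<ge> c7 / 4 * \<mu> n"
proof -
  have nk: "n \<ge> k0" using n by (rule k0_le_if)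
  have E0: "E > 0" using bh by simp
  have n1: "real n > 1" using nk k0_ge by auto
  have ln1: "ln (real n) \<ge> 1" by (rule ln_ge_1[OF nk])
  have c2: "c2 > 0" unfolding c2_def using bh D8 by auto
  have c7: "c7 > 0" unfolding c7_def using c2 D8 by auto
  have W: "W n > 0" using Q C4 \<psi>_pos[OF nk] by (simp add: W_def)
  let ?w = "\<lambda>k. real (low n k A)"
  have "(\<Sum>k\<in>A \<inter> {..n}. low n k A) = (\<Sum>k\<in>A \<inter> {k. 2 * (n div E) < k \<and> b h * k \<le> n}.
      reps b {1..<h} (A \<inter> {n div E<..2 * (n div E)}) (n - b h * k))"
  proof (rule sum.mono_neutral_cong_right)
    have "k \<le> n" if "b h * k \<le> n" for k
    proof -
      have "1 * k \<le> b h * k" using bh by (intro mult_le_mono1) simp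
      then show ?thesis using that by linarith
    qed
    then show "A \<inter> {k. 2 * (n div E) < k \<and> b h * k \<le> n} \<subseteq> A \<inter> {..n}" by auto
  qed (auto simp: low_def)
  also have "\<dots> \<le> reps b {1..h} A n"
  proof (rule sum_reps_prefix_le)
    show "finite (A \<inter> {k. 2 * (n div E) < k \<and> b h * k \<le> n})"
    proof (rule finite_subset)
      show "A \<inter> {k. 2 * (n div E) < k \<and> b h * k \<le> n} \<subseteq> {..n}"
      proof
        fix k assume "k \<in> A \<inter> {k. 2 * (n div E) < k \<and> b h * k \<le> n}"
        then have "b h * k \<le> n" by blast
        moreover have "1 * k \<le> b h * k" using bh by (intro mult_le_mono1) simp
        ultimately have "k \<le> n" by linarith
        then show "k \<in> {..n}" by simp
      qed
    qed simp
  qed (use h2 bpos in auto)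
  finally have Y: "(\<Sum>k\<in>A \<inter> {..n}. ?w k) \<le> real (reps b {1..h} A n)"
    by (metis of_nat_le_iff of_nat_sum)
  have "G n / (real n * D) * ?w k \<le> p k * ?w k" for k
  proof (cases "low n k A = 0")
    case False
    then have k: "2 * (n div E) < k" "b h * k \<le> n" by (auto simp: low_def split: if_splits)
    have "1 * k \<le> b h * k" using bh by (intro mult_le_mono1) simp
    then have "k \<le> n" using k by linarith
    moreover have "n div E \<ge> k0" using n E0 by (simp add: less_eq_div_iff_mult_less_eq mult.commute)
    then have "k0 \<le> k" using k by linarith
    moreover have "n div E < k" using k by linarith
    then have "n \<le> k * E" using E0 by (simp add: div_less_iff_less_mult less_imp_le)
    ultimately show ?thesis by (intro mult_right_mono p_ge) auto
  qed simp
  then have "G n / (real n * D) * real (\<Sum>k\<le>n. low n k A) \<le> (\<Sum>k\<le>n. p k * ?w k)"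
    by (simp add: sum_distrib_left sum_mono)
  moreover have "G n / (real n * D) * (c2 * G n) ^ (h - 1) \<le> G n / (real n * D) * real (\<Sum>k\<le>n. low n k A)"
    using sum_low_ge[OF n] G_ge_1[OF nk] D8 by (intro mult_left_mono) auto
  moreover have "G n / (real n * D) * (c2 * G n) ^ (h - 1) = c7 * \<mu> n"
  proof -
    have "G n * G n ^ (h - 1) = G n ^ h" using h2 by (simp add: power_Suc[symmetric])
    then have "\<mu> n = G n * G n ^ (h - 1) / real n" by (simp add: \<mu>_def)
    then show ?thesis by (simp add: c7_def power_mult_distrib mult_ac)
  qed
  ultimately have V: "c7 * \<mu> n \<le> (\<Sum>k\<le>n. p k * ?w k)" by linarith
  have "- (1 / W n) * (\<Sum>k\<in>A \<inter> {..n}. ?w k) \<le> (\<Sum>k\<le>n. p k * (exp (- (1 / W n) * ?w k) - 1)) + 3 * ln (real n)"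
    by (rule dominatedD[OF ev_low[OF nk]])
  also have "(\<Sum>k\<le>n. p k * (exp (- (1 / W n) * ?w k) - 1)) \<le> (\<Sum>k\<le>n. p k * (- (1 / (2 * W n)) * ?w k))"
  proof (intro sum_mono mult_left_mono p01)
    fix k
    have "exp (- (?w k / W n)) - 1 \<le> - (?w k / W n / 2)"
      using low_le_W[OF n, of k] W by (intro exp_neg_minus_one_le) auto
    then show "exp (- (1 / W n) * ?w k) - 1 \<le> - (1 / (2 * W n)) * ?w k" by (simp add: mult.commute)
  qed
  also have "\<dots> = - (1 / (2 * W n)) * (\<Sum>k\<le>n. p k * ?w k)" by (simp add: sum_distrib_left mult_ac)
  also have "\<dots> \<le> - (1 / (2 * W n)) * (c7 * \<mu> n)" using V W by (intro mult_left_mono_neg) auto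
  finally have "c7 * \<mu> n / 2 - 3 * W n * ln (real n) \<le> (\<Sum>k\<in>A \<inter> {..n}. ?w k)"
    using W by (simp add: field_simps)
  moreover have "12 * W n * ln (real n) \<le> c7 * \<mu> n"
  proof (cases "G n ^ (h - 1) \<le> real n powr (1 - 2 * \<delta>)")
    case True
    have "12 * Q ^ h * ln (real n) \<le> L * c7 * ln (real n)" using L ln1 by (intro mult_right_mono) auto
    also have "\<dots> = c7 * (L * ln (real n))" by simp
    also have "\<dots> \<le> c7 * \<mu> n" using \<mu>(1)[OF nk] c7 by (intro mult_left_mono) auto
    finally show ?thesis using True by (simp add: W_def)
  next
    case False
    \<comment> \<open>Here \<open>G n ^ (h - 1)\<close> exceeds
      \<open>n powr (1 - 2 * \<delta>)\<close>, one more factor \<open>G n\<close> gives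
      \<open>n powr (1 / h)\<close>, and \<open>2 * \<delta> = 1 / (2 * h)\<close>.\<close>
    have "real n powr (1 / (2 * real h)) * real n = real n powr (1 - 2 * \<delta>) * real n powr (1 / real h)"
    proof -
      have "1 / (2 * real h) + 1 = 1 - 2 * \<delta> + 1 / real h" using h2 by (simp add: \<delta>_def field_simps)
      then show ?thesis using n1 by (metis less_trans zero_less_one order.strict_implies_order powr_add powr_one)
    qed
    also have "\<dots> \<le> G n ^ (h - 1) * G n" using False G_root[OF nk] G_ge_1[OF nk] by (intro mult_mono) auto
    also have "\<dots> = G n ^ h" using h2 by (simp add: power_Suc[symmetric] mult.commute)
    finally have "real n powr (1 / (2 * real h)) \<le> \<mu> n" using n1 by (simp add: \<mu>_def le_divide_eq)
    then have "c7 * real n powr (1 / (2 * real h)) \<le> c7 * \<mu> n" using c7 by (intro mult_left_mono) auto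
    then show ?thesis using \<psi>_ln_le_root[OF nk] False by (simp add: W_def mult_ac)
  qed
  ultimately show ?thesis using Y by (simp add: algebra_simps)
qed

lemma count_ge:
  assumes n: "n \<ge> E * k0"
  shows "real (card (A \<inter> {..n})) \<ge> c2 * G n"
proof -
  have "2 * (n div E) \<le> E * (n div E)" using bh by (intro mult_le_mono1) simp
  also have "\<dots> \<le> n" by simp
  finally have "card (A \<inter> {k. n div E < k \<and> k \<le> 2 * (n div E) \<and> k mod b h = 0}) \<le> card (A \<inter> {..n})"
    by (intro card_mono) auto
  then show ?thesis using count_residue_ge[OF n, of 0] bh by simp
qed

end

section \<open>Existence of a set satisfying all moment bounds\<close>

context growth_data
begin

text \<open>There are at most \<open>3 * 2 ^ (2 * h) + b h + 2\<close> families of weights, three of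
  them indexed by pairs \<open>(J, S)\<close> and one by residues. Each is predictable; for
  \<open>low\<close> this holds because its entries stay below
  \<open>2 * (n div E) < k\<close>.\<close>

lemma good_set_exists:
  assumes k0_big: "k0 \<ge> 3 * 2 ^ (2 * h) + b h + 5"
  shows "\<exists>A. good_set h b E D Cu Cl c0 L G \<psi> k0 A"
proof -
  define u1 :: "nat \<Rightarrow> nat \<Rightarrow> nat set \<Rightarrow> real" where
    "u1 = (\<lambda>n k X. 1 * (if k \<le> n \<and> n < k * E then 1 else 0))"
  define u2 :: "nat \<Rightarrow> nat \<Rightarrow> nat \<Rightarrow> nat set \<Rightarrow> real" where
    "u2 = (\<lambda>\<rho> n k X. - 1 * (if n div E < k \<and> k \<le> 2 * (n div E) \<and> k mod b h = \<rho> then 1 else 0))"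
  define u3 where "u3 = (\<lambda>(J, S) n k X. \<delta> / 2 * ln (real n) / Q ^ card J * real (top_reps b J S n k X))"
  define u4 where "u4 = (\<lambda>(J, S) n k X. 1 / Q ^ h * real (top_reps b J S n k X))"
  define u5 where "u5 = (\<lambda>(J, S) n k X. 3 * ln (real n) / (T * \<mu> n) * real (top_reps b J S n k X))"
  define u6 where "u6 = (\<lambda>n k X. - (1 / W n) * real (low n k X))"
  let ?P = "Pow {1..h} \<times> Pow {1..h}"
  define U where "U = {u1} \<union> u2 ` {..<b h} \<union> u3 ` ?P \<union> u4 ` ?P \<union> u5 ` ?P \<union> {u6}"
  have fin: "finite U" unfolding U_def by auto
  have cP: "card ?P = 2 ^ (2 * h)" by (simp add: card_cartesian_product card_Pow mult_2 power_add)
  have "card U \<le> card {u1} + card (u2 ` {..<b h}) + card (u3 ` ?P) + card (u4 ` ?P) + card (u5 ` ?P) + card {u6}"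
    unfolding U_def by (intro order_trans[OF card_Un_le] add_mono order_refl)
  also have "\<dots> \<le> 1 + b h + 2 ^ (2 * h) + 2 ^ (2 * h) + 2 ^ (2 * h) + 1"
    using card_image_le[of "{..<b h}" u2] card_image_le[of ?P u3] card_image_le[of ?P u4] card_image_le[of ?P u5]
    unfolding cP by (intro add_mono) auto
  finally have cU: "k0 \<ge> card U + 3" using k0_big by linarith
  have low_pred: "low n k (X \<inter> {..<k}) = low n k X" for n k X
  proof (cases "2 * (n div E) < k")
    case True
    then have "X \<inter> {..<k} \<inter> {n div E<..2 * (n div E)} = X \<inter> {n div E<..2 * (n div E)}" by auto
    then show ?thesis by (simp add: low_def)
  qed (simp add: low_def)
  have pred: "u n k X = u n k (X \<inter> {..<k})" if "u \<in> U" for u n k X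
    using that
    by (auto simp: U_def u1_def u2_def u3_def u4_def u5_def u6_def top_reps_predictable low_pred)
  obtain A where A: "\<forall>k\<in>A. p k > 0" and
    dom: "\<forall>u\<in>U. \<forall>n\<ge>k0. \<forall>N. (\<Sum>k<N. (if k \<in> A then u n k A else 0) - p k * (exp (u n k A) - 1)) \<le> 3 * ln (real n)"
    proof -
    have "\<exists>A. (\<forall>k\<in>A. p k > 0) \<and> (\<forall>u\<in>U. \<forall>n\<ge>k0. \<forall>N.
      (\<Sum>k<N. (if k \<in> A then u n k A else 0) - p k * (exp (u n k A) - 1)) \<le> 3 * ln (real n))"
      by (rule simultaneous_exponential_bounds[OF p01 fin cU]) (rule pred)
    then show ?thesis using that by blast
  qed
  have dom': "dominated A n (\<lambda>k. u n k A)" if "u \<in> U" "n \<ge> k0" for u n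
    using dom that unfolding dominated_def by blast
  have "good_set h b E D Cu Cl c0 L G \<psi> k0 A"
  proof (intro good_set.intro good_set_axioms.intro; (rule growth_data_axioms)?)
    fix k assume "k \<in> A"
    then show "k0 \<le> k" using A by (auto simp: p_def split: if_splits)
  next
    fix n assume n: "k0 \<le> n"
    show "dominated A n (\<lambda>k. 1 * (if k \<le> n \<and> n < k * E then 1 else 0))"
      using dom'[of u1, OF _ n] by (simp add: U_def u1_def)
  next
    fix n assume n: "k0 \<le> n"
    show "dominated A n (\<lambda>k. - (1 / W n) * real (low n k A))"
      using dom'[of u6, OF _ n] by (simp add: U_def u6_def)
  next
    fix n \<rho> assume n: "k0 \<le> n" and \<rho>: "\<rho> < b h"
    show "dominated A n (\<lambda>k. - 1 * (if n div E < k \<and> k \<le> 2 * (n div E) \<and> k mod b h = \<rho> then 1 else 0))"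
      using dom'[of "u2 \<rho>", OF _ n] \<rho> by (simp add: U_def u2_def)
  next
    fix n J S assume n: "k0 \<le> n" and JS: "J \<subseteq> {1..h}" "S \<subseteq> {1..h}"
    then have JSU: "u3 (J, S) \<in> U" unfolding U_def by blast
    show "dominated A n (\<lambda>k. 1 / (4 * real h) / 2 * ln (real n) / (32 * real h * 2 ^ h) ^ card J * real (top_reps b J S n k A))"
      using dom'[OF JSU n] unfolding u3_def \<delta>_def Q_def by simp
  next
    fix n J S assume n: "k0 \<le> n" and JS: "J \<subseteq> {1..h}" "S \<subseteq> {1..h}"
    then have JSU: "u4 (J, S) \<in> U" unfolding U_def by blast
    show "dominated A n (\<lambda>k. 1 / (32 * real h * 2 ^ h) ^ h * real (top_reps b J S n k A))"
      using dom'[OF JSU n] unfolding u4_def Q_def by simp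
  next
    fix n J S assume n: "k0 \<le> n" and JS: "J \<subseteq> {1..h}" "S \<subseteq> {1..h}"
    then have JSU: "u5 (J, S) \<in> U" unfolding U_def by blast
    have "dominated A n (\<lambda>k. 3 * ln (real n) / (T * \<mu> n) * real (top_reps b J S n k A))"
      using dom'[OF JSU n] unfolding u5_def by simp
    then show "dominated A n (\<lambda>k. 3 * ln (real n) / ((3 * (32 * real h * 2 ^ h) ^ h + 3 * (2 ^ h * (2 * D * (4 * D + 2) ^ h * Cu + 3 * (32 * real h * 2 ^ h) ^ h * Cl)) / (c0 * (ln 2 / (8 * real h * ln (real E))))) * \<mu> n) * real (top_reps b J S n k A))"
      unfolding T_def C4_def C1_def Q_def \<sigma>_def .
  qed
  then show ?thesis by blast
qed

end

subsection \<open>The logarithmic integral of \<open>f\<close> and slowly varying functions\<close>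

lemma power_exceeds:
  fixes r c :: real
  assumes "r > 1"
  shows "\<exists>j. c \<le> r ^ j"
  using real_arch_pow[OF assms, of c] less_imp_le by blast

text \<open>The two inequalities are the two halves of the comparison of \<open>f\<close> with its
  logarithmic integral: \<open>Ff\<close> makes the integral grow at least like a power,
  \<open>fF\<close> makes it doubling.\<close>

locale log_density =
  fixes f :: "real \<Rightarrow> real" and C1 C2 x0 :: real
  assumes fpos: "\<And>x. x \<ge> 1 \<Longrightarrow> f x > 0"
    and floc: "\<And>y. y \<ge> 1 \<Longrightarrow> f integrable_on {1..y}"
    and x0: "x0 \<ge> 1" and C1: "C1 > 0" and C2: "C2 > 0"
    and Ff: "\<And>x. x \<ge> x0 \<Longrightarrow> integral {1..x} (\<lambda>t. f t / t) \<le> C1 * f x"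
    and fF: "\<And>x. x \<ge> x0 \<Longrightarrow> f x \<le> C2 * integral {1..x} (\<lambda>t. f t / t)"
begin

definition F :: "real \<Rightarrow> real" where "F x = integral {1..x} (\<lambda>t. f t / t)"

text \<open>A positive gauge-integrable \<open>f\<close> is absolutely integrable, and the factor
  \<open>1 / t\<close> is bounded and measurable on the interval.\<close>

lemma integrable_1: "(\<lambda>t. f t / t) integrable_on {1..y}" if "y \<ge> 1"
proof -
  have "f absolutely_integrable_on {1..y}"
    using floc[OF that] fpos by (intro nonnegative_absolutely_integrable_1) (auto intro: less_imp_le)
  then have "(\<lambda>t. inverse t * f t) absolutely_integrable_on {1..y}"
  proof (intro absolutely_integrable_bounded_measurable_product_real)
    have c: "continuous_on {1..y} (\<lambda>t::real. inverse t)" by (intro continuous_intros) auto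
    show "inverse \<in> borel_measurable (lebesgue_on {1..y})"
      using c by (intro continuous_imp_measurable_on_sets_lebesgue) auto
    show "bounded (inverse ` {1..y})"
      using compact_continuous_image[OF c] compact_imp_bounded by blast
  qed auto
  then show ?thesis
    by (simp add: absolutely_integrable_on_def divide_inverse mult.commute)
qed

lemma integrable_sub: "(\<lambda>t. f t / t) integrable_on {x..y}" if "1 \<le> x"
proof (cases "x \<le> y")
  case True
  then show ?thesis
    by (rule_tac integrable_on_subinterval[OF integrable_1[of y]]) (use that in auto)
next
  case False
  then show ?thesis by (simp add: integrable_on_empty)
qed

lemma F_diff: "F y - F x = integral {x..y} (\<lambda>t. f t / t)" if "1 \<le> x" "x \<le> y"
  using Henstock_Kurzweil_Integration.integral_combine[of 1 x y "\<lambda>t. f t / t"] integrable_1[of y] that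
  by (simp add: F_def)

lemma F_mono: "F x \<le> F y" if "1 \<le> x" "x \<le> y"
proof -
  have "0 \<le> integral {x..y} (\<lambda>t. f t / t)"
    using that fpos by (intro integral_nonneg integrable_sub) (auto intro!: divide_nonneg_nonneg less_imp_le)
  then show ?thesis using F_diff[OF that] by simp
qed

lemma F_pos: "F x > 0" if "x \<ge> x0"
proof -
  have "0 < f x" using that x0 by (intro fpos) auto
  also have "f x \<le> C2 * F x" using fF[OF that] by (simp add: F_def)
  finally show ?thesis using C2 by (simp add: zero_less_mult_iff)
qed

text \<open>On \<open>{x..y}\<close> the integrand is at most \<open>C2 * F y / x\<close>, and the
  interval is so short that the increment is at most \<open>F y / 2\<close>.\<close>

lemma F_step_upper: "F y \<le> 2 * F x" if "x0 \<le> x" "x \<le> y" "y \<le> (1 + 1 / (2 * C2)) * x"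
proof -
  have x: "x > 0" "1 \<le> x" using that x0 by auto
  have "F y - F x = integral {x..y} (\<lambda>t. f t / t)" using that x by (intro F_diff) auto
  also have "\<dots> \<le> integral {x..y} (\<lambda>t. C2 * F y / x)"
  proof (intro integral_le integrable_sub)
    fix t assume t: "t \<in> {x..y}"
    have "f t \<le> C2 * F t" using fF[of t] t that by (simp add: F_def)
    also have "\<dots> \<le> C2 * F y" using C2 t x by (intro mult_left_mono F_mono) auto
    finally have "f t \<le> C2 * F y" .
    then show "f t / t \<le> C2 * F y / x"
      using t x fpos[of t] F_pos[of y] that C2 by (intro frac_le) auto
  qed (use x in auto)
  also have "\<dots> = (y - x) * (C2 * F y / x)" using that by simp
  also have "\<dots> \<le> (x / (2 * C2)) * (C2 * F y / x)"
    using that F_pos[of y] C2 x by (intro mult_right_mono) (auto simp: algebra_simps)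
  also have "\<dots> = F y / 2" using x C2 by simp
  finally show ?thesis by simp
qed

lemma F_doubling: "\<exists>D\<ge>1. \<forall>x\<ge>x0. F (2 * x) \<le> D * F x"
proof -
  define r where "r = 1 + 1 / (2 * C2)"
  have r: "r > 1" using C2 by (simp add: r_def)
  obtain j where j: "2 \<le> r ^ j" using power_exceeds[OF r] by blast
  have iter: "F (r ^ i * x) \<le> 2 ^ i * F x" if x: "x \<ge> x0" for x i
  proof (induction i)
    case (Suc i)
    have "1 * x \<le> r ^ i * x" using r x x0 by (intro mult_right_mono one_le_power) auto
    then have ge: "x0 \<le> r ^ i * x" using x by simp
    have "1 * (r ^ i * x) \<le> r * (r ^ i * x)" using r ge x0 by (intro mult_right_mono) auto
    then have "F (r * (r ^ i * x)) \<le> 2 * F (r ^ i * x)"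
      using ge by (intro F_step_upper) (auto simp: r_def)
    then show ?case using Suc by (simp add: mult.assoc)
  qed simp
  have "F (2 * x) \<le> 2 ^ j * F x" if x: "x \<ge> x0" for x
  proof -
    have "F (2 * x) \<le> F (r ^ j * x)" using j x x0 by (intro F_mono mult_right_mono) auto
    then show ?thesis using iter[OF x, of j] by simp
  qed
  then show ?thesis by (intro exI[of _ "2 ^ j"]) auto
qed

text \<open>On \<open>{x..2 * x}\<close> the integrand is at least
  \<open>F x / (2 * C1 * x)\<close>, so doubling \<open>x\<close> multiplies \<open>F\<close> by at
  least \<open>1 + 1 / (2 * C1)\<close>; enough doublings give a factor 2.\<close>

lemma F_growth: "\<exists>\<Lambda>::nat. \<Lambda> \<ge> 2 \<and> (\<forall>x y. x0 \<le> x \<longrightarrow> x * real \<Lambda> \<le> y \<longrightarrow> 2 * F x \<le> F y)"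
proof -
  define r where "r = 1 + 1 / (2 * C1)"
  have r: "r > 1" using C1 by (simp add: r_def)
  have step: "r * F x \<le> F (2 * x)" if "x0 \<le> x" for x
  proof -
    have x: "x > 0" "1 \<le> x" using that x0 by auto
    have "F x / (2 * C1) = integral {x..2 * x} (\<lambda>t. F x / C1 / (2 * x))" using x by simp
    also have "\<dots> \<le> integral {x..2 * x} (\<lambda>t. f t / t)"
    proof (intro integral_le integrable_sub)
      fix t assume t: "t \<in> {x..2 * x}"
      have "F x \<le> F t" using t x by (intro F_mono) auto
      also have "\<dots> \<le> C1 * f t" using Ff[of t] t that by (simp add: F_def)
      finally have "F x / C1 \<le> f t" using C1 by (simp add: divide_le_eq mult.commute)
      then show "F x / C1 / (2 * x) \<le> f t / t"
        using t x fpos[of t] by (intro frac_le) auto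
    qed (use x in auto)
    also have "\<dots> = F (2 * x) - F x" using x by (intro F_diff[symmetric]) auto
    finally show ?thesis by (simp add: r_def algebra_simps)
  qed
  have iter: "r ^ i * F x \<le> F (2 ^ i * x)" if x: "x \<ge> x0" for x i
  proof (induction i)
    case (Suc i)
    have "1 * x \<le> 2 ^ i * x" using x x0 by (intro mult_right_mono one_le_power) auto
    then have "r * F (2 ^ i * x) \<le> F (2 * (2 ^ i * x))" using x by (intro step) auto
    moreover have "r * (r ^ i * F x) \<le> r * F (2 ^ i * x)" using Suc r by (intro mult_left_mono) auto
    ultimately show ?case by (simp add: mult.assoc)
  qed simp
  obtain j where j: "2 \<le> r ^ j" using power_exceeds[OF r] by blast
  have "2 * F x \<le> F y" if x: "x0 \<le> x" and y: "x * real (2 ^ Suc j) \<le> y" for x y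
  proof -
    have "2 * F x \<le> r ^ j * F x" using j F_pos[OF x] by (intro mult_right_mono) auto
    also have "\<dots> \<le> F (2 ^ j * x)" by (rule iter[OF x])
    also have "\<dots> \<le> F y"
    proof (rule F_mono)
      have "1 * 1 \<le> 2 ^ j * x" using x x0 by (intro mult_mono) auto
      then show "1 \<le> 2 ^ j * x" by simp
      show "2 ^ j * x \<le> y" using y \<open>1 \<le> 2 ^ j * x\<close> by (simp add: mult_ac)
    qed
    finally show ?thesis .
  qed
  moreover have "(2::nat) \<le> 2 ^ Suc j" by simp
  ultimately show ?thesis by blast
qed

end

section \<open>Constants, logarithms and slowly varying functions against powers\<close>

lemma eventually_const_le_powr:
  fixes a e :: real
  assumes "e > 0"
  shows "eventually (\<lambda>n. a \<le> real n powr e) sequentially"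
proof -
  have "eventually (\<lambda>n. (max a 1) powr (1 / e) \<le> real n) sequentially"
    using filterlim_real_sequentially by (simp add: filterlim_at_top)
  then show ?thesis
  proof eventually_elim
    case (elim n)
    have "a \<le> ((max a 1) powr (1 / e)) powr e" using assms by (simp add: powr_powr)
    also have "\<dots> \<le> real n powr e" using elim assms by (intro powr_mono2) auto
    finally show ?case .
  qed
qed

lemma eventually_ln_le_powr:
  fixes a e :: real
  assumes "e > 0"
  shows "eventually (\<lambda>n. a * ln (real n) \<le> real n powr e) sequentially"
  using eventually_const_le_powr[OF half_gt_zero[OF assms], of "2 * \<bar>a\<bar> / e"] eventually_ge_at_top[of 1]
proof eventually_elim
  case (elim n)
  have "a * ln (real n) \<le> \<bar>a\<bar> * ln (real n)" using elim by (intro mult_right_mono) auto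
  also have "\<dots> \<le> \<bar>a\<bar> * (real n powr (e / 2) / (e / 2))"
    using elim assms by (intro mult_left_mono ln_powr_bound) auto
  also have "\<dots> = 2 * \<bar>a\<bar> / e * real n powr (e / 2)" by simp
  also have "\<dots> \<le> real n powr (e / 2) * real n powr (e / 2)" using elim by (intro mult_right_mono) auto
  also have "\<dots> = real n powr e" using elim by (simp add: powr_add[symmetric])
  finally show ?case .
qed

text \<open>Eventually each doubling of the argument multiplies \<open>\<psi>\<close> by at most
  \<open>2 powr (e / 2)\<close>. Iteration along \<open>2 ^ i * x0\<close>, with monotonicity in
  between, gives a constant times \<open>x powr (e / 2)\<close>, and the other half of the exponent
  absorbs the constant.\<close>

lemma slowly_varying_le_powr:
  assumes sv: "slowly_varying \<psi>" and mono: "mono_on {1..} \<psi>" and e: "e > 0"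
  shows "eventually (\<lambda>n. \<psi> (real n) \<le> real n powr e) sequentially"
proof -
  define d where "d = e / 2"
  have d: "d > 0" using e by (simp add: d_def)
  have pos: "\<psi> x > 0" if "x \<ge> 1" for x using sv that by (auto simp: slowly_varying_def)
  have "((\<lambda>x. \<psi> (2 * x) / \<psi> x) \<longlongrightarrow> 1) at_top" using sv by (auto simp: slowly_varying_def)
  moreover have "1 < (2::real) powr d" using d by simp
  ultimately have "eventually (\<lambda>x. \<psi> (2 * x) / \<psi> x < 2 powr d) at_top"
    by (rule order_tendstoD(2))
  then obtain x1 where x1: "\<And>x. x \<ge> x1 \<Longrightarrow> \<psi> (2 * x) / \<psi> x < 2 powr d"
    by (auto simp: eventually_at_top_linorder)
  define x0 where "x0 = max x1 1"
  have x0: "x0 \<ge> 1" by (simp add: x0_def)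
  have step: "\<psi> (2 * x) \<le> 2 powr d * \<psi> x" if "x \<ge> x0" for x
    using x1[of x] pos[of x] that by (simp add: x0_def divide_less_eq less_imp_le)
  have iter: "\<psi> (2 ^ i * x0) \<le> (2 powr d) ^ i * \<psi> x0" for i
  proof (induction i)
    case (Suc i)
    have "1 * x0 \<le> 2 ^ i * x0" using x0 by (intro mult_right_mono one_le_power) auto
    then have "\<psi> (2 * (2 ^ i * x0)) \<le> 2 powr d * \<psi> (2 ^ i * x0)" by (intro step) auto
    also have "\<dots> \<le> 2 powr d * ((2 powr d) ^ i * \<psi> x0)" using Suc by (intro mult_left_mono) auto
    finally show ?case by (simp add: mult.assoc)
  qed simp
  have bound: "\<psi> x \<le> (2 powr d * \<psi> x0) * x powr d" if x: "x \<ge> x0" for x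
  proof -
    define y where "y = log 2 (x / x0)"
    have y0: "y \<ge> 0" using x x0 by (simp add: y_def)
    define i where "i = nat \<lceil>y\<rceil>"
    have i: "y \<le> real i" "real i \<le> y + 1" using y0 unfolding i_def by linarith+
    have "x = 2 powr y * x0" using x x0 by (simp add: y_def)
    also have "\<dots> \<le> 2 powr real i * x0" using i x0 by (intro mult_right_mono powr_mono) auto
    also have "\<dots> = 2 ^ i * x0" by (simp add: powr_realpow)
    finally have "\<psi> x \<le> \<psi> (2 ^ i * x0)" using x x0 by (intro mono_onD[OF mono]) auto
    also have "\<dots> \<le> (2 powr d) ^ i * \<psi> x0" by (rule iter)
    also have "(2 powr d) ^ i = (2 powr d) powr real i" by (intro powr_realpow[symmetric]) auto
    also have "\<dots> = 2 powr (d * real i)" by (simp add: powr_powr)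
    also have "\<dots> \<le> 2 powr (d * (y + 1))" using i d by (intro powr_mono mult_left_mono) auto
    also have "\<dots> = 2 powr d * (2 powr y) powr d" by (simp add: powr_powr powr_add[symmetric] algebra_simps)
    also have "2 powr y = x / x0" using x x0 by (simp add: y_def)
    also have "2 powr d * (x / x0) powr d \<le> 2 powr d * x powr d"
      using x x0 d by (intro mult_left_mono powr_mono2) (auto simp: divide_le_eq mult_le_cancel_left1)
    finally show ?thesis using pos[OF x0] by (simp add: mult_ac)
  qed
  have "eventually (\<lambda>n. x0 \<le> real n) sequentially"
    using filterlim_real_sequentially by (simp add: filterlim_at_top)
  then show ?thesis using eventually_const_le_powr[OF d, of "2 powr d * \<psi> x0"]
  proof eventually_elim
    case (elim n)
    have "\<psi> (real n) \<le> (2 powr d * \<psi> x0) * real n powr d" using bound elim by auto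
    also have "\<dots> \<le> real n powr d * real n powr d" using elim by (intro mult_right_mono) auto
    also have "\<dots> = real n powr e" using elim x0 by (simp add: powr_add[symmetric] d_def)
    finally show ?case .
  qed
qed

subsection \<open>Existence of the set\<close>

lemma doubling_iterate:
  fixes F :: "nat \<Rightarrow> real"
  assumes D: "D \<ge> 1" and pos: "\<And>n. n \<ge> n1 \<Longrightarrow> F n > 0"
    and mono: "\<And>m n. n1 \<le> m \<Longrightarrow> m \<le> n \<Longrightarrow> F m \<le> F n"
    and dbl: "\<And>n. n \<ge> n1 \<Longrightarrow> F (2 * n) \<le> D * F n"
    and k: "n1 \<le> k" "k \<le> n" "n \<le> k * E"
  shows "F n \<le> D ^ E * F k"
proof -
  have "F (2 ^ i * k) \<le> D ^ i * F k" for i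
  proof (induction i)
    case (Suc i)
    have "1 * k \<le> 2 ^ i * k" by (intro mult_le_mono1) simp
    then have "n1 \<le> 2 ^ i * k" using k by linarith
    then have "F (2 * (2 ^ i * k)) \<le> D * F (2 ^ i * k)" by (rule dbl)
    also have "\<dots> \<le> D * (D ^ i * F k)" using Suc D by (intro mult_left_mono) auto
    finally show ?case by (simp add: mult.assoc)
  qed simp
  note this[of E]
  moreover have "k * E \<le> 2 ^ E * k" using less_exp[of E] by (simp add: mult.commute less_imp_le)
  then have "n \<le> 2 ^ E * k" using k by linarith
  then have "F n \<le> F (2 ^ E * k)" using k by (intro mono) auto
  ultimately show ?thesis by linarith
qed

text \<open>The constants have to be fixed in the order \<open>E\<close>, \<open>D\<close>,
  \<open>L\<close>, \<open>K\<close>, \<open>k0\<close>. The constant \<open>C4\<close> depends on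
  \<open>K\<close> through \<open>Cu\<close>, but it enters only conditions that hold for all large
  n, so it affects only \<open>k0\<close>.\<close>

lemma basis_of_prescribed_growth:
  fixes h :: nat and b :: "nat \<Rightarrow> nat" and F \<psi> :: "nat \<Rightarrow> real" and n1 \<Lambda> :: nat
  assumes h2: "h \<ge> 2" and bpos: "\<forall>i\<in>{1..h}. b i > 0" and bgcd: "Gcd (b ` {1..h}) = 1"
    and pos: "\<And>n. n \<ge> n1 \<Longrightarrow> F n > 0"
    and mono: "\<And>m n. n1 \<le> m \<Longrightarrow> m \<le> n \<Longrightarrow> F m \<le> F n"
    and D0: "D0 \<ge> 1" and dbl: "\<And>n. n \<ge> n1 \<Longrightarrow> F (2 * n) \<le> D0 * F n"
    and \<Lambda>: "\<Lambda> \<ge> 2" and growth: "\<And>m n. n1 \<le> m \<Longrightarrow> m * \<Lambda> \<le> n \<Longrightarrow> 2 * F m \<le> F n"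
    and C: "C > 0" "\<And>n. n \<ge> n1 \<Longrightarrow> F n \<le> C * real n"
    and c: "c > 0" "\<And>n. n \<ge> n1 \<Longrightarrow> c * (real n * \<psi> n) \<le> F n ^ h"
    and Cv: "Cv > 0" "\<And>n. n \<ge> n1 \<Longrightarrow> F n ^ (h - 1) \<le> Cv * (real n * \<psi> n)"
    and \<psi>_mono: "\<And>m n. n1 \<le> m \<Longrightarrow> m \<le> n \<Longrightarrow> \<psi> m \<le> \<psi> n"
    and Cl: "Cl > 0" "\<And>n. n \<ge> n1 \<Longrightarrow> ln (real n) \<le> Cl * \<psi> n"
    and \<psi>_small: "\<And>e. e > 0 \<Longrightarrow> eventually (\<lambda>n. \<psi> n \<le> real n powr e) sequentially"
  shows "\<exists>A. 0 \<notin> A \<and> (\<lambda>n. real (card (A \<inter> {..n}))) \<in> \<Theta>(F)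
    \<and> (\<lambda>n. real (reps b {1..h} A n)) \<in> \<Theta>(\<lambda>n. F n ^ h / real n)"
proof -
  \<comment> \<open>The factor \<open>\<Lambda>\<close> makes \<open>F\<close> double over a ratio
    \<open>E\<close>, the other factor makes the largest entry of a representation at least
    \<open>n / E\<close>.\<close>
  define E where "E = 8 * sum b {1..h} * \<Lambda>"
  have E8: "8 * sum b {1..h} \<le> E" unfolding E_def using \<Lambda> by simp
  have bh: "b h \<ge> 1" using bpos h2 by (simp add: Suc_le_eq)
  have "b h \<le> sum b {1..h}" using h2 by (intro member_le_sum) auto
  then have H1: "sum b {1..h} \<ge> 1" using bh by linarith
  have E\<Lambda>: "\<Lambda> \<le> E" using H1 mult_le_mono1[of 1 "8 * sum b {1..h}" \<Lambda>] unfolding E_def by linarith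
  have E1: "E \<ge> 8" using E8 H1 by linarith
  define D where "D = real E + D0 ^ E"
  have D0E: "D0 ^ E \<ge> 1" using D0 by (intro one_le_power)
  have DE: "real E \<le> D" "D0 ^ E \<le> D" "D > 0" using D0E E1 by (auto simp: D_def)
  let ?\<delta> = "1 / (4 * real h)"
  let ?\<sigma> = "ln 2 / (8 * real h * ln (real E))"
  let ?Q = "32 * real h * 2 ^ h"
  let ?C1 = "4 * D + 2"
  let ?c2 = "1 / (8 * real E * real (b h) * D)"
  let ?c7 = "?c2 ^ (h - 1) / D"
  have c7: "?c7 > 0" using E1 bh DE by auto
  define L where "L = 1 + 12 * ?Q ^ h / ?c7"
  have "0 \<le> 12 * ?Q ^ h / ?c7" by (rule divide_nonneg_pos[OF _ c7]) simp
  then have L1: "L \<ge> 1" unfolding L_def by linarith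
  have L7: "12 * ?Q ^ h \<le> L * ?c7"
  proof -
    have "L * ?c7 = ?c7 + 12 * ?Q ^ h" unfolding L_def using less_imp_neq[OF c7]
      by (simp only: distrib_right mult_1 nonzero_eq_divide_eq nonzero_divide_eq_eq times_divide_eq_left
          nonzero_mult_div_cancel_right not_sym simp_thms)
    then show ?thesis using c7 by linarith
  qed
  \<comment> \<open>Chosen so that
    \<open>L * n * ln n \<le> L * Cl * n * \<psi> n \<le> (K * F n) ^ h\<close>.\<close>
  define K where "K = 1 + L * Cl / c"
  have "L * Cl / c > 0" using L1 Cl c by auto
  then have K1: "K \<ge> 1" by (simp add: K_def)
  have KL: "L * Cl / c \<le> K ^ h"
  proof -
    have "L * Cl / c \<le> K" by (simp add: K_def)
    also have "K ^ 1 \<le> K ^ h" using K1 h2 by (intro power_increasing) auto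
    finally show ?thesis by simp
  qed
  define G where "G n = min (real n) (K * F n)" for n
  define Cu where "Cu = K ^ (h - 1) * Cv"
  define c0 where "c0 = min 1 c"
  have const_pos: "Cu > 0" "c0 > 0" using K1 Cv c by (auto simp: Cu_def c0_def)
  let ?C4 = "2 ^ h * (2 * D * ?C1 ^ h * Cu + 3 * ?Q ^ h * Cl)"
  have C4: "?C4 > 0" using DE const_pos Cl h2 by (intro mult_pos_pos add_pos_pos) auto
  have \<delta>: "?\<delta> > 0" using h2 by simp
  have \<sigma>: "?\<sigma> > 0" using h2 E1 by simp
  have Gpos: "G n \<ge> 0" if "n \<ge> n1" for n using pos[OF that] K1 by (simp add: G_def)
  have Gup: "G n ^ (h - 1) \<le> Cu * (real n * \<psi> n)" if "n \<ge> n1" for n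
  proof -
    have "G n ^ (h - 1) \<le> (K * F n) ^ (h - 1)" using Gpos[OF that] by (intro power_mono) (auto simp: G_def)
    also have "\<dots> = K ^ (h - 1) * F n ^ (h - 1)" by (simp add: power_mult_distrib)
    also have "\<dots> \<le> K ^ (h - 1) * (Cv * (real n * \<psi> n))" using K1 Cv(2)[OF that] by (intro mult_left_mono) auto
    finally show ?thesis by (simp add: Cu_def mult_ac)
  qed
  \<comment> \<open>Where the minimum in \<open>G\<close> is \<open>n\<close>, the bound by
    \<open>n ^ 2\<close> suffices because \<open>h \<ge> 2\<close>.\<close>
  have G_cases: "X \<le> G n ^ h" if "X \<le> real n ^ 2" "X \<le> K ^ h * F n ^ h" "n \<ge> 1" for X n
  proof (cases "real n \<le> K * F n")
    case True
    have "real n ^ 2 \<le> real n ^ h" using that h2 by (intro power_increasing) auto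
    then show ?thesis using True that by (simp add: G_def)
  next
    case False
    then show ?thesis using that by (simp add: G_def power_mult_distrib)
  qed
  define cc where "cc = ?c7"
  define CC where "CC = ?C4"
  have cc: "cc > 0" and CC: "CC > 0" using c7 C4 by (simp_all only: cc_def CC_def)
  \<comment> \<open>All growth conditions that hold only for large n. The constants
    \<open>cc\<close> and \<open>CC\<close> stand for \<open>c7\<close> and \<open>C4\<close> and
    depend on nothing chosen later.\<close>
  define asym where "asym n \<longleftrightarrow> n \<ge> 3 \<and> \<psi> n \<le> real n \<and> L * ln (real n) \<le> real n powr 1 \<and>
    24 * real E * real (b h) * D * ln (real n) \<le> real n powr (1 / real h) \<and>
    D * ?C1 ^ h \<le> real n powr (?\<delta> / 2) \<and>
    Cu * \<psi> n \<le> real n powr (3 * ?\<delta>) \<and>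
    12 * CC * \<psi> n * ln (real n) \<le> cc * real n powr (1 / (2 * real h)) \<and>
    real E \<le> real n powr ?\<delta> \<and>
    3 * CC * \<psi> n * ln (real n) \<le> real n powr ?\<delta> \<and>
    6 * D * ?C1 ^ (h - 1) \<le> real n powr ?\<sigma>" for n
  have \<psi>ln: "eventually (\<lambda>n. a * \<psi> n * ln (real n) \<le> real n powr e) sequentially" if "e > 0" "a > 0" for a e
    using \<psi>_small[OF half_gt_zero[OF \<open>e > 0\<close>]] eventually_ln_le_powr[OF half_gt_zero[OF \<open>e > 0\<close>], of a]
      eventually_ge_at_top[of 1]
  proof eventually_elim
    case (elim n)
    have "a * \<psi> n * ln (real n) = \<psi> n * (a * ln (real n))" by simp
    also have "\<dots> \<le> real n powr (e / 2) * (a * ln (real n))"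
      using elim that by (intro mult_right_mono) auto
    also have "\<dots> \<le> real n powr (e / 2) * real n powr (e / 2)" using elim by (intro mult_left_mono) auto
    also have "\<dots> = real n powr e" using elim by (simp add: powr_add[symmetric])
    finally show ?case .
  qed
  have "eventually asym sequentially"
    unfolding asym_def
  proof (intro eventually_conj)
    show "eventually (\<lambda>n. \<psi> n \<le> real n) sequentially"
      using \<psi>_small[of 1] by simp
    show "eventually (\<lambda>n. Cu * \<psi> n \<le> real n powr (3 * ?\<delta>)) sequentially"
      using \<psi>_small[OF \<delta>] eventually_const_le_powr[OF \<delta>, of Cu] eventually_ge_at_top[of 1]
    proof eventually_elim
      case (elim n)
      have "Cu * \<psi> n \<le> Cu * real n powr ?\<delta>" using elim const_pos by (intro mult_left_mono) auto
      also have "\<dots> \<le> real n powr ?\<delta> * real n powr ?\<delta>" using elim by (intro mult_right_mono) auto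
      also have "\<dots> = real n powr (2 * ?\<delta>)" by (simp only: powr_add[symmetric] mult_2)
      also have "\<dots> \<le> real n powr (3 * ?\<delta>)" using elim \<delta> by (intro powr_mono mult_right_mono) auto
      finally show ?case .
    qed
    have "eventually (\<lambda>n. 12 * CC / cc * \<psi> n * ln (real n) \<le> real n powr (1 / (2 * real h))) sequentially"
      using cc CC h2 by (intro \<psi>ln divide_pos_pos) auto
    then show "eventually (\<lambda>n. 12 * CC * \<psi> n * ln (real n) \<le> cc * real n powr (1 / (2 * real h))) sequentially"
    proof eventually_elim
      case (elim n)
      then show ?case using cc by (simp add: field_simps)
    qed
    show "eventually (\<lambda>n. 3 * CC * \<psi> n * ln (real n) \<le> real n powr ?\<delta>) sequentially"
      using CC \<delta> by (intro \<psi>ln) auto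
  qed ((rule eventually_ge_at_top | (rule eventually_const_le_powr eventually_ln_le_powr, use \<delta> \<sigma> h2 in simp))+)
  then obtain n2 where n2: "\<And>n. n \<ge> n2 \<Longrightarrow> asym n" by (auto simp: eventually_sequentially)
  define k0 where "k0 = n1 + n2 + 4 * E * b h + 3 * 2 ^ (2 * h) + b h + 5"
  have k0: "k0 \<ge> n1" "k0 \<ge> n2" "k0 \<ge> 4 * E * b h" "k0 \<ge> 3 * 2 ^ (2 * h) + b h + 5" by (auto simp: k0_def)
  have as: "asym n" and nn1: "n \<ge> n1" and n3: "real n \<ge> 3" "n \<ge> 1" if "n \<ge> k0" for n
    using n2[of n] k0 that by (auto simp: k0_def)
  have ln1: "ln (real n) \<ge> 1" if "n \<ge> k0" for n
    using n3[OF that] exp_le by (subst ln_ge_iff) auto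
  have G_ln: "L * (real n * ln (real n)) \<le> G n ^ h" if n: "n \<ge> k0" for n
  proof (rule G_cases)
    have "real n * (L * ln (real n)) \<le> real n * real n"
      using as[OF n] n3[OF n] by (intro mult_left_mono) (auto simp: asym_def)
    then show "L * (real n * ln (real n)) \<le> (real n)\<^sup>2" by (simp add: power2_eq_square mult_ac)
    have "L * (real n * ln (real n)) \<le> L * (real n * (Cl * \<psi> n))"
      using Cl(2)[OF nn1[OF n]] L1 by (intro mult_left_mono) auto
    also have "\<dots> = (L * Cl / c) * (c * (real n * \<psi> n))" using c by simp
    also have "\<dots> \<le> K ^ h * F n ^ h"
    proof (intro mult_mono)
      have "0 \<le> \<psi> n" using Cl(2)[OF nn1[OF n]] ln1[OF n] Cl(1) by (smt (verit) mult_nonneg_nonpos)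
      then show "0 \<le> c * (real n * \<psi> n)" using c by auto
    qed (use KL c(2)[OF nn1[OF n]] K1 in auto)
    finally show "L * (real n * ln (real n)) \<le> K ^ h * F n ^ h" .
  qed (use n3[OF n] in auto)
  have G_root: "real n powr (1 / real h) \<le> G n" if n: "n \<ge> k0" for n
  proof (rule ccontr)
    assume "\<not> ?thesis"
    then have "G n ^ h < (real n powr (1 / real h)) ^ h"
      using Gpos[OF nn1[OF n]] h2 by (intro power_strict_mono) auto
    also have "\<dots> = (real n powr (1 / real h)) powr real h"
      using n3[OF n] by (intro powr_realpow[symmetric]) auto
    also have "\<dots> = real n" using h2 n3[OF n] by (simp add: powr_powr)
    also have "\<dots> \<le> L * (real n * ln (real n))"
    proof -
      have "1 * (real n * 1) \<le> L * (real n * ln (real n))"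
        using L1 ln1[OF n] by (intro mult_mono) auto
      then show ?thesis by simp
    qed
    finally show False using G_ln[OF n] by linarith
  qed
  have gd: "growth_data h b E D Cu Cl c0 L G \<psi> k0"
  proof (rule growth_data.intro)
    fix n assume n: "k0 \<le> n"
    show "G n \<le> real n" by (simp add: G_def)
    show "c0 * (real n * \<psi> n) \<le> G n ^ h"
    proof (rule G_cases)
      have \<psi>0: "0 \<le> \<psi> n" using Cl(2)[OF nn1[OF n]] ln1[OF n] Cl(1) by (smt (verit) mult_nonneg_nonpos)
      have "c0 * (real n * \<psi> n) \<le> 1 * (real n * real n)"
        using \<psi>0 as[OF n] c by (intro mult_mono) (auto simp: c0_def asym_def)
      then show "c0 * (real n * \<psi> n) \<le> (real n)\<^sup>2" by (simp add: power2_eq_square)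
      have "c0 * (real n * \<psi> n) \<le> c * (real n * \<psi> n)" using \<psi>0 by (intro mult_right_mono) (auto simp: c0_def)
      also have "\<dots> \<le> 1 * F n ^ h" using c(2)[OF nn1[OF n]] by simp
      also have "\<dots> \<le> K ^ h * F n ^ h" using K1 pos[OF nn1[OF n]] by (intro mult_right_mono one_le_power) auto
      finally show "c0 * (real n * \<psi> n) \<le> K ^ h * F n ^ h" .
    qed (use n3[OF n] in auto)
    show "24 * real E * real (b h) * D * ln (real n) \<le> G n"
      using G_root[OF n] as[OF n] unfolding asym_def by linarith
    show "G n ^ (h - 2) \<le> real n powr (1 - ?\<delta>)"
    proof -
      have r: "real n powr (1 / real h) > 0" using n3[OF n] by auto
      \<comment> \<open>The h - 1 factors are bounded by \<open>n powr (1 + 3 * \<delta>)\<close>;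
        dividing one of them out by \<open>G_root\<close> saves \<open>n powr (1 / h)\<close>, which
        is \<open>n powr (4 * \<delta>)\<close>.\<close>
      have "G n ^ (h - 2) * real n powr (1 / real h) \<le> G n ^ (h - 2) * G n"
        using G_root[OF n] Gpos[OF nn1[OF n]] by (intro mult_left_mono) auto
      also have "\<dots> = G n ^ (h - 1)" by (simp only: power_minus_one_expand[OF h2])
      also have "\<dots> \<le> Cu * (real n * \<psi> n)" by (rule Gup[OF nn1[OF n]])
      also have "\<dots> = real n * (Cu * \<psi> n)" by simp
      also have "\<dots> \<le> real n * real n powr (3 * ?\<delta>)"
        using as[OF n] by (intro mult_left_mono) (auto simp: asym_def)
      also have "\<dots> = real n powr 1 * real n powr (3 * ?\<delta>)" using n3[OF n] by simp
      also have "\<dots> = real n powr (1 + 3 * ?\<delta>)" by (simp only: powr_add)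
      also have "1 + 3 * ?\<delta> = (1 - ?\<delta>) + 1 / real h" using h2 by (simp add: field_simps)
      also have "real n powr \<dots> = real n powr (1 - ?\<delta>) * real n powr (1 / real h)" by (simp only: powr_add)
      finally show ?thesis using r by (simp only: mult_le_cancel_right_pos)
    qed
  next
    fix m n assume m: "k0 \<le> m" and mn: "m \<le> n"
    then show "G m \<le> G n"
      unfolding G_def using K1 mono[of m n] k0 by (intro min.mono mult_left_mono) auto
    show "\<psi> m \<le> \<psi> n" using m mn k0 by (intro \<psi>_mono) auto
  next
    fix k n assume k: "k0 \<le> k" "k \<le> n" "n \<le> k * E"
    have "F n \<le> D0 ^ E * F k"
      by (rule doubling_iterate[of D0 n1 F k n E]) (use D0 pos mono dbl k k0 in auto)
    also have "\<dots> \<le> D * F k" using DE pos[of k] k k0 by (intro mult_right_mono) auto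
    finally have 1: "K * F n \<le> D * (K * F k)" using K1 by (simp add: mult.left_commute mult_left_mono)
    have "real n \<le> real k * real E" using k(3) by (metis of_nat_le_iff of_nat_mult)
    also have "\<dots> \<le> real k * D" using DE by (intro mult_left_mono) auto
    finally have 2: "real n \<le> D * real k" by (simp add: mult.commute)
    show "G n \<le> D * G k" unfolding G_def min_mult_distrib_left using 1 2 DE by (simp add: min_def)
  next
    fix m n assume m: "k0 \<le> m" "m * E \<le> n"
    have "m * \<Lambda> \<le> m * E" using E\<Lambda> by simp
    then have "2 * F m \<le> F n" using m k0 by (intro growth) linarith+
    then have "2 * (K * F m) \<le> K * F n" using K1 by (simp add: mult.left_commute mult_left_mono)
    moreover have "2 * real m \<le> real n"
    proof -
      have "m * 2 \<le> m * E" using E1 by (intro mult_le_mono2) simp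
      then have "2 * m \<le> n" using m by linarith
      then show ?thesis by linarith
    qed
    ultimately show "2 * G m \<le> G n" by (simp add: G_def min_def)
  qed ((use h2 bpos bgcd E8 DE const_pos Cl L1 L7 k0 G_ln G_root Gup nn1 as[unfolded asym_def cc_def CC_def] in blast)+)
  then obtain A where A: "good_set h b E D Cu Cl c0 L G \<psi> k0 A"
    using growth_data.good_set_exists k0 by blast
  interpret good_set h b E D Cu Cl c0 L G \<psi> k0 ?\<delta> ?\<sigma> ?Q ?C1 ?C4 ?c2 ?c7
    "3 * ?Q ^ h + 3 * ?C4 / (c0 * ?\<sigma>)" A
    by (rule A) simp_all
  \<comment> \<open>The cut-off at \<open>n\<close> changes \<open>F\<close> only by a constant
    factor because \<open>F n \<le> C * n\<close>; hence \<open>G\<close> and \<open>F\<close> have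
    the same order.\<close>
  define a where "a = 1 / max 1 C"
  have a: "a > 0" "a \<le> 1" using C by (auto simp: a_def)
  have GF: "G n \<le> K * F n" "a * F n \<le> G n" if "n \<ge> k0" for n
  proof -
    show "G n \<le> K * F n" by (simp add: G_def)
    have F0: "F n > 0" by (rule pos[OF nn1[OF that]])
    have "F n \<le> max 1 C * real n" using C(2)[OF nn1[OF that]] mult_right_mono[of C "max 1 C" "real n"] by linarith
    then have "a * F n \<le> real n" by (simp add: a_def divide_le_eq mult.commute)
    moreover have "a * F n \<le> K * F n" using a K1 F0 by (intro mult_right_mono) auto
    ultimately show "a * F n \<le> G n" by (simp add: G_def)
  qed
  have Ek: "k0 \<le> E * k0" using E1 by simp
  show ?thesis
  proof (intro exI[of _ A] conjI)
    show "0 \<notin> A" using A_ge k0_ge by fastforce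
    show "(\<lambda>n. real (card (A \<inter> {..n}))) \<in> \<Theta>(F)"
    proof (rule bigthetaI'[of "?c2 * a" "?C1 * K"])
      show "eventually (\<lambda>n. ?c2 * a * norm (F n) \<le> norm (real (card (A \<inter> {..n}))) \<and>
        norm (real (card (A \<inter> {..n}))) \<le> ?C1 * K * norm (F n)) sequentially"
        using eventually_ge_at_top[of "E * k0"]
      proof eventually_elim
        case (elim n)
        then have nk: "n \<ge> k0" using Ek by linarith
        have F0: "F n > 0" by (rule pos[OF nn1[OF nk]])
        have "?c2 * (a * F n) \<le> ?c2 * G n" using GF[OF nk] DE by (intro mult_left_mono) auto
        moreover have "?C1 * G n \<le> ?C1 * (K * F n)" using GF[OF nk] DE by (intro mult_left_mono) auto
        ultimately show ?case using count_ge[OF elim] count_le[OF nk] F0 by (simp add: mult.assoc)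
      qed
    qed (use a E1 bh DE K1 in auto)
    let ?T = "3 * ?Q ^ h + 3 * ?C4 / (c0 * ?\<sigma>)"
    define M where "M = 2 ^ h * (2 * D * ?C1 ^ h + 4 / 3 * ?T)"
    have M0: "M > 0" unfolding M_def
    proof (rule mult_pos_pos[OF _ add_nonneg_pos[OF _ mult_pos_pos]])
      show "0 \<le> 2 * D * ?C1 ^ h" using D8 by simp
      show "0 < ?T" using T(3) by (rule less_le_trans[OF zero_less_one])
    qed auto
    show "(\<lambda>n. real (reps b {1..h} A n)) \<in> \<Theta>(\<lambda>n. F n ^ h / real n)"
    proof (rule bigthetaI'[of "?c7 / 4 * a ^ h" "M * K ^ h"])
      show "eventually (\<lambda>n. ?c7 / 4 * a ^ h * norm (F n ^ h / real n) \<le> norm (real (reps b {1..h} A n)) \<and>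
        norm (real (reps b {1..h} A n)) \<le> M * K ^ h * norm (F n ^ h / real n)) sequentially"
        using eventually_ge_at_top[of "E * k0"]
      proof eventually_elim
        case (elim n)
        then have nk: "n \<ge> k0" using Ek by linarith
        have F0: "F n > 0" by (rule pos[OF nn1[OF nk]])
        have "(a * F n) ^ h / real n \<le> \<mu> n"
          unfolding \<mu>_def using GF[OF nk] a F0 by (intro divide_right_mono power_mono) auto
        then have 1: "?c7 / 4 * (a ^ h * (F n ^ h / real n)) \<le> ?c7 / 4 * \<mu> n"
          using c7 by (intro mult_left_mono) (auto simp: power_mult_distrib)
        have "\<mu> n \<le> (K * F n) ^ h / real n"
          unfolding \<mu>_def using GF[OF nk] G_ge_1[OF nk] by (intro divide_right_mono power_mono) auto
        then have 2: "M * \<mu> n \<le> M * (K ^ h * (F n ^ h / real n))"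
          using M0 by (intro mult_left_mono) (auto simp: power_mult_distrib)
        have n: "norm (F n ^ h / real n) = F n ^ h / real n" using F0 by simp
        have "?c7 / 4 * (a ^ h * (F n ^ h / real n)) \<le> real (reps b {1..h} A n)"
          using 1 reps_ge_\<mu>[OF elim] by (rule order_trans)
        moreover have "real (reps b {1..h} A n) \<le> M * \<mu> n"
          using reps_le_\<mu>[OF nk] by (simp only: M_def mult.assoc)
        then have "real (reps b {1..h} A n) \<le> M * (K ^ h * (F n ^ h / real n))"
          using 2 by (rule order_trans)
        ultimately show ?case unfolding n mult.assoc by simp
      qed
    qed ((intro mult_pos_pos divide_pos_pos[OF c7] M0 zero_less_power; use a K1 in simp)+)
  qed
qed

theorem theorem4:
  fixes h :: nat and b :: "nat \<Rightarrow> nat" and \<psi> f :: "real \<Rightarrow> real"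
  assumes h2: "h \<ge> 2"
    and bpos: "\<forall>i\<in>{1..h}. b i > 0"
    and bgcd: "Gcd (b ` {1..h}) = 1"
    and sv: "slowly_varying \<psi>"
    and incr: "mono_on {1..} \<psi>"
    and logpsi: "(\<lambda>x. ln x) \<in> O(\<psi>)"
    and fpos: "\<forall>x\<ge>1. f x > 0"
    and floc: "\<forall>y\<ge>1. f integrable_on {1..y}"
    and lower: "(\<lambda>x. (x * \<psi> x) powr (1 / real h)) \<in> O(f)"
    and upper: "f \<in> O(\<lambda>x. min ((x * \<psi> x) powr (1 / (real h - 1))) x)"
    and intf: "(\<lambda>x. integral {1..x} (\<lambda>t. f t / t)) \<in> \<Theta>(f)"
  shows "\<exists>A :: nat set.
           (\<lambda>x. real (card {k\<in>A. 1 \<le> k \<and> real k \<le> x})) \<in> \<Theta>(f) \<and>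
           (\<lambda>n. real (rep_count b A h n)) \<in> \<Theta>(\<lambda>n. f (real n) ^ h / real n)"
proof -
  have \<psi>pos: "\<psi> x > 0" if "x \<ge> 1" for x using sv that by (auto simp: slowly_varying_def)
  obtain Cl where Cl: "Cl > 0" "eventually (\<lambda>x. norm (ln x) \<le> Cl * norm (\<psi> x)) at_top"
    using logpsi by (rule landau_o.bigE)
  obtain c1 where c1: "c1 > 0" "eventually (\<lambda>x. norm ((x * \<psi> x) powr (1 / real h)) \<le> c1 * norm (f x)) at_top"
    using lower by (rule landau_o.bigE)
  obtain c2 where c2: "c2 > 0"
    "eventually (\<lambda>x. norm (f x) \<le> c2 * norm (min ((x * \<psi> x) powr (1 / (real h - 1))) x)) at_top"
    using upper by (rule landau_o.bigE)
  obtain C1 where C1: "C1 > 0" "eventually (\<lambda>x. norm (integral {1..x} (\<lambda>t. f t / t)) \<le> C1 * norm (f x)) at_top"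
    using bigthetaD1[OF intf] by (rule landau_o.bigE)
  obtain c3 where c3: "c3 > 0" "eventually (\<lambda>x. norm (integral {1..x} (\<lambda>t. f t / t)) \<ge> c3 * norm (f x)) at_top"
    using bigthetaD2[OF intf] by (rule landau_omega.bigE)
  have "eventually (\<lambda>x. x \<ge> 1 \<and> norm (ln x) \<le> Cl * norm (\<psi> x) \<and>
      norm ((x * \<psi> x) powr (1 / real h)) \<le> c1 * norm (f x) \<and>
      norm (f x) \<le> c2 * norm (min ((x * \<psi> x) powr (1 / (real h - 1))) x) \<and>
      norm (integral {1..x} (\<lambda>t. f t / t)) \<le> C1 * norm (f x) \<and>
      norm (integral {1..x} (\<lambda>t. f t / t)) \<ge> c3 * norm (f x)) at_top"
    by (intro eventually_conj eventually_ge_at_top Cl c1 c2 C1 c3)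
  then obtain x1 where x1: "\<And>x. x \<ge> x1 \<Longrightarrow> x \<ge> 1 \<and> norm (ln x) \<le> Cl * norm (\<psi> x) \<and>
      norm ((x * \<psi> x) powr (1 / real h)) \<le> c1 * norm (f x) \<and>
      norm (f x) \<le> c2 * norm (min ((x * \<psi> x) powr (1 / (real h - 1))) x) \<and>
      norm (integral {1..x} (\<lambda>t. f t / t)) \<le> C1 * norm (f x) \<and>
      norm (integral {1..x} (\<lambda>t. f t / t)) \<ge> c3 * norm (f x)"
    by (auto simp: eventually_at_top_linorder)
  define x0 where "x0 = max x1 1"
  have x0_ge: "x0 \<ge> 1" "x0 \<ge> x1" by (auto simp: x0_def)
  \<comment> \<open>Needed to drop the norms from the asymptotic hypotheses; an integral that does
    not exist has the value 0.\<close>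
  have nonneg: "integral {1..x} (\<lambda>t. f t / t) \<ge> 0" for x
  proof (cases "(\<lambda>t. f t / t) integrable_on {1..x}")
    case True
    then show ?thesis using fpos by (intro integral_nonneg) (auto intro!: divide_nonneg_nonneg less_imp_le)
  next
    case False
    then show ?thesis by (simp add: not_integrable_integral)
  qed
  interpret log_density f C1 "1 / c3" x0
  proof
    fix x assume x: "x \<ge> x0"
    then have fx: "f x > 0" and x': "x \<ge> x1" using fpos x0_ge by auto
    show "integral {1..x} (\<lambda>t. f t / t) \<le> C1 * f x" using x1[OF x'] fx nonneg[of x] by simp
    show "f x \<le> 1 / c3 * integral {1..x} (\<lambda>t. f t / t)"
      using x1[OF x'] fx nonneg[of x] c3 by (simp add: field_simps)
  qed (use fpos floc x0_ge C1 c3 in auto)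
  note x0 = x0_ge
  have F\<Theta>: "F \<in> \<Theta>(f)" using intf by (simp add: F_def[abs_def])
  have low: "x * \<psi> x \<le> (c1 / c3) ^ h * F x ^ h" if x: "x \<ge> x0" for x
  proof -
    have x': "x \<ge> x1" "x \<ge> 1" using x x0 by auto
    have pos: "x * \<psi> x > 0" using \<psi>pos[OF x'(2)] x' by simp
    have "(x * \<psi> x) powr (1 / real h) \<le> c1 * f x" using x1[OF x'(1)] fpos[OF x'(2)] by simp
    also have "\<dots> \<le> c1 * (1 / c3 * F x)" using fF[OF x] c1 unfolding F_def by (intro mult_left_mono) auto
    finally have "((x * \<psi> x) powr (1 / real h)) ^ h \<le> (c1 / c3 * F x) ^ h" by (intro power_mono) auto
    moreover have "((x * \<psi> x) powr (1 / real h)) ^ h = ((x * \<psi> x) powr (1 / real h)) powr real h"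
      using pos by (intro powr_realpow[symmetric]) auto
    moreover have "\<dots> = x * \<psi> x" using pos h2 by (simp add: powr_powr)
    ultimately show ?thesis by (simp only: power_mult_distrib)
  qed
  have up: "F x \<le> C1 * c2 * (x * \<psi> x) powr (1 / (real h - 1))" "F x \<le> C1 * c2 * x" if x: "x \<ge> x0" for x
  proof -
    have x': "x \<ge> x1" "x \<ge> 1" using x x0 by auto
    have "f x \<le> c2 * min ((x * \<psi> x) powr (1 / (real h - 1))) x"
      using x1[OF x'(1)] fpos[OF x'(2)] x' by (auto simp: min_def split: if_splits)
    then have "C1 * f x \<le> C1 * (c2 * min ((x * \<psi> x) powr (1 / (real h - 1))) x)"
      using C1 by (intro mult_left_mono) auto
    then have "F x \<le> C1 * c2 * min ((x * \<psi> x) powr (1 / (real h - 1))) x"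
      using Ff[OF x] by (simp add: F_def mult.assoc)
    moreover have "C1 * c2 > 0" using C1 c2 by simp
    ultimately show "F x \<le> C1 * c2 * (x * \<psi> x) powr (1 / (real h - 1))" "F x \<le> C1 * c2 * x"
      by (meson min.cobounded1 min.cobounded2 mult_left_mono less_imp_le order_trans)+
  qed
  have up': "F x ^ (h - 1) \<le> (C1 * c2) ^ (h - 1) * (x * \<psi> x)" if x: "x \<ge> x0" for x
  proof -
    have x': "x \<ge> 1" using x x0 by auto
    have pos: "x * \<psi> x > 0" using \<psi>pos[OF x'] x' by simp
    have "F x ^ (h - 1) \<le> (C1 * c2 * (x * \<psi> x) powr (1 / (real h - 1))) ^ (h - 1)"
      using up(1)[OF x] F_pos[OF x] by (intro power_mono) auto
    also have "\<dots> = (C1 * c2) ^ (h - 1) * ((x * \<psi> x) powr (1 / (real h - 1))) ^ (h - 1)"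
      by (rule power_mult_distrib)
    also have "((x * \<psi> x) powr (1 / (real h - 1))) ^ (h - 1) = ((x * \<psi> x) powr (1 / (real h - 1))) powr real (h - 1)"
      using pos by (intro powr_realpow[symmetric]) auto
    also have "\<dots> = x * \<psi> x" using pos h2 by (simp add: powr_powr of_nat_diff)
    finally show ?thesis .
  qed
  obtain D where D: "D \<ge> 1" "\<And>x. x \<ge> x0 \<Longrightarrow> F (2 * x) \<le> D * F x" using F_doubling by blast
  obtain \<Lambda> :: nat where \<Lambda>: "\<Lambda> \<ge> 2" "\<And>x y. x0 \<le> x \<Longrightarrow> x * real \<Lambda> \<le> y \<Longrightarrow> 2 * F x \<le> F y"
    using F_growth by blast
  define n1 where "n1 = nat \<lceil>x0\<rceil>"
  have n1: "real n \<ge> x0" "real n \<ge> 1" if "n \<ge> n1" for n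
    using that x0 unfolding n1_def by linarith+
  have "\<exists>A. 0 \<notin> A \<and> (\<lambda>n. real (card (A \<inter> {..n}))) \<in> \<Theta>(\<lambda>n. F (real n))
    \<and> (\<lambda>n. real (reps b {1..h} A n)) \<in> \<Theta>(\<lambda>n. F (real n) ^ h / real n)"
  proof (rule basis_of_prescribed_growth[OF h2 bpos bgcd, where ?n1.0 = n1 and \<psi> = "\<lambda>n. \<psi> (real n)"
        and ?D0.0 = D and \<Lambda> = \<Lambda> and C = "C1 * c2" and c = "1 / (c1 / c3) ^ h" and Cv = "(C1 * c2) ^ (h - 1)" and Cl = Cl])
    fix n assume n: "n \<ge> n1"
    show "F (real n) > 0" using F_pos n1[OF n] by simp
    show "F (real (2 * n)) \<le> D * F (real n)" using D(2) n1[OF n] by simp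
    show "F (real n) \<le> C1 * c2 * real n" using up(2) n1[OF n] by simp
    show "1 / (c1 / c3) ^ h * (real n * \<psi> (real n)) \<le> F (real n) ^ h"
      using low[OF n1(1)[OF n]] c1 c3 by (simp add: field_simps)
    show "F (real n) ^ (h - 1) \<le> (C1 * c2) ^ (h - 1) * (real n * \<psi> (real n))" by (rule up'[OF n1(1)[OF n]])
    show "ln (real n) \<le> Cl * \<psi> (real n)"
      using x1[of "real n"] n1[OF n] x0 \<psi>pos[of "real n"] by auto
  next
    fix m n assume mn: "n1 \<le> m" "m \<le> n"
    show "F (real m) \<le> F (real n)" using n1[OF mn(1)] mn by (intro F_mono) auto
    show "\<psi> (real m) \<le> \<psi> (real n)" using n1[OF mn(1)] mn by (intro mono_onD[OF incr]) auto
  next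
    fix m n assume mn: "n1 \<le> m" "m * \<Lambda> \<le> n"
    then have "real m * real \<Lambda> \<le> real n" by (metis of_nat_le_iff of_nat_mult)
    then show "2 * F (real m) \<le> F (real n)" using \<Lambda>(2) n1[OF mn(1)] by blast
  qed (use D \<Lambda> C1 c1 c2 c3 Cl slowly_varying_le_powr[OF sv incr] in auto)
  then obtain A where A0: "0 \<notin> A" and A1: "(\<lambda>n. real (card (A \<inter> {..n}))) \<in> \<Theta>(\<lambda>n. F (real n))"
    and A2: "(\<lambda>n. real (reps b {1..h} A n)) \<in> \<Theta>(\<lambda>n. F (real n) ^ h / real n)" by blast
  \<comment> \<open>Composition with the integer part carries the estimate from integers to real x.
    As \<open>0 \<notin> A\<close>, the lower limit 1 in the counting set changes nothing.\<close>
  have lim: "filterlim (\<lambda>x :: real. nat \<lfloor>x\<rfloor>) sequentially at_top"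
    by (intro filterlim_compose[OF filterlim_nat_sequentially] filterlim_floor_sequentially)
  have "(\<lambda>x. real (card {k\<in>A. 1 \<le> k \<and> real k \<le> x})) = (\<lambda>x. real (card (A \<inter> {..nat \<lfloor>x\<rfloor>})))"
  proof
    fix x :: real
    have "k \<in> A \<and> 1 \<le> k \<and> real k \<le> x \<longleftrightarrow> k \<in> A \<and> k \<le> nat \<lfloor>x\<rfloor>" for k
    proof (cases "k = 0")
      case False
      then have "k \<le> nat \<lfloor>x\<rfloor> \<longleftrightarrow> real k \<le> x" by linarith
      then show ?thesis using False by auto
    qed (use A0 in auto)
    then show "real (card {k\<in>A. 1 \<le> k \<and> real k \<le> x}) = real (card (A \<inter> {..nat \<lfloor>x\<rfloor>}))"
      by (intro arg_cong[where f="\<lambda>S. real (card S)"]) auto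
  qed
  also have "\<dots> \<in> \<Theta>(\<lambda>x. F (real (nat \<lfloor>x\<rfloor>)))"
    by (rule landau_theta.compose[OF A1 lim])
  also have "(\<lambda>x. F (real (nat \<lfloor>x\<rfloor>))) \<in> \<Theta>(F)"
  \<comment> \<open>The integer part y of x satisfies \<open>y \<le> x \<le> 2 * y\<close>, so one
    doubling of \<open>F\<close> bridges the gap.\<close>
  proof (rule bigthetaI'[of "1 / D" 1])
    show "eventually (\<lambda>x. 1 / D * norm (F x) \<le> norm (F (real (nat \<lfloor>x\<rfloor>))) \<and> norm (F (real (nat \<lfloor>x\<rfloor>))) \<le> 1 * norm (F x)) at_top"
      using eventually_ge_at_top[of "x0 + 1"]
    proof eventually_elim
      case (elim x)
      define y where "y = real (nat \<lfloor>x\<rfloor>)"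
      have y: "y \<le> x" "x \<le> 2 * y" "y \<ge> x0" using elim x0 unfolding y_def by linarith+
      have "F x \<le> F (2 * y)" using y x0 elim by (intro F_mono) auto
      also have "\<dots> \<le> D * F y" by (rule D(2)[OF y(3)])
      finally have 1: "F x \<le> D * F y" .
      have 2: "F y \<le> F x" using y x0 by (intro F_mono) auto
      have "F y > 0" "F x > 0" using F_pos y by auto
      then show ?case using 1 2 D(1) unfolding y_def[symmetric] by (simp add: divide_le_eq mult.commute)
    qed
  qed (use D in auto)
  also note F\<Theta>
  finally have B1: "(\<lambda>x. real (card {k\<in>A. 1 \<le> k \<and> real k \<le> x})) \<in> \<Theta>(f)" .
  have Fn: "(\<lambda>n. F (real n)) \<in> \<Theta>(\<lambda>n. f (real n))"
    by (rule landau_theta.compose[OF F\<Theta> filterlim_real_sequentially])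
  have "(\<lambda>n. F (real n) ^ h) \<in> \<Theta>(\<lambda>n. f (real n) ^ h)"
    by (rule bigthetaI[OF landau_o.big_power[OF bigthetaD1[OF Fn]] landau_omega.big_power[OF bigthetaD2[OF Fn]]])
  then have "(\<lambda>n. F (real n) ^ h / real n) \<in> \<Theta>(\<lambda>n. f (real n) ^ h / real n)"
    by (rule landau_theta.divide_right[rotated]) (auto intro: eventually_mono[OF eventually_gt_at_top[of 0]])
  then have "(\<lambda>n. real (rep_count b A h n)) \<in> \<Theta>(\<lambda>n. f (real n) ^ h / real n)"
    unfolding rep_count_eq_reps using A2 landau_theta.trans by blast
  then show ?thesis using B1 by blast
qed

end
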